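(* Let $\mathbb{F}_q$ be a finite field of characteristic $p$, and let $W_2(\mathbb{F}_q)$ be the ring of ($p$-typical) Witt vectors of length two over $\mathbb{F}_q$. For all integers $n\geq 1$ and $d\geq 1$, we have $$\#\mathrm{Irr}_d\big(\mathrm{SL}_n(\mathbb{F}_q[t]/t^2)\big)=\#\mathrm{Irr}_d\big(\mathrm{SL}_n(W_2(\mathbb{F}_q))\big).$$
   Context: For a finite group $G$ and an integer $d\geq 1$, $\mathrm{Irr}_d(G)$ denotes the set of isomorphism classes of irreducible complex representations of $G$ of dimension $d$. *)

theory Defs
  imports
    "HOL-Computational_Algebra.Computational_Algebra"
    "Jordan_Normal_Form.Char_Poly"
    "Jordan_Normal_Form.VS_Connect"
begin

section \<open>The ring $R[t]/(t^2)$\<close>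

quotient_type (overloaded) 'a poly_mod_t2 =
  "'a::comm_ring_1 poly" / "\<lambda>f g. [:0, 1:] ^ 2 dvd f - g"
proof (rule equivpI)
  show "reflp (\<lambda>f g :: 'a poly. [:0, 1:] ^ 2 dvd f - g)"
    by (rule reflpI) simp
  show "symp (\<lambda>f g :: 'a poly. [:0, 1:] ^ 2 dvd f - g)"
    by (rule sympI) (metis dvd_minus_iff minus_diff_eq)
  show "transp (\<lambda>f g :: 'a poly. [:0, 1:] ^ 2 dvd f - g)"
  proof (rule transpI)
    fix f g h :: "'a poly"
    assume "[:0, 1:] ^ 2 dvd f - g" "[:0, 1:] ^ 2 dvd g - h"
    from dvd_add[OF this] show "[:0, 1:] ^ 2 dvd f - h" by simp
  qed
qed

lemma eq_imp_t2_dvd_diff: "f = g \<Longrightarrow> [:0, 1:] ^ 2 dvd f - g"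
  for f g :: "'a::comm_ring_1 poly"
  by simp

instantiation poly_mod_t2 :: (comm_ring_1) comm_ring_1
begin

lift_definition zero_poly_mod_t2 :: "'a poly_mod_t2" is 0 .
lift_definition one_poly_mod_t2 :: "'a poly_mod_t2" is 1 .

lift_definition plus_poly_mod_t2 :: "'a poly_mod_t2 \<Rightarrow> 'a poly_mod_t2 \<Rightarrow> 'a poly_mod_t2" is "(+)"
  by (simp only: add_diff_add dvd_add)

lift_definition uminus_poly_mod_t2 :: "'a poly_mod_t2 \<Rightarrow> 'a poly_mod_t2" is uminus
  by (metis dvd_minus_iff minus_diff_minus)

lift_definition minus_poly_mod_t2 :: "'a poly_mod_t2 \<Rightarrow> 'a poly_mod_t2 \<Rightarrow> 'a poly_mod_t2" is "(-)"
proof -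
  fix f f' g g' :: "'a poly"
  assume "[:0, 1:] ^ 2 dvd f - f'" "[:0, 1:] ^ 2 dvd g - g'"
  from dvd_diff[OF this] show "[:0, 1:] ^ 2 dvd f - g - (f' - g')"
    by (simp add: algebra_simps)
qed

lift_definition times_poly_mod_t2 :: "'a poly_mod_t2 \<Rightarrow> 'a poly_mod_t2 \<Rightarrow> 'a poly_mod_t2" is "(*)"
proof -
  fix f f' g g' :: "'a poly"
  assume "[:0, 1:] ^ 2 dvd f - f'" "[:0, 1:] ^ 2 dvd g - g'"
  then have "[:0, 1:] ^ 2 dvd (f - f') * g + f' * (g - g')"
    by (intro dvd_add dvd_mult dvd_mult2)
  then show "[:0, 1:] ^ 2 dvd f * g - f' * g'"
    by (simp add: algebra_simps)
qed

instance
proof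
  show "(0 :: 'a poly_mod_t2) \<noteq> 1"
  proof (transfer, rule notI)
    assume "[:0, 1:] ^ 2 dvd (0 :: 'a poly) - 1"
    then obtain h :: "'a poly" where "0 - 1 = [:0, 1:] ^ 2 * h" by (elim dvdE)
    from arg_cong[OF this, of "\<lambda>f. coeff f 0"] show False
      by (simp add: power2_eq_square)
  qed
qed (transfer, rule eq_imp_t2_dvd_diff, simp add: algebra_simps)+

end


section \<open>Witt vectors of length two\<close>

text \<open>
  The \<open>p\<close>-typical Witt vectors of length two are the pairs $(x_0, x_1)$ with the ring structure
  for which the Witt polynomials $w_0 = X_0$ and $w_1 = X_0^p + p X_1$ are ring homomorphisms,
  functorially in the coefficient ring. For addition this forces
  $S_1 = X_1 + Y_1 + (X_0^p + Y_0^p - (X_0 + Y_0)^p) / p$, where the quotient is the following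
  polynomial with integer coefficients.
\<close>

definition witt_carry :: "nat \<Rightarrow> 'a::comm_ring_1 \<Rightarrow> 'a \<Rightarrow> 'a" where
  "witt_carry p x y = - (\<Sum>i=1..<p. of_nat ((p choose i) div p) * x ^ i * y ^ (p - i))"

lemma of_nat_mult_witt_carry:
  fixes x y :: "'a::comm_ring_1"
  assumes p: "prime p"
  shows "of_nat p * witt_carry p x y = x ^ p + y ^ p - (x + y) ^ p"
proof -
  have p0: "p > 0" using p prime_gt_0_nat by blast
  have "(x + y) ^ p = (\<Sum>i\<in>{..p}. of_nat (p choose i) * x ^ i * y ^ (p - i))"
    by (rule binomial_ring)
  also have "{..p} = insert 0 (insert p {1..<p})" using p0 by auto
  also have "(\<Sum>i\<in>\<dots>. of_nat (p choose i) * x ^ i * y ^ (p - i))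
      = y ^ p + x ^ p + (\<Sum>i=1..<p. of_nat (p choose i) * x ^ i * y ^ (p - i))"
    using p0 by (simp add: add.assoc)
  also have "(\<Sum>i=1..<p. of_nat (p choose i) * x ^ i * y ^ (p - i))
      = of_nat p * (\<Sum>i=1..<p. of_nat ((p choose i) div p) * x ^ i * y ^ (p - i))"
  proof (unfold sum_distrib_left, rule sum.cong[OF refl])
    fix i assume "i \<in> {1..<p}"
    then have "p dvd (p choose i)" using p by (intro dvd_choose_prime) auto
    then have "of_nat (p choose i) = (of_nat p * of_nat ((p choose i) div p) :: 'a)"
      by (metis dvd_mult_div_cancel of_nat_mult)
    then show "of_nat (p choose i) * x ^ i * y ^ (p - i)
        = of_nat p * (of_nat ((p choose i) div p) * x ^ i * y ^ (p - i))"
      by (simp add: mult.assoc)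
  qed
  finally show ?thesis by (simp add: witt_carry_def)
qed

lemma witt_carry_commute: "witt_carry p x y = witt_carry p y x"
  unfolding witt_carry_def
  by (rule arg_cong[of _ _ uminus], rule sum.reindex_bij_witness[of _ "\<lambda>i. p - i" "\<lambda>i. p - i"])
     (auto simp: binomial_symmetric[symmetric] mult_ac)

lemma witt_carry_0 [simp]: "witt_carry p 0 x = 0" "witt_carry p x 0 = 0"
  by (auto simp: witt_carry_def power_0_left intro!: sum.neutral)

lemma witt_carry_mult: "witt_carry p (x * z) (y * z) = witt_carry p x y * z ^ p"
proof -
  have "(x * z) ^ i * (y * z) ^ (p - i) = x ^ i * y ^ (p - i) * z ^ p" if "i \<in> {1..<p}" for i
  proof -
    have "z ^ p = z ^ i * z ^ (p - i)" using that by (simp flip: power_add)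
    then show ?thesis by (simp add: power_mult_distrib mult_ac)
  qed
  then show ?thesis
    unfolding witt_carry_def by (simp add: sum_distrib_right mult.assoc)
qed

lemma (in comm_ring_hom) hom_witt_carry:
  "hom (witt_carry p x y) = witt_carry p (hom x) (hom y)"
  unfolding witt_carry_def by (simp add: hom_distribs)

lemma comm_ring_hom_poly_map_poly:
  assumes "comm_ring_hom h"
  shows "comm_ring_hom (\<lambda>f. poly (map_poly h f) c)"
proof -
  interpret h: comm_ring_hom h by fact
  interpret m: map_poly_comm_ring_hom h ..
  show ?thesis by unfold_locales (simp_all add: hom_distribs)
qed

text \<open>
  Associativity of Witt vector addition is checked in the torsion-free ring $\mathbb{Z}[X,Y,Z]$
  and then specialised.
\<close>
lemma witt_carry_assoc:
  fixes x y z :: "'a::comm_ring_1"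
  assumes p: "prime p"
  shows "witt_carry p x y + witt_carry p (x + y) z = witt_carry p y z + witt_carry p x (y + z)"
proof -
  define X Y Z :: "int poly poly poly" where "X = [:[:[:0, 1:]:]:]" and "Y = [:[:0, 1:]:]"
    and "Z = [:0, 1:]"
  have "of_nat p * (witt_carry p X Y + witt_carry p (X + Y) Z)
      = of_nat p * (witt_carry p Y Z + witt_carry p X (Y + Z))"
    by (simp add: distrib_left of_nat_mult_witt_carry[OF p] add.assoc)
  moreover have "of_nat p \<noteq> (0 :: int poly poly poly)"
    using p by (metis not_prime_0 of_nat_eq_0_iff)
  ultimately have *: "witt_carry p X Y + witt_carry p (X + Y) Z
      = witt_carry p Y Z + witt_carry p X (Y + Z)"
    by simp
  define h1 :: "int poly \<Rightarrow> 'a" where "h1 f = poly (map_poly of_int f) x" for f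
  define h2 where "h2 f = poly (map_poly h1 f) y" for f
  define h3 where "h3 f = poly (map_poly h2 f) z" for f
  have "comm_ring_hom (of_int :: int \<Rightarrow> 'a)" ..
  then have h1: "comm_ring_hom h1"
    unfolding h1_def by (rule comm_ring_hom_poly_map_poly)
  then have h2: "comm_ring_hom h2"
    unfolding h2_def by (rule comm_ring_hom_poly_map_poly)
  then have h3: "comm_ring_hom h3"
    unfolding h3_def by (rule comm_ring_hom_poly_map_poly)
  interpret h1: comm_ring_hom h1 by (rule h1)
  interpret h2: comm_ring_hom h2 by (rule h2)
  interpret h3: comm_ring_hom h3 by (rule h3)
  have h1X: "h1 [:0, 1:] = x" by (simp add: h1_def)
  have "h2 [:[:0, 1:]:] = x" "h2 [:0, 1:] = y" by (simp_all add: h2_def h1X)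
  then have "h3 X = x" "h3 Y = y" "h3 Z = z" by (simp_all add: h3_def X_def Y_def Z_def)
  with arg_cong[OF *, of h3] show ?thesis
    by (simp add: h3.hom_witt_carry hom_distribs)
qed

datatype 'a witt2 = Witt2 (witt_fst: 'a) (witt_snd: 'a)

instantiation witt2 :: (comm_ring_prime_char) comm_ring_1
begin

definition "0 = Witt2 (0 :: 'a) 0"

definition "1 = Witt2 (1 :: 'a) 0"

definition "x + y = Witt2 (witt_fst x + witt_fst y)
  (witt_snd x + witt_snd y + witt_carry CHAR('a) (witt_fst x) (witt_fst y))"
  for x y :: "'a witt2"

text \<open>
  The second component of the product, likewise forced by $w_1$, over any coefficient ring;
  its last term vanishes here since \<open>CHAR('a) = p\<close>.
\<close>
definition "x * y = Witt2 (witt_fst x * witt_fst y)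
  (witt_fst x ^ CHAR('a) * witt_snd y + witt_snd x * witt_fst y ^ CHAR('a)
   + of_nat CHAR('a) * witt_snd x * witt_snd y)"
  for x y :: "'a witt2"

definition "- x = Witt2 (- witt_fst x)
  (- witt_snd x - witt_carry CHAR('a) (witt_fst x) (- witt_fst x))"
  for x :: "'a witt2"

definition "x - y = x + - y" for x y :: "'a witt2"

instance
proof
  fix x y z :: "'a witt2"
  have p: "prime CHAR('a)" by simp
  show "x + y + z = x + (y + z)"
    using witt_carry_assoc[OF p, of "witt_fst x" "witt_fst y" "witt_fst z"]
    by (simp add: plus_witt2_def algebra_simps)
  show "x + y = y + x"
    using witt_carry_commute[of "CHAR('a)" "witt_fst x" "witt_fst y"]
    by (simp add: plus_witt2_def algebra_simps)
  show "0 + x = x"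
    by (simp add: plus_witt2_def zero_witt2_def)
  show "- x + x = 0"
    using witt_carry_commute[of "CHAR('a)" "witt_fst x" "- witt_fst x"]
    by (simp add: plus_witt2_def zero_witt2_def uminus_witt2_def)
  show "x - y = x + - y"
    by (rule minus_witt2_def)
  show "x * y * z = x * (y * z)"
    by (simp add: times_witt2_def algebra_simps power_mult_distrib)
  show "x * y = y * x"
    by (simp add: times_witt2_def algebra_simps)
  show "1 * x = x"
    by (simp add: times_witt2_def one_witt2_def)
  show "(x + y) * z = x * z + y * z"
    by (simp add: times_witt2_def plus_witt2_def witt_carry_mult freshmans_dream[OF p refl]
        algebra_simps)
  show "(0 :: 'a witt2) \<noteq> 1"
    by (simp add: zero_witt2_def one_witt2_def)
qed

end


section \<open>Special linear groups\<close>

definition SL :: "'a::comm_ring_1 itself \<Rightarrow> nat \<Rightarrow> 'a mat monoid" where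
  "SL ty n = \<lparr>carrier = {A \<in> carrier_mat n n. det A = 1}, mult = (*), one = 1\<^sub>m n\<rparr>"

lemma group_SL: "group (SL TYPE('a::comm_ring_1) n)"
proof (rule groupI)
  fix A assume "A \<in> carrier (SL TYPE('a) n)"
  then have A: "A \<in> carrier_mat n n" "det A = 1" by (auto simp: SL_def)
  have adj: "adj_mat A \<in> carrier_mat n n" "adj_mat A * A = 1\<^sub>m n"
    using adj_mat[OF A(1)] A(2) by auto
  have "det (adj_mat A) = 1"
    using det_mult[OF adj(1) A(1)] adj(2) A(2) by simp
  with adj show "\<exists>B \<in> carrier (SL TYPE('a) n). B \<otimes>\<^bsub>SL TYPE('a) n\<^esub> A = \<one>\<^bsub>SL TYPE('a) n\<^esub>"
    by (auto simp: SL_def)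
qed (auto simp: SL_def det_mult)


section \<open>Complex representations\<close>

definition GL_complex :: "nat \<Rightarrow> complex mat monoid" where
  "GL_complex d = units_of (ring_mat TYPE(complex) d ())"

text \<open>
  Representations of dimension \<open>d\<close> are taken on $\mathbb{C}^d$, which meets every isomorphism
  class of representations of dimension \<open>d\<close>.
\<close>
definition reps :: "nat \<Rightarrow> ('g, 'm) monoid_scheme \<Rightarrow> ('g \<Rightarrow> complex mat) set" where
  "reps d G = hom G (GL_complex d)"

definition irreducible_rep :: "nat \<Rightarrow> ('g, 'm) monoid_scheme \<Rightarrow> ('g \<Rightarrow> complex mat) \<Rightarrow> bool" where
  "irreducible_rep d G \<rho> \<longleftrightarrow> \<rho> \<in> reps d G \<and> d > 0 \<and>
    (\<forall>W. VectorSpace.subspace class_ring W (module_vec TYPE(complex) d) \<and>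
         (\<forall>g \<in> carrier G. \<forall>w \<in> W. \<rho> g *\<^sub>v w \<in> W)
         \<longrightarrow> W = {0\<^sub>v d} \<or> W = carrier_vec d)"

text \<open>
  Functions in \<^term>\<open>hom\<close> are unconstrained outside the carrier; two functions that agree on the
  carrier are isomorphic by the identity matrix, so this adds no isomorphism classes.
\<close>
definition rep_iso :: "nat \<Rightarrow> ('g, 'm) monoid_scheme \<Rightarrow> (('g \<Rightarrow> complex mat) \<times> ('g \<Rightarrow> complex mat)) set"
  where "rep_iso d G = {(\<rho>, \<sigma>). \<rho> \<in> reps d G \<and> \<sigma> \<in> reps d G \<and>
    (\<exists>T \<in> carrier (GL_complex d). \<forall>g \<in> carrier G. T * \<rho> g = \<sigma> g * T)}"

lemma equiv_rep_iso: "equiv (reps d G) (rep_iso d G)"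
proof -
  interpret M: ring "ring_mat TYPE(complex) d ()" by (rule ring_mat)
  interpret GL: group "GL_complex d"
    unfolding GL_complex_def by (rule M.units_group)
  have mult: "mult (GL_complex d) = (*)"
    by (simp add: GL_complex_def units_of_mult ring_mat_simps)
  note iso = rep_iso_def[unfolded mult[symmetric]]
  have img: "\<rho> g \<in> carrier (GL_complex d)" if "\<rho> \<in> reps d G" "g \<in> carrier G" for \<rho> g
    using that by (auto simp: reps_def hom_def)
  show ?thesis
  proof (rule equivI)
    show "rep_iso d G \<subseteq> reps d G \<times> reps d G"
      by (auto simp: iso)
    show "refl_on (reps d G) (rep_iso d G)"
      by (auto simp: refl_on_def iso img intro!: bexI[of _ "\<one>\<^bsub>GL_complex d\<^esub>"])
    show "sym (rep_iso d G)"
    proof (rule symI)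
      fix \<rho> \<sigma> assume "(\<rho>, \<sigma>) \<in> rep_iso d G"
      then obtain T where r: "\<rho> \<in> reps d G" "\<sigma> \<in> reps d G" and T: "T \<in> carrier (GL_complex d)"
        and eq: "\<And>g. g \<in> carrier G \<Longrightarrow> T \<otimes>\<^bsub>GL_complex d\<^esub> \<rho> g = \<sigma> g \<otimes>\<^bsub>GL_complex d\<^esub> T"
        by (auto simp: iso)
      let ?T = "inv\<^bsub>GL_complex d\<^esub> T"
      have "?T \<otimes>\<^bsub>GL_complex d\<^esub> \<sigma> g = \<rho> g \<otimes>\<^bsub>GL_complex d\<^esub> ?T" if g: "g \<in> carrier G" for g
        using img[OF r(1) g] img[OF r(2) g] T eq[OF g]
        by (metis GL.inv_closed GL.inv_solve_left GL.inv_solve_right GL.m_assoc GL.m_closed)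
      then show "(\<sigma>, \<rho>) \<in> rep_iso d G"
        using r T by (auto simp: iso intro!: bexI[of _ ?T])
    qed
    show "trans (rep_iso d G)"
    proof (rule transI)
      fix \<rho> \<sigma> \<tau> assume "(\<rho>, \<sigma>) \<in> rep_iso d G" "(\<sigma>, \<tau>) \<in> rep_iso d G"
      then obtain S T where r: "\<rho> \<in> reps d G" "\<sigma> \<in> reps d G" "\<tau> \<in> reps d G"
        and S: "S \<in> carrier (GL_complex d)" and T: "T \<in> carrier (GL_complex d)"
        and eq: "\<And>g. g \<in> carrier G \<Longrightarrow> S \<otimes>\<^bsub>GL_complex d\<^esub> \<rho> g = \<sigma> g \<otimes>\<^bsub>GL_complex d\<^esub> S"
          "\<And>g. g \<in> carrier G \<Longrightarrow> T \<otimes>\<^bsub>GL_complex d\<^esub> \<sigma> g = \<tau> g \<otimes>\<^bsub>GL_complex d\<^esub> T"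
        by (auto simp: iso)
      have "(T \<otimes>\<^bsub>GL_complex d\<^esub> S) \<otimes>\<^bsub>GL_complex d\<^esub> \<rho> g
          = \<tau> g \<otimes>\<^bsub>GL_complex d\<^esub> (T \<otimes>\<^bsub>GL_complex d\<^esub> S)" if g: "g \<in> carrier G" for g
        using img[OF r(1) g] img[OF r(2) g] img[OF r(3) g] S T eq[OF g]
        by (metis GL.m_assoc)
      then show "(\<rho>, \<tau>) \<in> rep_iso d G"
        using r S T by (auto simp: iso intro!: bexI[of _ "T \<otimes>\<^bsub>GL_complex d\<^esub> S"])
    qed
  qed
qed

definition Irr :: "nat \<Rightarrow> ('g, 'm) monoid_scheme \<Rightarrow> ('g \<Rightarrow> complex mat) set set" where
  "Irr d G = {\<rho>. irreducible_rep d G \<rho>} // rep_iso d G"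

end

theory Submission
  imports Defs "HOL-Library.Function_Algebras" "HOL-Algebra.Sylow" "HOL-Algebra.Group_Action"
begin

text \<open>
  Both rings are extensions $R$ of $\mathbb{F}_q$ by a square-zero ideal which, as an
  $\mathbb{F}_q$-space, is $\mathbb{F}_q$ (after a Frobenius twist for Witt vectors). Hence both groups
  $\mathrm{SL}_n(R)$ are extensions of $\mathrm{SL}_n(\mathbb{F}_q)$ by the same module of trace-zero
  matrices, and the characters of the kernel are \<open>\<phi>(z) = \<theta>(tr(Xz))\<close>.

  Suppose that there are scalars \<open>\<mu>\<^sub>\<phi>(y)\<close>, for characters \<open>\<phi>\<close> of the kernel and \<open>y\<close> in the
  group, which extend \<open>\<phi>\<close> and satisfy \<open>\<mu>\<^sub>\<phi>(y y') = \<mu>\<^sub>\<phi>(y) \<mu>\<^sub>\<phi>\<^sub>y(y')\<close>. If both groups have such scalars,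
  then \<open>y \<mapsto> \<Sum>\<^sub>\<phi> \<mu>2\<^sub>\<phi>(y) \<mu>1\<^sub>\<phi>(x)\<^sup>-\<^sup>1 E\<^sub>\<phi> \<rho>(x)\<close>, where \<open>x\<close> has the same image as \<open>y\<close> in $\mathrm{SL}_n(\mathbb{F}_q)$
  and \<open>E\<^sub>\<phi>\<close> projects onto the \<open>\<phi>\<close>-isotypic part, turns representations \<open>\<rho>\<close> of the first group into
  representations of the second, with the same subrepresentations and intertwiners.

  The scalars exist as soon as each \<open>\<phi>\<close> extends to the preimage of a Sylow $p$-subgroup $P$ of its
  stabiliser. An element of $P$ satisfies \<open>g X = X g + c(g) g\<close> with $c : P \to \mathbb{F}_q$ additive. In a
  suitable basis, $X$ and $P$ are block triangular up to levels, with diagonal blocks on which $X$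
  is multiplication by $t$ and $g$ is the substitution $t \mapsto t + c(g)$ on polynomials of degree below
  \<open>N = |c(P)|\<close>. Such matrices can be lifted to $R$ and form a subgroup covering $P$; on its
  intersection with the kernel, \<open>\<phi>\<close> becomes \<open>f \<mapsto> \<theta>(m N (N - 1) / 2 f)\<close>, which is trivial unless
  $p = N = 2$, and extends in that case as well.
\<close>

section \<open>Fixed points of $p$-groups\<close>

text \<open>The function \<open>\<theta>(tr(Xz))\<close> of trace-zero \<open>z\<close> determines
  \<open>X\<close> only up to scalar matrices. An element \<open>g\<close> therefore stabilises it
  exactly when it commutes with \<open>X\<close> up to a scalar, which is where \<open>c(g)\<close>
  comes from; comparing traces, \<open>c\<close> can be nonzero only if $p$ divides $n$. For
  \<open>c = 0\<close> one has \<open>N = 1\<close> and unitriangular matrices suffice; the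
  substitution blocks serve the other case.

  The obstacle is that $P$ need not lift to a subgroup isomorphic to it, so the lifts are allowed to
  form a larger group that meets the kernel. This is harmless because \<open>X\<close> and the lifts
  are triangular in the same basis: in \<open>tr(Xz)\<close> only the entries next to the diagonals
  of the blocks survive. For \<open>e\<close> of square zero, substituting \<open>t + e\<close>
  takes \<open>t^i\<close> to \<open>t^i + i t^(i-1) e\<close>, so each block contributes
  \<open>0 + 1 + ... + (N - 1)\<close>, whence $N(N-1)/2$.

  Passing to Sylow subgroups is possible because the characters have order dividing $p$ while the
  index is prime to $p$. Scalars subject to one twisted relation, rather than an extension on each
  stabiliser, let a single formula transfer all representations without induction.\<close>

lemma p_group_nontrivial_fixed_point:
  fixes G (structure) and act :: "'g \<Rightarrow> 'e \<Rightarrow> 'e"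
  assumes G: "group G" and p: "prime p" and ord: "order G = p ^ k"
    and E: "finite E" "p dvd card E"
    and closed: "\<And>g x. g \<in> carrier G \<Longrightarrow> x \<in> E \<Longrightarrow> act g x \<in> E"
    and one: "\<And>x. x \<in> E \<Longrightarrow> act \<one> x = x"
    and mult: "\<And>g h x. g \<in> carrier G \<Longrightarrow> h \<in> carrier G \<Longrightarrow> x \<in> E \<Longrightarrow> act (g \<otimes> h) x = act g (act h x)"
    and x: "x \<in> E" "\<And>g. g \<in> carrier G \<Longrightarrow> act g x = x"
  obtains y where "y \<in> E" "y \<noteq> x" "\<And>g. g \<in> carrier G \<Longrightarrow> act g y = y"
proof (rule ccontr)
  assume neg: "\<not> thesis"
  interpret group G by fact
  \<comment> \<open>Elements of \<open>BijGroup E\<close> are extensional, hence the restriction to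
    \<open>E\<close>.\<close>
  define \<phi> where "\<phi> g = restrict (act g) E" for g
  have bij: "bij_betw (act g) E E" if g: "g \<in> carrier G" for g
  proof (rule bij_betw_byWitness[where f' = "act (inv g)"])
    show "\<forall>a\<in>E. act (inv g) (act g a) = a" "\<forall>a\<in>E. act g (act (inv g) a) = a"
      using g by (auto simp: mult[symmetric] one)
  qed (use g closed in auto)
  have "group_hom G (BijGroup E) \<phi>"
  proof (intro group_hom.intro group_hom_axioms.intro)
    show "\<phi> \<in> hom G (BijGroup E)"
    proof (rule homI)
      fix g assume g: "g \<in> carrier G"
      then show mem: "\<phi> g \<in> carrier (BijGroup E)"
        using bij by (auto simp: \<phi>_def BijGroup_def Bij_def bij_betw_restrict_eq)
      fix h assume h: "h \<in> carrier G"
      have "\<phi> h \<in> Bij E" "\<phi> g \<in> Bij E"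
        using bij g h by (auto simp: \<phi>_def Bij_def bij_betw_restrict_eq)
      then show "\<phi> (g \<otimes> h) = \<phi> g \<otimes>\<^bsub>BijGroup E\<^esub> \<phi> h"
        using g h by (auto simp: BijGroup_def compose_def \<phi>_def mult closed fun_eq_iff)
    qed
  qed (use G group_BijGroup in auto)
  then interpret group_action G E \<phi> by (rule group_action.intro)
  have part: "partition E (orbits G E \<phi>)" by (rule orbit_partition)
  have orbx: "orbit G \<phi> x = {x}"
    using x by (auto simp: orbit_def \<phi>_def intro!: exI[of _ "\<one>"])
  \<comment> \<open>The orbits other than the known fixed point. If none of them were a singleton,
    each would have size a positive power of \<open>p\<close>, and \<open>p\<close> would divide
    both \<open>card E\<close> and \<open>card E - 1\<close>.\<close>
  let ?C = "orbits G E \<phi> - {{x}}"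
  have disj: "c1 \<inter> c2 = {}" if "c1 \<in> orbits G E \<phi>" "c2 \<in> orbits G E \<phi>" "c1 \<noteq> c2" for c1 c2
  proof (rule ccontr)
    assume "c1 \<inter> c2 \<noteq> {}"
    then obtain y where y: "y \<in> c1" "y \<in> c2" by blast
    then have "y \<in> E" using partition.partition_coverture[OF part] that(1) by blast
    from partition.unique_class[OF part this] show False using that y by blast
  qed
  have un: "\<Union>(orbits G E \<phi>) = E"
    using partition.partition_coverture[OF part] .
  have xo: "{x} \<in> orbits G E \<phi>" using orbx x(1) unfolding orbits_def by blast
  then have "x \<notin> \<Union>?C"
    using disj[OF _ xo] by blast
  then have U: "\<Union>?C = E - {x}"
    using un xo by blast
  have "p dvd card (\<Union>?C)"
  proof (rule dvd_partition)
    show "finite (\<Union>?C)" using U E by simp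
    show "\<forall>c1\<in>?C. \<forall>c2\<in>?C. c1 \<noteq> c2 \<longrightarrow> c1 \<inter> c2 = {}" using disj by blast
    show "\<forall>c\<in>?C. p dvd card c"
    proof
      fix c assume "c \<in> ?C"
      then obtain y where y: "y \<in> E" "c = orbit G \<phi> y" "c \<noteq> {x}" by (auto simp: orbits_def)
      then have yx: "y \<noteq> x" using orbx by auto
      have "card c dvd p ^ k"
        using orbit_stabilizer_theorem[OF y(1)] ord y(2) by (metis dvd_triv_left)
      then obtain j where j: "card c = p ^ j" using p divides_primepow_nat by blast
      have "j \<noteq> 0"
      proof
        assume "j = 0"
        then have "card c = 1" using j by simp
        then obtain z where "c = {z}" using card_1_singletonE by blast
        moreover have "y \<in> c" using orbit_refl y by blast
        ultimately have c: "c = {y}" by auto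
        have "act g y = y" if "g \<in> carrier G" for g
        proof -
          have "\<phi> g y \<in> c" using that y(2) by (auto simp: orbit_def)
          then show ?thesis using c y(1) by (simp add: \<phi>_def)
        qed
        then show False using neg that[OF y(1) yx] by blast
      qed
      then show "p dvd card c" using j by (simp add: dvd_power)
    qed
  qed
  then have "p dvd card E - 1" using U x E by simp
  moreover have "card E \<noteq> 0" using x E by auto
  ultimately have "p dvd card E - (card E - 1)"
    using E(2) by (metis dvd_diff_nat)
  moreover have "card E - (card E - 1) = 1" using \<open>card E \<noteq> 0\<close> by simp
  ultimately show False using p not_prime_1 by (metis nat_dvd_1_iff_1)
qed

text \<open>A prime \<open>l\<close> dividing the order gives, by Sylow, a nontrivial subgroup
  \<open>H\<close> of the additive group of order \<open>l ^ a\<close>. Translation by a nonzero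
  \<open>x\<close> in \<open>H\<close> permutes \<open>H\<close>, so summing over \<open>H\<close>
  yields \<open>l ^ a * x = 0\<close>; hence the characteristic divides \<open>l ^ a\<close> and
  equals \<open>l\<close>.\<close>

lemma card_finite_field_prime_power:
  "\<exists>r. card (UNIV :: 'a::finite_field set) = CHAR('a) ^ r"
proof -
  let ?p = "CHAR('a)" and ?q = "card (UNIV :: 'a set)"
  let ?G = "\<lparr>carrier = (UNIV :: 'a set), mult = (+), one = 0\<rparr>"
  have q0: "?q \<noteq> 0" by simp
  have p: "prime ?p" by simp
  have G: "group ?G"
    by (rule groupI) (auto simp: add.assoc intro: exI[of _ "- _"])
  have "l = ?p" if l: "prime l" "l dvd ?q" for l
  proof -
    obtain m where "?q = l ^ multiplicity l ?q * m" "\<not> l dvd m"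
      using multiplicity_decompose'[OF q0, of l] not_prime_unit l(1) by metis
    then obtain a where m: "?q = l ^ a * m" "\<not> l dvd m" by blast
    have a: "a > 0" using l m by (metis gr0I mult_1 power_0)
    obtain H where H: "subgroup H ?G" "card H = l ^ a"
      using sylow_thm[OF l(1) G, of a m] m(1) by (auto simp: order_def)
    have "1 < l ^ a" using a prime_gt_1_nat[OF l(1)] by (simp only: one_less_power)
    then have "\<not> H \<subseteq> {0}" using H(2) card_mono[of "{0::'a}" H] by auto
    then obtain x where x: "x \<in> H" "x \<noteq> 0" by auto
    have add: "y + x \<in> H" if "y \<in> H" for y
      using subgroup.m_closed[OF H(1) that x(1)] by simp
    have "finite H" by simp
    then have "(\<lambda>y. y + x) ` H = H"
      using add by (intro endo_inj_surj) (auto simp: inj_on_def)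
    then have "\<Sum>H = (\<Sum>y\<in>H. y + x)"
      using sum.reindex[of "\<lambda>y. y + x" H "\<lambda>y. y"] by (simp add: inj_on_def)
    then have "of_nat (l ^ a) * x = 0"
      using H(2) by (simp add: sum.distrib)
    then have "?p dvd l ^ a" using x by (simp add: of_nat_eq_0_iff_char_dvd flip: of_nat_power)
    then show ?thesis using p l(1) by (metis prime_dvd_power primes_dvd_imp_eq)
  qed
  then have l: "l = ?p" if "prime l" "l dvd ?q" for l using that by blast
  obtain m where "?q = ?p ^ multiplicity ?p ?q * m" "\<not> ?p dvd m"
    using multiplicity_decompose'[OF q0, of ?p] not_prime_unit p by metis
  then obtain a where m: "?q = ?p ^ a * m" "\<not> ?p dvd m" by blast
  have "m = 1"
  proof (rule ccontr)
    assume "m \<noteq> 1"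
    then obtain l' where "prime l'" "l' dvd m" using prime_factor_nat by blast
    then show False using l[of l'] m by auto
  qed
  then show ?thesis using m by auto
qed

section \<open>Modules over $p$-groups with a twisted equivariant operator\<close>

text \<open>The case in view is a $p$-group of matrices acting on the column space;
  \<open>twist\<close> says that conjugating \<open>X\<close> by \<open>g\<close> adds the scalar
  \<open>c g\<close>. The laws of the action are stated on \<open>V\<close> because there, and not
  on the whole type, the identity matrix will act as the identity.\<close>

locale twisted_module = vector_space scale
  for scale :: "'q::finite_field \<Rightarrow> 'v::ab_group_add \<Rightarrow> 'v" (infixr "*s" 75) +
  fixes V :: "'v set" and X :: "'v \<Rightarrow> 'v" and G :: "('g, 'm) monoid_scheme" (structure)
    and \<alpha> :: "'g \<Rightarrow> 'v \<Rightarrow> 'v" and c :: "'g \<Rightarrow> 'q" and k :: nat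
  assumes subspace_V: "subspace V" and finite_V: "finite V"
    and X_add: "X (u + v) = X u + X v" and X_scale: "X (a *s v) = a *s X v"
    and X_V: "v \<in> V \<Longrightarrow> X v \<in> V"
    and group_G: "group G" and order_G: "order G = CHAR('q) ^ k"
    and act_add: "g \<in> carrier G \<Longrightarrow> \<alpha> g (u + v) = \<alpha> g u + \<alpha> g v"
    and act_scale: "g \<in> carrier G \<Longrightarrow> \<alpha> g (a *s v) = a *s \<alpha> g v"
    and act_V: "g \<in> carrier G \<Longrightarrow> v \<in> V \<Longrightarrow> \<alpha> g v \<in> V"
    and act_mult: "g \<in> carrier G \<Longrightarrow> h \<in> carrier G \<Longrightarrow> v \<in> V \<Longrightarrow> \<alpha> (g \<otimes> h) v = \<alpha> g (\<alpha> h v)"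
    and act_one: "v \<in> V \<Longrightarrow> \<alpha> \<one> v = v"
    and c_mult: "g \<in> carrier G \<Longrightarrow> h \<in> carrier G \<Longrightarrow> c (g \<otimes> h) = c g + c h"
    and twist: "g \<in> carrier G \<Longrightarrow> v \<in> V \<Longrightarrow> \<alpha> g (X v) = X (\<alpha> g v) + c g *s \<alpha> g v"
begin

sublocale G: group G by (rule group_G)

definition C where "C = c ` carrier G"
definition N where "N = card C"

lemma finite_G: "finite (carrier G)"
  using order_G G.order_gt_0_iff_finite by simp

lemma finite_C: "finite C"
  using finite_G by (simp add: C_def)

lemma zero_in_C: "0 \<in> C"
proof -
  have "c \<one> + 0 = c \<one> + c \<one>" using c_mult[of \<one> \<one>] by simp
  then have "c \<one> = 0" by (simp only: add_left_cancel)
  then show ?thesis unfolding C_def by force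
qed

lemma N_pos: "N > 0"
  using zero_in_C finite_C by (auto simp: N_def card_gt_0_iff)

text \<open>Translation by \<open>z\<close> is an injection of the finite set \<open>C\<close> into
  itself, hence onto.\<close>

lemma C_shift:
  assumes "z \<in> C" shows "(\<lambda>x. x - z) ` C = C"
proof -
  have "(\<lambda>x. x + z) ` C \<subseteq> C"
  proof
    fix y assume "y \<in> (\<lambda>x. x + z) ` C"
    then obtain g h where "g \<in> carrier G" "h \<in> carrier G" "y = c (g \<otimes> h)"
      using assms by (auto simp: C_def c_mult)
    then show "y \<in> C" by (auto simp: C_def)
  qed
  moreover have "inj_on (\<lambda>x. x + z) C" by (simp add: inj_on_def)
  ultimately have "(\<lambda>x. x + z) ` C = C"
    using finite_C by (intro endo_inj_surj)
  then have "(\<lambda>x. x - z) ` C = (\<lambda>x. x - z) ` ((\<lambda>x. x + z) ` C)" by simp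
  also have "\<dots> = C" by (simp only: image_image) simp
  finally show ?thesis .
qed

lemma X_0 [simp]: "X 0 = 0" using X_add[of 0 0] by simp
lemma X_sum: "X (sum f I) = (\<Sum>i\<in>I. X (f i))"
  by (induction I rule: infinite_finite_induct) (auto simp: X_add)
lemma Xp_V: "v \<in> V \<Longrightarrow> (X ^^ i) v \<in> V" by (induction i) (auto simp: X_V)
lemma Xp_add: "(X ^^ i) (u + v) = (X ^^ i) u + (X ^^ i) v" by (induction i) (auto simp: X_add)
lemma Xp_scale: "(X ^^ i) (a *s v) = a *s (X ^^ i) v" by (induction i) (auto simp: X_scale)
lemma Xp_0 [simp]: "(X ^^ i) 0 = 0" by (induction i) auto
lemma Xp_sum: "(X ^^ i) (sum f I) = (\<Sum>j\<in>I. (X ^^ i) (f j))"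
  by (induction I rule: infinite_finite_induct) (auto simp: Xp_add)

lemma act_0 [simp]: "g \<in> carrier G \<Longrightarrow> \<alpha> g 0 = 0" using act_add[of g 0 0] by simp
lemma act_sum: "g \<in> carrier G \<Longrightarrow> \<alpha> g (sum f I) = (\<Sum>i\<in>I. \<alpha> g (f i))"
  by (induction I rule: infinite_finite_induct) (auto simp: act_add)

section \<open>Polynomials in \<open>X\<close> and their behaviour under the group\<close>

definition pact :: "'q poly \<Rightarrow> 'v \<Rightarrow> 'v" where
  "pact f v = (\<Sum>i\<le>degree f. coeff f i *s (X ^^ i) v)"

lemma pact_bound: "degree f \<le> n \<Longrightarrow> pact f v = (\<Sum>i\<le>n. coeff f i *s (X ^^ i) v)"
  unfolding pact_def by (rule sum.mono_neutral_left) (auto simp: coeff_eq_0)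

lemma pact_0 [simp]: "pact 0 v = 0" by (simp add: pact_def)

lemma pact_pCons [simp]: "pact (pCons a f) v = a *s v + X (pact f v)"
proof -
  have "pact (pCons a f) v = (\<Sum>i\<le>Suc (degree f). coeff (pCons a f) i *s (X ^^ i) v)"
    by (rule pact_bound) (simp add: degree_pCons_le)
  also have "\<dots> = a *s v + (\<Sum>i\<le>degree f. coeff f i *s (X ^^ Suc i) v)"
    by (simp add: sum.atMost_Suc_shift del: sum.atMost_Suc funpow.simps)
  also have "(\<Sum>i\<le>degree f. coeff f i *s (X ^^ Suc i) v) = X (pact f v)"
    by (simp add: pact_def X_sum X_scale)
  finally show ?thesis .
qed

lemma pact_add: "pact (f + g) v = pact f v + pact g v"
proof -
  let ?n = "max (degree f) (degree g)"
  have "pact (f + g) v = (\<Sum>i\<le>?n. coeff (f + g) i *s (X ^^ i) v)"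
    by (rule pact_bound) (rule degree_add_le_max)
  then show ?thesis
    using pact_bound[of f ?n v] pact_bound[of g ?n v] by (simp add: scale_left_distrib sum.distrib)
qed

lemma pact_smult: "pact (Polynomial.smult a f) v = a *s pact f v"
  using pact_bound[of "Polynomial.smult a f" "degree f" v] by (simp add: degree_smult_le scale_sum_right pact_def)

lemma pact_vadd: "pact f (u + v) = pact f u + pact f v"
  by (simp add: pact_def Xp_add scale_right_distrib sum.distrib)

lemma pact_V: "v \<in> V \<Longrightarrow> pact f v \<in> V"
  unfolding pact_def by (intro subspace_sum subspace_scale subspace_V Xp_V)

lemma pact_monom: "pact (monom 1 i) v = (X ^^ i) v"
  by (induction i) (auto simp: monom_0 monom_Suc)

lemma pact_closed:
  assumes "subspace U" "\<And>v. v \<in> U \<Longrightarrow> X v \<in> U" "v \<in> U"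
  shows "pact f v \<in> U"
proof -
  have "(X ^^ i) v \<in> U" for i using assms by (induction i) auto
  then show ?thesis unfolding pact_def using assms by (intro subspace_sum subspace_scale) auto
qed

text \<open>Moving \<open>g\<close> past \<open>X\<close> replaces \<open>X\<close> by
  \<open>X + c g\<close>, so a polynomial in \<open>X\<close> is carried to its composition with
  \<open>t + c g\<close>.\<close>

lemma act_pact:
  assumes "g \<in> carrier G" "v \<in> V"
  shows "\<alpha> g (pact f v) = pact (f \<circ>\<^sub>p [:c g, 1:]) (\<alpha> g v)"
proof (induction f)
  case (pCons a f)
  have "\<alpha> g (pact (pCons a f) v) = a *s \<alpha> g v + X (\<alpha> g (pact f v)) + c g *s \<alpha> g (pact f v)"
    using assms by (simp add: act_add act_scale twist pact_V add.assoc)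
  then show ?case using pCons
    by (simp add: pcompose_pCons pact_add pact_smult mult_pCons_left)
qed (use assms in simp)

text \<open>
  As \<open>C\<close> is an additive group, \<open>L\<close> is invariant under the shifts by \<open>c g\<close>, so \<open>L(X)\<close> commutes with
  the group; this is what bounds the level of \<open>X\<^sup>N a\<^sub>s\<close>.
\<close>
definition L :: "'q poly" where "L = (\<Prod>z\<in>C. [:- z, 1:])"

lemma L_shift: "g \<in> carrier G \<Longrightarrow> L \<circ>\<^sub>p [:c g, 1:] = L"
proof -
  assume g: "g \<in> carrier G"
  then have "c g \<in> C" by (simp add: C_def)
  have "L \<circ>\<^sub>p [:c g, 1:] = (\<Prod>z\<in>C. [:- (z - c g), 1:])"
    by (simp add: L_def pcompose_prod pcompose_pCons)
  also have "\<dots> = (\<Prod>z\<in>(\<lambda>z. z - c g) ` C. [:- z, 1:])"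
    by (subst prod.reindex) (auto simp: inj_on_def)
  finally show ?thesis by (simp only: L_def C_shift[OF \<open>c g \<in> C\<close>])
qed

lemma degree_L: "degree L = N"
  by (simp add: L_def N_def degree_prod_eq_sum_degree)

lemma lead_L: "coeff L N = 1"
  using lead_coeff_prod[of "\<lambda>z. [:- z, 1:]" C] by (simp add: degree_L[symmetric] L_def)

lemma pact_L: "pact L v = (X ^^ N) v + (\<Sum>i<N. coeff L i *s (X ^^ i) v)"
  using lead_L by (simp add: pact_def degree_L lessThan_Suc_atMost[symmetric] add.commute)

lemma power_linear_expand:
  "pact ([:z, 1:] ^ i) v = (\<Sum>j\<le>i. z ^ (i - j) *s of_nat (i choose j) *s (X ^^ j) v)"
proof -
  have "degree ([:z, 1:] ^ i) \<le> i" using degree_power_le[of "[:z, 1:]" i] by simp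
  from pact_bound[OF this] show ?thesis by (simp add: coeff_linear_poly_power mult.commute)
qed

text \<open>Division by \<open>t - w\<close> for one of the points \<open>w\<close> replaces the
  inversion of a Vandermonde matrix: the quotient has one coefficient less and, since
  \<open>z - w\<close> is invertible, takes values in \<open>U\<close> at all remaining points
  \<open>z\<close>.\<close>

lemma vandermonde_subspace:
  assumes "subspace U" "finite D" "card D = n" "\<And>z. z \<in> D \<Longrightarrow> (\<Sum>j<n. z ^ j *s \<beta> j) \<in> U" "j < n"
  shows "\<beta> j \<in> U"
  using assms(2-5)
proof (induction n arbitrary: D \<beta> j)
  case (Suc n)
  note U = subspace_add[OF assms(1)] subspace_diff[OF assms(1)] subspace_scale[OF assms(1)]
    subspace_sum[OF assms(1)]
  obtain w where w: "w \<in> D" using Suc.prems by fastforce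
  \<comment> \<open>The coefficients of the quotient by \<open>t - w\<close>; \<open>rec\<close> is
    synthetic division.\<close>
  define \<gamma> where "\<gamma> l = (\<Sum>j=l..<n. w ^ (j - l) *s \<beta> (Suc j))" for l
  have rec: "\<gamma> l = \<beta> (Suc l) + w *s \<gamma> (Suc l)" if "l < n" for l
  proof -
    have "\<gamma> l = \<beta> (Suc l) + (\<Sum>j=Suc l..<n. w ^ (j - l) *s \<beta> (Suc j))"
      using that by (simp add: \<gamma>_def sum.atLeast_Suc_lessThan)
    also have "(\<Sum>j=Suc l..<n. w ^ (j - l) *s \<beta> (Suc j)) = w *s \<gamma> (Suc l)"
      unfolding \<gamma>_def scale_sum_right
    proof (rule sum.cong)
      fix j assume "j \<in> {Suc l..<n}"
      then have "j - l = Suc (j - Suc l)" by (simp add: Suc_diff_Suc)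
      then show "w ^ (j - l) *s \<beta> (Suc j) = w *s w ^ (j - Suc l) *s \<beta> (Suc j)" by simp
    qed simp
    finally show ?thesis .
  qed
  have \<gamma>n: "\<gamma> n = 0" by (simp add: \<gamma>_def)
  \<comment> \<open>Division with remainder; the remainder
    \<open>\<beta> 0 + w *s \<gamma> 0\<close> is the value at \<open>w\<close>.\<close>
  have horner: "(\<Sum>j<Suc n. z ^ j *s \<beta> j) = \<beta> 0 + w *s \<gamma> 0 + (z - w) *s (\<Sum>l<n. z ^ l *s \<gamma> l)" for z
  proof -
    have 1: "(\<Sum>l<n. z ^ l *s \<gamma> l) = (\<Sum>l<n. z ^ l *s \<beta> (Suc l)) + w *s (\<Sum>l<n. z ^ l *s \<gamma> (Suc l))"
      by (simp add: rec scale_right_distrib sum.distrib scale_sum_right mult.commute)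
    have 2: "z *s (\<Sum>l<n. z ^ l *s \<gamma> (Suc l)) = (\<Sum>l<n. z ^ l *s \<gamma> l) - \<gamma> 0"
      using sum.lessThan_Suc_shift[of "\<lambda>l. z ^ l *s \<gamma> l" n] \<gamma>n by (simp add: scale_sum_right)
    have 3: "(\<Sum>j<Suc n. z ^ j *s \<beta> j) = \<beta> 0 + z *s (\<Sum>l<n. z ^ l *s \<beta> (Suc l))"
      by (simp add: sum.lessThan_Suc_shift scale_sum_right del: sum.lessThan_Suc)
    let ?S = "\<Sum>l<n. z ^ l *s \<gamma> l" and ?T = "\<Sum>l<n. z ^ l *s \<gamma> (Suc l)"
    have "z *s (\<Sum>l<n. z ^ l *s \<beta> (Suc l)) = z *s ?S - w *s z *s ?T"
      using 1 by (simp add: scale_right_distrib mult.commute)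
    also have "\<dots> = w *s \<gamma> 0 + (z - w) *s ?S"
      by (simp add: 2 scale_right_diff_distrib scale_left_diff_distrib)
    finally show ?thesis using 3 by (simp add: add.assoc)
  qed
  have base: "\<beta> 0 + w *s \<gamma> 0 \<in> U" using Suc.prems(3)[OF w] by (simp add: horner del: sum.lessThan_Suc)
  have \<gamma>: "\<gamma> l \<in> U" if l: "l < n" for l
  proof (rule Suc.IH[of "D - {w}"])
    show "card (D - {w}) = n" using Suc.prems w by simp
    fix z assume z: "z \<in> D - {w}"
    have "(z - w) *s (\<Sum>l<n. z ^ l *s \<gamma> l) \<in> U"
      using U(2)[OF Suc.prems(3)[of z] base] z by (simp add: horner del: sum.lessThan_Suc)
    from U(3)[OF this, of "inverse (z - w)"] z show "(\<Sum>l<n. z ^ l *s \<gamma> l) \<in> U" by simp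
  qed (use Suc.prems l in auto)
  have \<gamma>': "\<gamma> l \<in> U" if "l \<le> n" for l
    using \<gamma>[of l] \<gamma>n that subspace_0[OF assms(1)] by (cases "l = n") auto
  show ?case
  proof (cases j)
    case 0
    then show ?thesis using U(2)[OF base U(3)[OF \<gamma>'[of 0], of w]] by simp
  next
    case (Suc l)
    then have l: "l < n" using \<open>j < Suc n\<close> by simp
    then show ?thesis using Suc U(2)[OF \<gamma>'[of l] U(3)[OF \<gamma>'[of "Suc l"], of w]] rec[OF l] by simp
  qed
qed simp

text \<open>
  Applying \<open>g\<close> with \<open>c g = z\<close> replaces \<open>X\<^sup>i a\<^sub>i\<close> by \<open>(X + z)\<^sup>i a\<^sub>i\<close> modulo \<open>U\<close>; since this holds for
  \<open>N\<close> different values of \<open>z\<close>, the coefficients of the powers of \<open>z\<close> lie in \<open>U\<close>.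
\<close>
lemma X_independent_mod:
  assumes U: "subspace U" "\<And>v. v \<in> U \<Longrightarrow> X v \<in> U" "\<And>g v. g \<in> carrier G \<Longrightarrow> v \<in> U \<Longrightarrow> \<alpha> g v \<in> U"
    and a: "\<And>i. i < N \<Longrightarrow> a i \<in> V" "\<And>i g. i < N \<Longrightarrow> g \<in> carrier G \<Longrightarrow> \<alpha> g (a i) - a i \<in> U"
    and sum: "(\<Sum>i<N. (X ^^ i) (a i)) \<in> U" and i: "i < N"
  shows "a i \<in> U"
proof -
  \<comment> \<open>The coefficient of \<open>z ^ l\<close> in the sum over \<open>i\<close> of
    \<open>(X + z)^i\<close> applied to \<open>a i\<close>.\<close>
  define \<beta> where "\<beta> l = (\<Sum>i=l..<N. of_nat (i choose (i - l)) *s (X ^^ (i - l)) (a i))" for l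
  have Xp: "(X ^^ j) v \<in> U" if "v \<in> U" for j v using that U(2) by (induction j) auto
  have \<beta>: "\<beta> l \<in> U" if "l < N" for l
  proof (rule vandermonde_subspace[OF U(1) finite_C])
    show "card C = N" by (simp add: N_def)
    fix z assume "z \<in> C"
    then obtain g where g: "g \<in> carrier G" "z = c g" by (auto simp: C_def)
    have "(\<Sum>i<N. pact ([:z, 1:] ^ i) (a i)) \<in> U"
    proof -
      have "\<alpha> g (\<Sum>i<N. (X ^^ i) (a i)) = (\<Sum>i<N. pact ([:z, 1:] ^ i) (\<alpha> g (a i)))"
      proof -
        have "\<alpha> g ((X ^^ i) (a i)) = pact ([:z, 1:] ^ i) (\<alpha> g (a i))" if "i < N" for i
        proof -
          have "monom 1 i \<circ>\<^sub>p [:z, 1:] = [:z, 1:] ^ i"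
            by (simp add: monom_altdef pcompose_hom.hom_power pcompose_pCons)
          then show ?thesis using act_pact[OF g(1) a(1)[OF that], of "monom 1 i"] g(2)
            by (simp add: pact_monom)
        qed
        then show ?thesis using g by (simp add: act_sum)
      qed
      then have 1: "(\<Sum>i<N. pact ([:z, 1:] ^ i) (\<alpha> g (a i))) \<in> U" using U(3)[OF g(1) sum] by simp
      have "pact ([:z, 1:] ^ i) (\<alpha> g (a i)) = pact ([:z, 1:] ^ i) (a i) + pact ([:z, 1:] ^ i) (\<alpha> g (a i) - a i)" for i
        by (simp flip: pact_vadd)
      then have "(\<Sum>i<N. pact ([:z, 1:] ^ i) (a i)) = (\<Sum>i<N. pact ([:z, 1:] ^ i) (\<alpha> g (a i)))
          - (\<Sum>i<N. pact ([:z, 1:] ^ i) (\<alpha> g (a i) - a i))"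
        by (simp add: sum.distrib)
      also have "\<dots> \<in> U"
        by (intro subspace_diff 1 subspace_sum U(1) pact_closed U(2) a(2) g) auto
      finally show ?thesis .
    qed
    also have "(\<Sum>i<N. pact ([:z, 1:] ^ i) (a i)) = (\<Sum>l<N. z ^ l *s \<beta> l)"
    proof -
      have "pact ([:z, 1:] ^ i) (a i) = (\<Sum>l\<le>i. z ^ l *s of_nat (i choose (i - l)) *s (X ^^ (i - l)) (a i))" for i
        unfolding power_linear_expand
        by (rule sum.reindex_bij_witness[of _ "\<lambda>l. i - l" "\<lambda>l. i - l"]) auto
      then have "(\<Sum>i<N. pact ([:z, 1:] ^ i) (a i))
          = (\<Sum>i<N. \<Sum>l\<le>i. z ^ l *s of_nat (i choose (i - l)) *s (X ^^ (i - l)) (a i))" by simp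
      also have "\<dots> = (\<Sum>l<N. \<Sum>i=l..<N. z ^ l *s of_nat (i choose (i - l)) *s (X ^^ (i - l)) (a i))"
        unfolding sum.Sigma[OF finite_lessThan ballI[OF finite_atMost]]
          sum.Sigma[OF finite_lessThan ballI[OF finite_atLeastLessThan]]
        by (rule sum.reindex_bij_witness[of _ "\<lambda>(l, i). (i, l)" "\<lambda>(i, l). (l, i)"]) auto
      finally show ?thesis by (simp add: \<beta>_def scale_sum_right)
    qed
    finally show "(\<Sum>l<N. z ^ l *s \<beta> l) \<in> U" .
  qed (use that in auto)
  show ?thesis using i
  \<comment> \<open>The coefficient \<open>\<beta> i\<close> is \<open>a i\<close> plus multiples of
    powers of \<open>X\<close> applied to \<open>a j\<close> with \<open>j > i\<close>, so the
    induction descends from the top index.\<close>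
  proof (induction "N - i" arbitrary: i rule: less_induct)
    case less
    have "\<beta> i = a i + (\<Sum>j=Suc i..<N. of_nat (j choose (j - i)) *s (X ^^ (j - i)) (a j))"
      using less.prems by (simp add: \<beta>_def sum.atLeast_Suc_lessThan)
    moreover have "(\<Sum>j=Suc i..<N. of_nat (j choose (j - i)) *s (X ^^ (j - i)) (a j)) \<in> U"
      using less.prems by (intro subspace_sum subspace_scale U(1) Xp less.hyps) auto
    ultimately show ?case using subspace_diff[OF U(1) \<beta>[OF less.prems]] by fastforce
  qed
qed

text \<open>The quotient of \<open>V\<close> by \<open>U\<close> is a nonzero vector space over a
  finite field, so the number of its elements is divisible by the characteristic and the zero coset
  cannot be the only one fixed by the $p$-group.\<close>

lemma exists_invariant_mod:
  assumes U: "subspace U" "U \<subset> V" "\<And>g v. g \<in> carrier G \<Longrightarrow> v \<in> U \<Longrightarrow> \<alpha> g v \<in> U"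
  obtains v where "v \<in> V" "v \<notin> U" "\<And>g. g \<in> carrier G \<Longrightarrow> \<alpha> g v - v \<in> U"
proof -
  define E where "E = (\<lambda>v. (+) v ` U) ` V"
  have fU: "finite U" using U finite_V finite_subset by blast
  have coset_eq: "(+) v ` U = (+) w ` U \<longleftrightarrow> v - w \<in> U" for v w
  proof
    assume "(+) v ` U = (+) w ` U"
    moreover have "v \<in> (+) v ` U" using subspace_0[OF U(1)] by force
    ultimately show "v - w \<in> U" by auto
  next
    assume d: "v - w \<in> U"
    have "v + u = w + (v - w + u)" "w + u = v + (u - (v - w))" for u by simp_all
    then show "(+) v ` U = (+) w ` U"
      using subspace_add[OF U(1) d] subspace_diff[OF U(1) _ d] by (metis image_subsetI rev_image_eqI subset_antisym)
  qed
  have act_coset: "\<alpha> g ` (+) v ` U = (+) (\<alpha> g v) ` U" if g: "g \<in> carrier G" for g v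
  proof -
    have "\<alpha> g ` U = U"
    proof (rule endo_inj_surj[OF fU])
      show "\<alpha> g ` U \<subseteq> U" using U(3) g by auto
      have "\<alpha> (inv g) (\<alpha> g u) = u" if "u \<in> U" for u
        using act_mult[of "inv g" g u] act_one[of u] g that U(2) by auto
      then show "inj_on (\<alpha> g) U" by (rule inj_on_inverseI)
    qed
    moreover have "\<alpha> g ` (+) v ` U = (+) (\<alpha> g v) ` \<alpha> g ` U"
      using g by (simp add: image_image act_add)
    ultimately show ?thesis by simp
  qed
  \<comment> \<open>Lagrange for \<open>U\<close> in \<open>V\<close>, by counting disjoint
    cosets.\<close>
  have dis: "card V = card U * card E"
  proof -
    have UE: "\<Union>E = V"
    proof
      show "\<Union>E \<subseteq> V" using U(2) subspace_add[OF subspace_V] by (auto simp: E_def)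
      show "V \<subseteq> \<Union>E" using subspace_0[OF U(1)] by (force simp: E_def)
    qed
    have "card (\<Union>E) = card U * card E"
    proof (rule card_partition[symmetric])
      show "finite E" by (simp add: E_def finite_V)
      show "finite (\<Union>E)" by (simp add: UE finite_V)
      show "card c = card U" if "c \<in> E" for c
        using that by (auto simp: E_def card_image)
      show "c1 \<inter> c2 = {}" if c12: "c1 \<in> E" "c2 \<in> E" "c1 \<noteq> c2" for c1 c2
      proof (rule ccontr)
        assume "c1 \<inter> c2 \<noteq> {}"
        then obtain x where x: "x \<in> c1" "x \<in> c2" by blast
        obtain v w where c: "c1 = (+) v ` U" "c2 = (+) w ` U" using c12(1,2) by (auto simp: E_def)
        then obtain u u' where u: "u \<in> U" "u' \<in> U" "v + u = w + u'" using x by auto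
        then have "v - w = u' - u" by (simp add: algebra_simps)
        then have "v - w \<in> U" using subspace_diff[OF U(1)] u by simp
        then show False using c c12(3) coset_eq by simp
      qed
    qed
    then show ?thesis by (simp only: UE)
  qed
  \<comment> \<open>A basis shows that \<open>card V\<close> is a power of the characteristic;
    \<open>card E\<close> divides it and is not 1, as \<open>U\<close> is a proper subspace.\<close>
  have "CHAR('q) dvd card E"
  proof -
    obtain r where r: "card (UNIV :: 'q set) = CHAR('q) ^ r" using card_finite_field_prime_power by blast
    obtain B where B: "B \<subseteq> V" "independent B" "V \<subseteq> span B"
      using maximal_independent_subset[of V] by metis
    then have sB: "span B = V" using span_subspace subspace_V by auto
    have fB: "finite B" using B finite_V finite_subset by blast
    have "card V = card (B \<rightarrow>\<^sub>E (UNIV :: 'q set))"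
    proof (rule bij_betw_same_card[symmetric])
      show "bij_betw (\<lambda>f. \<Sum>b\<in>B. f b *s b) (B \<rightarrow>\<^sub>E UNIV) V"
      proof (rule bij_betwI')
        fix f g :: "'v \<Rightarrow> 'q" assume fg: "f \<in> B \<rightarrow>\<^sub>E UNIV" "g \<in> B \<rightarrow>\<^sub>E UNIV"
        show "(\<Sum>b\<in>B. f b *s b) = (\<Sum>b\<in>B. g b *s b) \<longleftrightarrow> f = g"
        proof
          assume "(\<Sum>b\<in>B. f b *s b) = (\<Sum>b\<in>B. g b *s b)"
          then have "(\<Sum>b\<in>B. (f b - g b) *s b) = 0"
            by (simp add: scale_left_diff_distrib sum_subtractf)
          then have "f b - g b = 0" if "b \<in> B" for b
            using independentD[OF B(2) fB subset_refl, of "\<lambda>b. f b - g b"] that by blast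
          then show "f = g" using fg by (intro PiE_ext[of f B "\<lambda>_. UNIV" g]) auto
        qed simp
      next
        fix f :: "'v \<Rightarrow> 'q" assume "f \<in> B \<rightarrow>\<^sub>E UNIV"
        show "(\<Sum>b\<in>B. f b *s b) \<in> V" using B(1) by (intro subspace_sum subspace_scale subspace_V) auto
      next
        fix v assume "v \<in> V"
        then obtain f where "v = (\<Sum>b\<in>B. f b *s b)" using sB span_finite[OF fB] by auto
        then show "\<exists>f\<in>B \<rightarrow>\<^sub>E UNIV. v = (\<Sum>b\<in>B. f b *s b)"
          by (intro bexI[of _ "restrict f B"]) auto
      qed
    qed
    also have "\<dots> = CHAR('q) ^ (r * card B)" by (simp add: card_PiE fB r power_mult)
    finally have "card E dvd CHAR('q) ^ (r * card B)" using dis by (metis dvd_triv_right)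
    then obtain j where j: "card E = CHAR('q) ^ j" using divides_primepow_nat CHAR_prime by blast
    have "card E \<noteq> 1"
    proof
      assume "card E = 1"
      then have "card V = card U" using dis by simp
      then show False using U(2) finite_V by (metis psubset_card_mono less_irrefl)
    qed
    then have "j \<noteq> 0" using j by (metis power_0)
    then show ?thesis using j by (simp add: dvd_power)
  qed
  have "\<exists>y\<in>E. y \<noteq> U \<and> (\<forall>g\<in>carrier G. \<alpha> g ` y = y)"
  proof (rule p_group_nontrivial_fixed_point[OF group_G CHAR_prime order_G, where E = E and act = "\<lambda>g S. \<alpha> g ` S" and x = U])
    show "CHAR('q) dvd card E" by fact
    show "finite E" by (simp add: E_def finite_V)
    show "\<alpha> g ` x \<in> E" if gx: "g \<in> carrier G" "x \<in> E" for g x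
    proof -
      obtain v where "v \<in> V" "x = (+) v ` U" using gx(2) by (auto simp: E_def)
      then show ?thesis using gx(1) act_V act_coset by (simp only: E_def) blast
    qed
    show "\<alpha> \<one> ` x = x" if xE: "x \<in> E" for x
    proof -
      obtain v where "v \<in> V" "x = (+) v ` U" using xE by (auto simp: E_def)
      then show ?thesis by (simp only: act_coset[OF G.one_closed] act_one)
    qed
    show "\<alpha> (g \<otimes> h) ` x = \<alpha> g ` \<alpha> h ` x" if ghx: "g \<in> carrier G" "h \<in> carrier G" "x \<in> E" for g h x
    proof -
      obtain v where v: "v \<in> V" "x = (+) v ` U" using ghx(3) by (auto simp: E_def)
      have "\<alpha> g ` \<alpha> h ` x = (+) (\<alpha> g (\<alpha> h v)) ` U"
        using ghx v(2) by (simp only: act_coset)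
      moreover have "\<alpha> (g \<otimes> h) ` x = (+) (\<alpha> (g \<otimes> h) v) ` U"
        using ghx v(2) by (simp only: act_coset[OF G.m_closed])
      ultimately show ?thesis using ghx v(1) by (simp only: act_mult)
    qed
    show "U \<in> E" using subspace_0[OF subspace_V] by (force simp: E_def)
    show "\<alpha> g ` U = U" if "g \<in> carrier G" for g
      using act_coset[OF that, of 0] that by simp
  qed blast
  then obtain y where y: "y \<in> E" "y \<noteq> U" "\<And>g. g \<in> carrier G \<Longrightarrow> \<alpha> g ` y = y" by blast
  then obtain v where v: "v \<in> V" "y = (+) v ` U" by (auto simp: E_def)
  show thesis
  proof (rule that[OF v(1)])
    have "y = (+) 0 ` U" if "v \<in> U" using coset_eq[of v 0] v(2) that by simp
    then show "v \<notin> U" using y(2) by auto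
    fix g assume g: "g \<in> carrier G"
    then show "\<alpha> g v - v \<in> U" using y(3)[OF g] v(2) act_coset[OF g] coset_eq by simp
  qed
qed

text \<open>A repeated vector would give a relation with coefficients 1 and -1. Injectivity bounds
  the length of independent families in \<open>V\<close> by \<open>card V\<close>, which makes
  longest ones available.\<close>

lemma indep_mod_imp_inj:
  assumes U: "subspace U" and a: "\<And>f. (\<Sum>s<r. f s *s a s) \<in> U \<Longrightarrow> (\<forall>s<r. f s = 0)"
  shows "inj_on a {..<r::nat}"
proof (rule inj_onI, rule ccontr)
  fix s t assume st: "s \<in> {..<r}" "t \<in> {..<r}" "a s = a t" "s \<noteq> t"
  let ?f = "\<lambda>x. if x = s then 1 else if x = t then - 1 else (0::'q)"
  have "(\<Sum>x<r. ?f x *s a x) = (\<Sum>x\<in>{s, t}. ?f x *s a x)"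
    using st by (intro sum.mono_neutral_right) auto
  also have "\<dots> = 0" using st by simp
  finally have "(\<Sum>x<r. ?f x *s a x) \<in> U" using subspace_0[OF U] by simp
  from a[OF this] st(1) show False by fastforce
qed

section \<open>Bases filtered by levels\<close>

definition level_span :: "nat \<Rightarrow> (nat \<Rightarrow> 'v) \<Rightarrow> (nat \<Rightarrow> nat) \<Rightarrow> nat \<Rightarrow> 'v set" where
  "level_span m a lev l = span {(X ^^ i) (a s) | s i. s < m \<and> i < N \<and> lev s < l}"

text \<open>A partial adapted basis: the vectors \<open>(X ^^ i) (a s)\<close> with
  \<open>i < N\<close> are independent, the group fixes each \<open>a s\<close> modulo lower levels,
  and \<open>(X ^^ N) (a s)\<close> may involve the level of \<open>s\<close> but no higher one.
  Since \<open>level_span\<close> has a strict bound, the argument \<open>lev s\<close> stands for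
  the levels below that of \<open>s\<close>, and \<open>Suc (lev s)\<close> includes it.\<close>

definition filtered :: "nat \<Rightarrow> (nat \<Rightarrow> 'v) \<Rightarrow> (nat \<Rightarrow> nat) \<Rightarrow> bool" where
  "filtered m a lev \<longleftrightarrow> (\<forall>s<m. a s \<in> V) \<and>
    (\<forall>f. (\<Sum>s<m. \<Sum>i<N. f s i *s (X ^^ i) (a s)) = 0 \<longrightarrow> (\<forall>s<m. \<forall>i<N. f s i = 0)) \<and>
    (\<forall>s t. s \<le> t \<longrightarrow> t < m \<longrightarrow> lev s \<le> lev t) \<and>
    (\<forall>s<m. \<forall>g\<in>carrier G. \<alpha> g (a s) - a s \<in> level_span m a lev (lev s)) \<and>
    (\<forall>s<m. (X ^^ N) (a s) \<in> level_span m a lev (Suc (lev s)))"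

lemma subspace_level_span: "subspace (level_span m a lev l)" by (simp add: level_span_def)

lemma level_span_base: "s < m \<Longrightarrow> i < N \<Longrightarrow> lev s < l \<Longrightarrow> (X ^^ i) (a s) \<in> level_span m a lev l"
  unfolding level_span_def by (rule span_base) blast

lemma level_span_mono: "l \<le> l' \<Longrightarrow> level_span m a lev l \<subseteq> level_span m a lev l'"
  unfolding level_span_def by (rule span_mono) (auto intro: less_le_trans)

lemma level_span_V: "filtered m a lev \<Longrightarrow> level_span m a lev l \<subseteq> V"
  unfolding level_span_def by (rule span_minimal) (auto simp: filtered_def subspace_V Xp_V)

text \<open>\<open>X\<close> takes a generator to the next one, except for \<open>i = N - 1\<close>,
  where the last clause of \<open>filtered\<close> takes over.\<close>

lemma level_span_X:
  assumes "filtered m a lev" "v \<in> level_span m a lev l"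
  shows "X v \<in> level_span m a lev l"
proof -
  have "level_span m a lev l \<subseteq> {v. X v \<in> level_span m a lev l}"
  proof (subst (1) level_span_def, rule span_minimal)
    show "subspace {v. X v \<in> level_span m a lev l}"
      by (rule subspaceI)
        (auto simp: X_add X_scale subspace_0[OF subspace_level_span] subspace_add[OF subspace_level_span] subspace_scale[OF subspace_level_span])
    show "{(X ^^ i) (a s) |s i. s < m \<and> i < N \<and> lev s < l} \<subseteq> {v. X v \<in> level_span m a lev l}"
    proof clarify
      fix s i assume s: "s < m" "i < N" "lev s < l"
      show "X ((X ^^ i) (a s)) \<in> level_span m a lev l"
      proof (cases "Suc i = N")
        case True
        then have "X ((X ^^ i) (a s)) = (X ^^ N) (a s)" by (metis funpow.simps(2) comp_apply)
        also have "\<dots> \<in> level_span m a lev (Suc (lev s))" using assms(1) s by (auto simp: filtered_def)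
        finally show ?thesis using level_span_mono[of "Suc (lev s)" l m a lev] s by auto
      next
        case False
        then show ?thesis using level_span_base[of s m "Suc i" lev l a] s by simp
      qed
    qed
  qed
  then show ?thesis using assms(2) by blast
qed

lemma level_span_act:
  assumes "filtered m a lev" "v \<in> level_span m a lev l" and g: "g \<in> carrier G"
  shows "\<alpha> g v \<in> level_span m a lev l"
proof -
  have "level_span m a lev l \<subseteq> {v. \<alpha> g v \<in> level_span m a lev l}"
  proof (subst (1) level_span_def, rule span_minimal)
    show "subspace {v. \<alpha> g v \<in> level_span m a lev l}"
      by (rule subspaceI)
        (auto simp: act_add act_scale g subspace_0[OF subspace_level_span] subspace_add[OF subspace_level_span] subspace_scale[OF subspace_level_span])
    show "{(X ^^ i) (a s) |s i. s < m \<and> i < N \<and> lev s < l} \<subseteq> {v. \<alpha> g v \<in> level_span m a lev l}"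
    proof clarify
      fix s i assume s: "s < m" "i < N" "lev s < l"
      have "\<alpha> g (a s) - a s \<in> level_span m a lev (lev s)" using assms s by (auto simp: filtered_def)
      then have "\<alpha> g (a s) - a s \<in> level_span m a lev l" using level_span_mono[of "lev s" l] s by auto
      from subspace_add[OF subspace_level_span this level_span_base[of s m 0 lev l a, simplified, OF s(1) N_pos s(3)]]
      have "\<alpha> g (a s) \<in> level_span m a lev l" by simp
      then have "pact (monom 1 i \<circ>\<^sub>p [:c g, 1:]) (\<alpha> g (a s)) \<in> level_span m a lev l"
        by (intro pact_closed[OF subspace_level_span] level_span_X[OF assms(1)])
      then show "\<alpha> g ((X ^^ i) (a s)) \<in> level_span m a lev l"
        using act_pact[OF g, of "a s" "monom 1 i"] assms(1) s by (simp add: pact_monom filtered_def)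
    qed
  qed
  then show ?thesis using assms(2) by blast
qed

lemma sum_lessThan_add: "(\<Sum>s<m+r. F s) = (\<Sum>s<m. F s) + (\<Sum>s<r. F (m + s :: nat))" for F :: "nat \<Rightarrow> 'v"
  by (induction r) (auto simp: add.assoc)

text \<open>
  The new vectors form a basis, modulo the span \<open>U\<close> of the old ones, of the vectors that are
  $G$-invariant modulo \<open>U\<close>.
\<close>
lemma filtered_extend:
  assumes filtered: "filtered m a lev" and l0: "\<And>s. s < m \<Longrightarrow> lev s < l0" and ne: "level_span m a lev l0 \<noteq> V"
  obtains m' a' lev' where "m < m'" "filtered m' a' lev'"
proof -
  define U where "U = level_span m a lev l0"
  have sU: "subspace U" by (simp add: U_def subspace_level_span)
  have UV: "U \<subset> V" using ne level_span_V[OF filtered] by (auto simp: U_def)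
  have XU: "X v \<in> U" if "v \<in> U" for v using level_span_X[OF filtered] that by (simp add: U_def)
  have aU: "\<alpha> g v \<in> U" if "g \<in> carrier G" "v \<in> U" for g v using level_span_act[OF filtered] that by (simp add: U_def)
  define A where "A = {v \<in> V. \<forall>g\<in>carrier G. \<alpha> g v - v \<in> U}"
  have sA: "subspace A"
  proof (rule subspaceI)
    show "0 \<in> A" by (simp add: A_def subspace_0[OF sU] subspace_0[OF subspace_V])
    fix x y assume xy: "x \<in> A" "y \<in> A"
    have "\<alpha> g (x + y) - (x + y) \<in> U" if g: "g \<in> carrier G" for g
    proof -
      have "(\<alpha> g x - x) + (\<alpha> g y - y) \<in> U" using xy g by (intro subspace_add[OF sU]) (auto simp: A_def)
      also have "(\<alpha> g x - x) + (\<alpha> g y - y) = \<alpha> g (x + y) - (x + y)"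
        using g by (simp add: act_add)
      finally show ?thesis .
    qed
    then show "x + y \<in> A" using xy by (auto simp: A_def subspace_add[OF subspace_V])
  next
    fix z x assume x: "x \<in> A"
    have "\<alpha> g (z *s x) - z *s x = z *s (\<alpha> g x - x)" if "g \<in> carrier G" for g
      using that by (simp add: act_scale scale_right_diff_distrib)
    then show "z *s x \<in> A" using x by (auto simp: A_def subspace_scale[OF sU] subspace_scale[OF subspace_V])
  qed
  \<comment> \<open>\<open>L(X)\<close> commutes with the group by \<open>L_shift\<close>, so it
    preserves invariance modulo \<open>U\<close>.\<close>
  have LA: "pact L v \<in> A" if "v \<in> A" for v
  proof -
    have "\<alpha> g (pact L v) - pact L v = pact L (\<alpha> g v - v)" if g: "g \<in> carrier G" for g
      using act_pact[OF g, of v L] L_shift[OF g] \<open>v \<in> A\<close> pact_vadd[of L "\<alpha> g v - v" v] by (simp add: A_def)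
    then show ?thesis using that by (auto simp: A_def pact_V intro!: pact_closed[OF sU XU])
  qed
  \<comment> \<open>Families in \<open>A\<close> independent modulo \<open>U\<close>. Their length
    is at most \<open>card V\<close>, and a longest one spans \<open>A\<close> modulo
    \<open>U\<close>.\<close>
  define Q where "Q r a' \<longleftrightarrow> (\<forall>s<r. a' s \<in> A) \<and> (\<forall>f. (\<Sum>s<r. f s *s a' s) \<in> U \<longrightarrow> (\<forall>s<r. f s = 0))"
    for r and a' :: "nat \<Rightarrow> 'v"
  have "Q 0 a" by (simp add: Q_def)
  moreover have "r \<le> card V" if "Q r a'" for r a'
  proof -
    have "inj_on a' {..<r}" using that by (intro indep_mod_imp_inj[OF sU]) (auto simp: Q_def)
    moreover have "a' ` {..<r} \<subseteq> V" using that by (auto simp: Q_def A_def)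
    ultimately show ?thesis using card_inj_on_le[of a' "{..<r}" V] finite_V by simp
  qed
  ultimately obtain r where r: "\<exists>a'. Q r a'" and rmax: "\<And>r'. \<exists>a'. Q r' a' \<Longrightarrow> r' \<le> r"
    using Nat.ex_has_greatest_nat[of "\<lambda>r. \<exists>a'. Q r a'" 0 "card V"] by blast
  obtain a' where Q: "Q r a'" using r by blast
  have span_A: "\<exists>f. v - (\<Sum>s<r. f s *s a' s) \<in> U" if v: "v \<in> A" for v
  proof (rule ccontr)
    assume neg: "\<nexists>f. v - (\<Sum>s<r. f s *s a' s) \<in> U"
    have "Q (Suc r) (a'(r := v))"
      unfolding Q_def
    proof (intro conjI allI impI)
      fix s assume "s < Suc r" then show "(a'(r := v)) s \<in> A" using Q v by (auto simp: Q_def less_Suc_eq)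
    next
      fix f s assume f: "(\<Sum>s<Suc r. f s *s (a'(r := v)) s) \<in> U" and s: "s < Suc r"
      have e: "(\<Sum>s<Suc r. f s *s (a'(r := v)) s) = (\<Sum>s<r. f s *s a' s) + f r *s v" by simp
      have fr: "f r = 0"
      proof (rule ccontr)
        assume n: "f r \<noteq> 0"
        let ?h = "\<lambda>s. - (inverse (f r) * f s)"
        have "inverse (f r) *s ((\<Sum>s<r. f s *s a' s) + f r *s v) = v - (\<Sum>s<r. ?h s *s a' s)"
          using n by (simp add: scale_right_distrib scale_sum_right sum_negf)
        moreover have "inverse (f r) *s ((\<Sum>s<r. f s *s a' s) + f r *s v) \<in> U"
          using f e by (intro subspace_scale[OF sU]) simp
        ultimately show False using neg by metis
      qed
      then have "(\<Sum>s<r. f s *s a' s) \<in> U" using f e by simp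
      then show "f s = 0" using Q s fr by (auto simp: Q_def less_Suc_eq)
    qed
    then show False using rmax[of "Suc r"] by auto
  qed
  have r0: "r > 0"
  proof (rule ccontr)
    assume "\<not> r > 0"
    moreover obtain v where "v \<in> V" "v \<notin> U" "\<And>g. g \<in> carrier G \<Longrightarrow> \<alpha> g v - v \<in> U"
      using exists_invariant_mod[OF sU UV aU] by blast
    ultimately show False using span_A[of v] by (simp add: A_def)
  qed
  define b where "b s = (if s < m then a s else a' (s - m))" for s
  define lv where "lv s = (if s < m then lev s else l0)" for s
  have sub: "level_span m a lev l \<subseteq> level_span (m + r) b lv l" for l
    unfolding level_span_def
  proof (rule span_mono, clarify)
    fix s i assume "s < m" "i < N" "lev s < l"
    then show "\<exists>t j. (X ^^ i) (a s) = (X ^^ j) (b t) \<and> t < m + r \<and> j < N \<and> lv t < l"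
      by (intro exI[of _ s] exI[of _ i]) (simp add: b_def lv_def)
  qed
  have "filtered (m + r) b lv"
    unfolding filtered_def
  proof (intro conjI allI impI ballI)
    fix s assume "s < m + r"
    then show "b s \<in> V" using filtered Q by (auto simp: filtered_def Q_def A_def b_def)
  next
    fix f s i assume f: "(\<Sum>s<m + r. \<Sum>i<N. f s i *s (X ^^ i) (b s)) = 0" and s: "s < m + r" and i: "i < N"
    let ?S1 = "\<Sum>s<m. \<Sum>i<N. f s i *s (X ^^ i) (a s)" and ?S2 = "\<Sum>s<r. \<Sum>i<N. f (m + s) i *s (X ^^ i) (a' s)"
    have e: "?S1 + ?S2 = 0" using f by (simp add: sum_lessThan_add b_def)
    have S1: "?S1 \<in> U"
      unfolding U_def by (intro subspace_sum subspace_scale subspace_level_span level_span_base l0) auto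
    have "?S2 = - ?S1" using e by (simp add: eq_neg_iff_add_eq_0 add.commute)
    then have "?S2 \<in> U" using subspace_neg[OF sU S1] by simp
    \<comment> \<open>Grouping by powers of \<open>X\<close> brings the relation into the form of
      \<open>X_independent_mod\<close>, with coefficients in \<open>A\<close>.\<close>
    moreover have "?S2 = (\<Sum>i<N. (X ^^ i) (\<Sum>s<r. f (m + s) i *s a' s))"
      by (subst sum.swap) (simp add: Xp_sum Xp_scale)
    ultimately have "(\<Sum>i<N. (X ^^ i) (\<Sum>s<r. f (m + s) i *s a' s)) \<in> U" by simp
    moreover have inA: "(\<Sum>s<r. f (m + s) i *s a' s) \<in> A" for i
      using Q by (intro subspace_sum subspace_scale sA) (auto simp: Q_def)
    ultimately have "(\<Sum>s<r. f (m + s) i *s a' s) \<in> U" if "i < N" for i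
      using that by (intro X_independent_mod[OF sU XU aU, where a = "\<lambda>i. \<Sum>s<r. f (m + s) i *s a' s"])
        (auto simp: A_def)
    then have z: "\<forall>i<N. \<forall>s<r. f (m + s) i = 0"
      using Q[unfolded Q_def, THEN conjunct2, rule_format, of "\<lambda>s. f (m + s) _"] by blast
    then have "?S2 = 0" by simp
    then have "?S1 = 0" using e by simp
    then have "\<forall>s<m. \<forall>i<N. f s i = 0" using filtered by (auto simp: filtered_def)
    then show "f s i = 0" using z[rule_format, of i "s - m"] i s by (cases "s < m") auto
  next
    fix s t assume "s \<le> t" "t < m + r"
    then show "lv s \<le> lv t" using filtered l0[of s] by (auto simp: lv_def filtered_def)
  next
    fix s g assume s: "s < m + r" and g: "g \<in> carrier G"
    show "\<alpha> g (b s) - b s \<in> level_span (m + r) b lv (lv s)"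
    proof (cases "s < m")
      case True
      then show ?thesis using filtered g sub[of "lev s"] by (auto simp: filtered_def b_def lv_def)
    next
      case False
      then have "a' (s - m) \<in> A" using Q s by (auto simp: Q_def)
      then have "\<alpha> g (a' (s - m)) - a' (s - m) \<in> level_span m a lev l0" using g by (auto simp: A_def U_def)
      then show ?thesis using False sub[of l0] by (auto simp: b_def lv_def)
    qed
  next
    fix s assume s: "s < m + r"
    show "(X ^^ N) (b s) \<in> level_span (m + r) b lv (Suc (lv s))"
    proof (cases "s < m")
      case True
      then show ?thesis using filtered sub[of "Suc (lev s)"] by (auto simp: filtered_def b_def lv_def)
    next
      case False
      \<comment> \<open>\<open>X ^^ N\<close> is \<open>L(X)\<close> minus a combination of lower
        powers of \<open>X\<close>. The lower powers give new basis vectors, and \<open>L(X)\<close>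
        maps \<open>A\<close> to itself, hence into the span of the new vectors modulo
        \<open>U\<close>.\<close>
      let ?W = "level_span (m + r) b lv (Suc l0)"
      let ?v = "a' (s - m)"
      have base: "(X ^^ i) (a' t) \<in> ?W" if "t < r" "i < N" for t i
        using level_span_base[of "m + t" "m + r" i lv "Suc l0" b] that by (simp add: b_def lv_def)
      have v: "?v \<in> A" "s - m < r" using Q s False by (auto simp: Q_def)
      obtain f where f: "pact L ?v - (\<Sum>t<r. f t *s a' t) \<in> U" using span_A[OF LA[OF v(1)]] by blast
      have "U \<subseteq> ?W" using order.trans[OF sub[of l0] level_span_mono[of l0 "Suc l0" "m + r" b lv]] by (simp add: U_def)
      then have "pact L ?v - (\<Sum>t<r. f t *s a' t) \<in> ?W" using f by blast
      moreover have "(\<Sum>t<r. f t *s a' t) \<in> ?W"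
        using base[of _ 0] N_pos by (intro subspace_sum subspace_scale subspace_level_span) auto
      ultimately have "pact L ?v \<in> ?W" using subspace_add[OF subspace_level_span] by fastforce
      moreover have "(\<Sum>i<N. coeff L i *s (X ^^ i) ?v) \<in> ?W"
        using base v(2) by (intro subspace_sum subspace_scale subspace_level_span) auto
      ultimately have "pact L ?v - (\<Sum>i<N. coeff L i *s (X ^^ i) ?v) \<in> ?W"
        by (rule subspace_diff[OF subspace_level_span])
      then show ?thesis using False by (simp add: pact_L b_def lv_def)
    qed
  qed
  then show thesis using that[of "m + r"] r0 by simp
qed

theorem exists_filtered_basis:
  obtains m a lev l0 where "filtered m a lev" "\<And>s. s < m \<Longrightarrow> lev s < l0" "level_span m a lev l0 = V"
proof -
  have "filtered 0 (\<lambda>_. 0) (\<lambda>_. 0)" by (simp add: filtered_def)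
  moreover have "m \<le> card V" if g: "filtered m a lev" for m a lev
  proof -
    have "inj_on a {..<m}"
    proof (rule indep_mod_imp_inj[of "{0}"])
      fix f s assume f: "(\<Sum>s<m. f s *s a s) \<in> {0}"
      have "(\<Sum>i<N. (if i = 0 then f s else 0) *s (X ^^ i) (a s)) = f s *s a s" for s
        using N_pos by (subst sum.mono_neutral_right[of "{..<N}" "{0}"]) auto
      then have "(\<Sum>s<m. \<Sum>i<N. (if i = 0 then f s else 0) *s (X ^^ i) (a s)) = 0" using f by simp
      then have "\<forall>s<m. \<forall>i<N. (if i = 0 then f s else 0) = 0"
        using g[unfolded filtered_def, THEN conjunct2, THEN conjunct1, rule_format, of "\<lambda>s i. if i = 0 then f s else 0"] by blast
      then show "\<forall>s<m. f s = 0" using N_pos by metis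
    qed simp
    moreover have "a ` {..<m} \<subseteq> V" using g by (auto simp: filtered_def)
    ultimately show ?thesis using card_inj_on_le[of a "{..<m}" V] finite_V by simp
  qed
  ultimately obtain m where m: "\<exists>a lev. filtered m a lev" and mmax: "\<And>m'. \<exists>a lev. filtered m' a lev \<Longrightarrow> m' \<le> m"
    using Nat.ex_has_greatest_nat[of "\<lambda>m. \<exists>a lev. filtered m a lev" 0 "card V"] by blast
  then obtain a lev where g: "filtered m a lev" by blast
  \<comment> \<open>Only a strict upper bound for all levels is wanted.\<close>
  have l0: "lev s < Suc (\<Sum>s<m. lev s)" if "s < m" for s
    using member_le_sum[of s "{..<m}" lev] that by simp
  show thesis
  proof (rule that[OF g l0], assumption)
    show "level_span m a lev (Suc (\<Sum>s<m. lev s)) = V"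
    proof (rule ccontr)
      assume "level_span m a lev (Suc (\<Sum>s<m. lev s)) \<noteq> V"
      from filtered_extend[OF g l0 this] mmax show False by (metis leD)
    qed
  qed
qed

end

text \<open>The index \<open>s * N + i\<close> stands for position \<open>i\<close> in block
  \<open>s\<close>; the adapted bases and matrices below are indexed in this way.\<close>

lemma sum_div_mod:
  fixes F :: "nat \<Rightarrow> nat \<Rightarrow> 'c::comm_monoid_add"
  assumes "N > 0"
  shows "(\<Sum>k<m*N. F (k div N) (k mod N)) = (\<Sum>s<m. \<Sum>i<N. F s i)"
proof -
  have "(\<Sum>s<m. \<Sum>i<N. F s i) = (\<Sum>(s, i)\<in>{..<m} \<times> {..<N}. F s i)"
    by (simp add: sum.cartesian_product)
  also have "\<dots> = (\<Sum>k<m*N. F (k div N) (k mod N))"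
  proof (rule sum.reindex_bij_witness[of _ "\<lambda>k. (k div N, k mod N)" "\<lambda>(s, i). s * N + i"])
    fix x assume "x \<in> {..<m} \<times> {..<N}"
    then obtain s i where x: "x = (s, i)" "s < m" "i < N" by auto
    then have "Suc s * N \<le> m * N" by (intro mult_le_mono1) simp
    then show "(case x of (s, i) \<Rightarrow> s * N + i) \<in> {..<m * N}" using x by simp
  qed (use assms in \<open>auto simp: less_mult_imp_div_less div_mult_mod_eq\<close>)
  finally show ?thesis by simp
qed

context twisted_module
begin

text \<open>The basis lists the vectors \<open>(X ^^ i) (a s)\<close> of a complete filtered family
  block by block. For the last clause, \<open>g\<close> takes such a vector to
  \<open>(X + c g)^i\<close> applied to \<open>a s\<close> plus lower terms, so within the level
  only binomial coefficients remain.\<close>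

theorem exists_adapted_basis:
  obtains m b lev where
    "\<And>j. j < m * N \<Longrightarrow> b j \<in> V"
    "\<And>f. (\<Sum>j<m*N. f j *s b j) = 0 \<Longrightarrow> (\<forall>j<m*N. f j = 0)"
    "\<And>v. v \<in> V \<Longrightarrow> \<exists>f. v = (\<Sum>j<m*N. f j *s b j)"
    "\<And>s t. s \<le> t \<Longrightarrow> t < m \<Longrightarrow> lev s \<le> (lev t :: nat)"
    "\<And>j. j < m * N \<Longrightarrow> Suc (j mod N) < N \<Longrightarrow> X (b j) = b (Suc j)"
    "\<And>j. j < m * N \<Longrightarrow> \<exists>f. X (b j) = (\<Sum>i<m*N. f i *s b i) \<and> (\<forall>i. lev (i div N) > lev (j div N) \<longrightarrow> f i = 0)"
    "\<And>j g. j < m * N \<Longrightarrow> g \<in> carrier G \<Longrightarrow> \<exists>f. \<alpha> g (b j) = (\<Sum>i<m*N. f i *s b i) \<and>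
      (\<forall>i. lev (i div N) > lev (j div N) \<longrightarrow> f i = 0) \<and>
      (\<forall>i. lev (i div N) = lev (j div N) \<longrightarrow>
         f i = (if i div N = j div N then coeff ([:c g, 1:] ^ (j mod N)) (i mod N) else 0))"
proof -
  obtain m a lev l0 where filtered: "filtered m a lev" and l0: "\<And>s. s < m \<Longrightarrow> lev s < l0"
    and V: "level_span m a lev l0 = V" using exists_filtered_basis by blast
  define b where "b j = (X ^^ (j mod N)) (a (j div N))" for j
  have dm: "j div N < m" "j mod N < N" if "j < m * N" for j
    using that N_pos by (auto simp: less_mult_imp_div_less)
  have coords: "\<exists>f. v = (\<Sum>j<m*N. f j *s b j) \<and> (\<forall>j. lev (j div N) \<ge> l \<longrightarrow> f j = 0)"
    if "v \<in> level_span m a lev l" for v l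
  proof -
    let ?W = "{v. \<exists>f. v = (\<Sum>j<m*N. f j *s b j) \<and> (\<forall>j. lev (j div N) \<ge> l \<longrightarrow> f j = 0)}"
    have "level_span m a lev l \<subseteq> ?W"
      unfolding level_span_def
    proof (rule span_minimal)
      show "subspace ?W"
      proof (rule subspaceI)
        show "0 \<in> ?W" by (auto intro!: exI[of _ "\<lambda>_. 0"])
        fix x y assume "x \<in> ?W" "y \<in> ?W"
        then obtain f g where "x = (\<Sum>j<m*N. f j *s b j)" "\<forall>j. lev (j div N) \<ge> l \<longrightarrow> f j = 0"
          "y = (\<Sum>j<m*N. g j *s b j)" "\<forall>j. lev (j div N) \<ge> l \<longrightarrow> g j = 0" by auto
        then show "x + y \<in> ?W"
          by (auto simp: scale_left_distrib sum.distrib intro!: exI[of _ "\<lambda>j. f j + g j"])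
      next
        fix z x assume "x \<in> ?W"
        then obtain f where "x = (\<Sum>j<m*N. f j *s b j)" "\<forall>j. lev (j div N) \<ge> l \<longrightarrow> f j = 0" by auto
        then show "z *s x \<in> ?W"
          by (auto simp: scale_sum_right intro!: exI[of _ "\<lambda>j. z * f j"])
      qed
      show "{(X ^^ i) (a s) |s i. s < m \<and> i < N \<and> lev s < l} \<subseteq> ?W"
      proof clarify
        fix s i assume s: "s < m" "i < N" "lev s < l"
        have "Suc s * N \<le> m * N" using s by (intro mult_le_mono1) simp
        then have lt: "s * N + i < m * N" using s by simp
        have "(\<Sum>j<m*N. (if j = s * N + i then 1 else 0) *s b j) = (\<Sum>j\<in>{s * N + i}. (if j = s * N + i then 1 else 0) *s b j)"
          using lt by (intro sum.mono_neutral_right) auto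
        also have "\<dots> = (X ^^ i) (a s)" using s by (simp add: b_def)
        finally show "\<exists>f. (X ^^ i) (a s) = (\<Sum>j<m*N. f j *s b j) \<and> (\<forall>j. lev (j div N) \<ge> l \<longrightarrow> f j = 0)"
          using s by (intro exI[of _ "\<lambda>j. if j = s * N + i then 1 else 0"]) auto
      qed
    qed
    then show ?thesis using that by blast
  qed
  show thesis
  proof (rule that)
    fix j assume "j < m * N"
    then show "b j \<in> V" using filtered dm by (auto simp: filtered_def b_def intro!: Xp_V)
  next
    fix f assume f: "(\<Sum>j<m*N. f j *s b j) = 0"
    have "(\<Sum>j<m*N. f j *s b j) = (\<Sum>j<m*N. f (j div N * N + j mod N) *s (X ^^ (j mod N)) (a (j div N)))"
      unfolding div_mult_mod_eq b_def ..
    also have "\<dots> = (\<Sum>s<m. \<Sum>i<N. f (s * N + i) *s (X ^^ i) (a s))"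
      by (rule sum_div_mod[OF N_pos])
    finally have "(\<Sum>s<m. \<Sum>i<N. f (s * N + i) *s (X ^^ i) (a s)) = 0" using f by simp
    then have z: "\<forall>s<m. \<forall>i<N. f (s * N + i) = 0"
      using filtered[unfolded filtered_def, THEN conjunct2, THEN conjunct1, rule_format, of "\<lambda>s i. f (s * N + i)"] by blast
    show "\<forall>j<m*N. f j = 0"
    proof (intro allI impI)
      fix j assume "j < m * N"
      from z[rule_format, OF dm[OF this]] show "f j = 0" unfolding div_mult_mod_eq .
    qed
  next
    fix v assume "v \<in> V" then show "\<exists>f. v = (\<Sum>j<m*N. f j *s b j)" using coords[of v l0] V by blast
  next
    fix s t assume "s \<le> t" "t < m" then show "lev s \<le> lev t" using filtered by (auto simp: filtered_def)
  next
    fix j assume "j < m * N" "Suc (j mod N) < N"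
    moreover from this have "Suc j mod N = Suc (j mod N)" "Suc j div N = j div N"
      by (auto simp: mod_Suc div_Suc)
    ultimately show "X (b j) = b (Suc j)" by (simp add: b_def)
  next
    fix j assume j: "j < m * N"
    have "b j \<in> level_span m a lev (Suc (lev (j div N)))" using level_span_base dm[OF j] by (simp add: b_def)
    then have "X (b j) \<in> level_span m a lev (Suc (lev (j div N)))" by (rule level_span_X[OF filtered])
    from coords[OF this] show "\<exists>f. X (b j) = (\<Sum>i<m*N. f i *s b i) \<and> (\<forall>i. lev (i div N) > lev (j div N) \<longrightarrow> f i = 0)"
      by (simp add: Suc_le_eq)
  next
    fix j g assume j: "j < m * N" and g: "g \<in> carrier G"
    let ?s = "j div N" and ?i = "j mod N"
    let ?q = "[:c g, 1:] ^ ?i"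
    \<comment> \<open>The deviation of \<open>a ?s\<close> from invariance lies in lower levels, and
      polynomials in \<open>X\<close> keep it there.\<close>
    define u where "u = \<alpha> g (a ?s) - a ?s"
    have aV: "a ?s \<in> V" using filtered dm[OF j] by (auto simp: filtered_def)
    have "u \<in> level_span m a lev (lev ?s)" using filtered dm[OF j] g by (auto simp: filtered_def u_def)
    then have "pact ?q u \<in> level_span m a lev (lev ?s)" by (intro pact_closed[OF subspace_level_span] level_span_X[OF filtered])
    then obtain f where f: "pact ?q u = (\<Sum>i<m*N. f i *s b i)" "\<And>i. lev (i div N) \<ge> lev ?s \<Longrightarrow> f i = 0"
      using coords by blast
    have "monom 1 ?i \<circ>\<^sub>p [:c g, 1:] = ?q"
      by (simp add: monom_altdef pcompose_hom.hom_power pcompose_pCons)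
    then have "\<alpha> g (b j) = pact ?q (a ?s + u)"
      using act_pact[OF g aV, of "monom 1 ?i"] by (simp add: pact_monom b_def u_def)
    also have "\<dots> = pact ?q (a ?s) + pact ?q u" by (rule pact_vadd)
    also have "pact ?q (a ?s) = (\<Sum>i<m*N. (if i div N = ?s then coeff ?q (i mod N) else 0) *s b i)"
    proof -
      \<comment> \<open>The degree stays below \<open>N\<close>, so only basis vectors of the same
        block occur and \<open>X ^^ N\<close> does not.\<close>
      have "degree ?q \<le> N - 1" using degree_power_le[of "[:c g, 1:]" ?i] dm[OF j] by simp
      from pact_bound[OF this, of "a ?s"]
      have "pact ?q (a ?s) = (\<Sum>i<N. coeff ?q i *s (X ^^ i) (a ?s))"
        using N_pos lessThan_Suc_atMost[of "N - 1"] by simp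
      also have "\<dots> = (\<Sum>s\<in>{?s}. \<Sum>i<N. (if s = ?s then coeff ?q i else 0) *s (X ^^ i) (a s))" by simp
      also have "\<dots> = (\<Sum>s<m. \<Sum>i<N. (if s = ?s then coeff ?q i else 0) *s (X ^^ i) (a s))"
        using dm[OF j] by (intro sum.mono_neutral_left) auto
      also have "\<dots> = (\<Sum>i<m*N. (if i div N = ?s then coeff ?q (i mod N) else 0) *s b i)"
        unfolding b_def by (rule sum_div_mod[OF N_pos, symmetric])
      finally show ?thesis .
    qed
    finally have "\<alpha> g (b j) = (\<Sum>i<m*N. ((if i div N = ?s then coeff ?q (i mod N) else 0) + f i) *s b i)"
      by (simp add: f(1) scale_left_distrib sum.distrib)
    then show "\<exists>f. \<alpha> g (b j) = (\<Sum>i<m*N. f i *s b i) \<and>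
      (\<forall>i. lev (i div N) > lev (j div N) \<longrightarrow> f i = 0) \<and>
      (\<forall>i. lev (i div N) = lev (j div N) \<longrightarrow>
         f i = (if i div N = j div N then coeff ([:c g, 1:] ^ (j mod N)) (i mod N) else 0))"
      using f(2) by (intro exI[of _ "\<lambda>i. (if i div N = ?s then coeff ?q (i mod N) else 0) + f i"]) auto
  qed
qed

end

section \<open>The adapted basis in matrix form\<close>

lemma index_mat_mult:
  assumes "A \<in> carrier_mat n m" "B \<in> carrier_mat m k" "i < n" "j < k"
  shows "(A * B) $$ (i, j) = (\<Sum>l<m. A $$ (i, l) * B $$ (l, j))"
  using assms by (auto simp: scalar_prod_def atLeast0LessThan intro!: sum.cong)

text \<open>Columns are modelled as functions that vanish from \<open>n\<close> on. Unlike
  \<open>vec\<close>, whose members have different dimensions, functions form a type that is itself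
  an additive group, as \<open>twisted_module\<close> demands.\<close>

definition mat_op :: "nat \<Rightarrow> 'a::semiring_0 mat \<Rightarrow> (nat \<Rightarrow> 'a) \<Rightarrow> nat \<Rightarrow> 'a" where
  "mat_op n A f = (\<lambda>i. if i < n then \<Sum>j<n. A $$ (i, j) * f j else 0)"

lemma mat_op_mult:
  assumes "A \<in> carrier_mat n n" "B \<in> carrier_mat n n"
  shows "mat_op n (A * B) f = mat_op n A (mat_op n B f)"
proof
  fix i show "mat_op n (A * B) f i = mat_op n A (mat_op n B f) i"
  proof (cases "i < n")
    case True
    have "(\<Sum>j<n. (A * B) $$ (i, j) * f j) = (\<Sum>j<n. \<Sum>l<n. A $$ (i, l) * B $$ (l, j) * f j)"
      using True by (simp add: index_mat_mult[OF assms] sum_distrib_right)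
    also have "\<dots> = (\<Sum>l<n. \<Sum>j<n. A $$ (i, l) * B $$ (l, j) * f j)" by (rule sum.swap)
    finally show ?thesis using True by (simp add: mat_op_def sum_distrib_left mult.assoc)
  qed (simp add: mat_op_def)
qed

lemma sum_fun_apply: "(\<Sum>l\<in>I. F l) i = (\<Sum>l\<in>I. F l i)" for F :: "'b \<Rightarrow> 'c \<Rightarrow> 'a::comm_monoid_add"
  by (induction I rule: infinite_finite_induct) auto

text \<open>The columns of \<open>M\<close> are an adapted basis, so \<open>M' * A * M\<close> is
  the matrix of \<open>A\<close> in that basis. For the last column of each block only the level
  condition on \<open>X\<close> is available, because \<open>X ^^ N\<close> is not controlled within
  the level.\<close>

lemma exists_adapted_matrix:
  fixes X :: "'q::finite_field mat" and G (structure) and n k :: nat and c :: "'q mat \<Rightarrow> 'q"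
  assumes X: "X \<in> carrier_mat n n" and G: "group G" and ord: "order G = CHAR('q) ^ k"
    and carr: "carrier G \<subseteq> carrier_mat n n" and mult: "mult G = (*)" and one: "\<one> = 1\<^sub>m n"
    and c: "\<And>g h. g \<in> carrier G \<Longrightarrow> h \<in> carrier G \<Longrightarrow> c (g * h) = c g + c h"
    and twist: "\<And>g. g \<in> carrier G \<Longrightarrow> g * X = X * g + c g \<cdot>\<^sub>m g"
  obtains M M' m N lev where
    "M \<in> carrier_mat n n" "M' \<in> carrier_mat n n" "M * M' = 1\<^sub>m n" "M' * M = 1\<^sub>m n"
    "n = m * N" "N = card (c ` carrier G)" "N > 0"
    "\<And>s t. s \<le> t \<Longrightarrow> t < m \<Longrightarrow> lev s \<le> (lev t :: nat)"
    "\<And>i j. i < n \<Longrightarrow> j < n \<Longrightarrow> lev (i div N) > lev (j div N) \<Longrightarrow> (M' * X * M) $$ (i, j) = 0"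
    "\<And>i j. i < n \<Longrightarrow> j < n \<Longrightarrow> Suc (j mod N) < N \<Longrightarrow> (M' * X * M) $$ (i, j) = (if i = Suc j then 1 else 0)"
    "\<And>g i j. g \<in> carrier G \<Longrightarrow> i < n \<Longrightarrow> j < n \<Longrightarrow> lev (i div N) > lev (j div N) \<Longrightarrow> (M' * g * M) $$ (i, j) = 0"
    "\<And>g i j. g \<in> carrier G \<Longrightarrow> i < n \<Longrightarrow> j < n \<Longrightarrow> lev (i div N) = lev (j div N) \<Longrightarrow> (M' * g * M) $$ (i, j) =
        (if i div N = j div N then coeff ([:c g, 1:] ^ (j mod N)) (i mod N) else 0)"
proof -
  define V :: "(nat \<Rightarrow> 'q) set" where "V = {f. \<forall>i\<ge>n. f i = 0}"
  define sc :: "'q \<Rightarrow> (nat \<Rightarrow> 'q) \<Rightarrow> nat \<Rightarrow> 'q" where "sc a f = (\<lambda>i. a * f i)" for a f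
  interpret vs: vector_space sc
    by unfold_locales (auto simp: sc_def fun_eq_iff algebra_simps)
  have bijV: "bij_betw (\<lambda>f i. if i < n then f i else 0) ({..<n} \<rightarrow>\<^sub>E UNIV) V"
    by (rule bij_betwI[where g = "\<lambda>f. restrict f {..<n}"]) (auto simp: V_def fun_eq_iff PiE_def extensional_def)
  then have finV: "finite V" using bij_betw_finite[OF bijV] by (simp add: finite_PiE)
  have cardV: "card V = card (UNIV :: 'q set) ^ n"
    using bij_betw_same_card[OF bijV] by (simp add: card_PiE)
  have opV: "mat_op n A f \<in> V" for A f by (simp add: mat_op_def V_def)
  have op_add: "mat_op n A (f + g) = mat_op n A f + mat_op n A g" for A :: "'q mat" and f g
    by (auto simp: mat_op_def fun_eq_iff algebra_simps sum.distrib)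
  have op_sc: "mat_op n A (sc z f) = sc z (mat_op n A f)" for A :: "'q mat" and z f
    by (auto simp: mat_op_def sc_def fun_eq_iff sum_distrib_left algebra_simps)
  have op_one: "mat_op n (1\<^sub>m n) f = f" if "f \<in> V" for f :: "nat \<Rightarrow> 'q"
  proof
    fix i show "mat_op n (1\<^sub>m n) f i = f i"
    proof (cases "i < n")
      case True
      have "(\<Sum>j<n. (1\<^sub>m n) $$ (i, j) * f j) = (\<Sum>j\<in>{i}. (1\<^sub>m n) $$ (i, j) * f j)"
        using True by (intro sum.mono_neutral_right) auto
      then show ?thesis using True by (simp add: mat_op_def)
    qed (use that in \<open>simp add: mat_op_def V_def\<close>)
  qed
  interpret tw: twisted_module sc V "mat_op n X" G "mat_op n" c k
  proof (intro twisted_module.intro twisted_module_axioms.intro vs.vector_space_axioms G ord finV)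
    show "vs.subspace V" by (rule vs.subspaceI) (auto simp: V_def sc_def)
    fix g v assume g: "g \<in> carrier G"
    then have gc: "g \<in> carrier_mat n n" using carr by auto
    have "mat_op n g (mat_op n X v) = mat_op n (X * g + c g \<cdot>\<^sub>m g) v"
      using mat_op_mult[OF gc X] twist[OF g] by simp
    also have "\<dots> = mat_op n (X * g) v + sc (c g) (mat_op n g v)"
      using gc X by (auto simp: mat_op_def sc_def fun_eq_iff algebra_simps sum.distrib sum_distrib_left simp del: index_mult_mat)
    finally show "mat_op n g (mat_op n X v) = mat_op n X (mat_op n g v) + sc (c g) (mat_op n g v)"
      by (simp add: mat_op_mult[OF X gc])
  next
    fix g h v assume "g \<in> carrier G" "h \<in> carrier G"
    then show "mat_op n (g \<otimes> h) v = mat_op n g (mat_op n h v)" "c (g \<otimes> h) = c g + c h"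
      using carr c by (auto simp: mult intro!: mat_op_mult)
  qed (simp_all add: opV op_add op_sc op_one one)
  obtain m b lev where b: "\<And>j. j < m * tw.N \<Longrightarrow> b j \<in> V"
    "\<And>f. (\<Sum>j<m*tw.N. sc (f j) (b j)) = 0 \<Longrightarrow> (\<forall>j<m*tw.N. f j = 0)"
    "\<And>v. v \<in> V \<Longrightarrow> \<exists>f. v = (\<Sum>j<m*tw.N. sc (f j) (b j))"
    "\<And>s t. s \<le> t \<Longrightarrow> t < m \<Longrightarrow> lev s \<le> (lev t :: nat)"
    "\<And>j. j < m * tw.N \<Longrightarrow> Suc (j mod tw.N) < tw.N \<Longrightarrow> mat_op n X (b j) = b (Suc j)"
    "\<And>j. j < m * tw.N \<Longrightarrow> \<exists>f. mat_op n X (b j) = (\<Sum>i<m*tw.N. sc (f i) (b i)) \<and> (\<forall>i. lev (i div tw.N) > lev (j div tw.N) \<longrightarrow> f i = 0)"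
    "\<And>j g. j < m * tw.N \<Longrightarrow> g \<in> carrier G \<Longrightarrow> \<exists>f. mat_op n g (b j) = (\<Sum>i<m*tw.N. sc (f i) (b i)) \<and>
      (\<forall>i. lev (i div tw.N) > lev (j div tw.N) \<longrightarrow> f i = 0) \<and>
      (\<forall>i. lev (i div tw.N) = lev (j div tw.N) \<longrightarrow>
         f i = (if i div tw.N = j div tw.N then coeff ([:c g, 1:] ^ (j mod tw.N)) (i mod tw.N) else 0))"
  proof (rule tw.exists_adapted_basis, goal_cases)
    case (1 m b lev)
    show ?case by (rule 1(1)[OF 1(2-8)])
  qed
  \<comment> \<open>Both numbers are the dimension of \<open>V\<close>, as is seen by counting its
    elements.\<close>
  have n: "n = m * tw.N"
  proof -
    let ?K = "m * tw.N"
    have "bij_betw (\<lambda>f. \<Sum>j<?K. sc (f j) (b j)) ({..<?K} \<rightarrow>\<^sub>E (UNIV :: 'q set)) V"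
    proof (rule bij_betwI')
      fix f g :: "nat \<Rightarrow> 'q" assume fg: "f \<in> {..<?K} \<rightarrow>\<^sub>E UNIV" "g \<in> {..<?K} \<rightarrow>\<^sub>E UNIV"
      show "(\<Sum>j<?K. sc (f j) (b j)) = (\<Sum>j<?K. sc (g j) (b j)) \<longleftrightarrow> f = g"
      proof
        assume "(\<Sum>j<?K. sc (f j) (b j)) = (\<Sum>j<?K. sc (g j) (b j))"
        then have "(\<Sum>j<?K. sc (f j - g j) (b j)) = 0"
          by (simp add: vs.scale_left_diff_distrib sum_subtractf)
        from b(2)[OF this] show "f = g" using fg by (intro PiE_ext[of f "{..<?K}" "\<lambda>_. UNIV" g]) auto
      qed simp
    next
      fix f :: "nat \<Rightarrow> 'q" show "(\<Sum>j<?K. sc (f j) (b j)) \<in> V"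
        using b(1) tw.subspace_V by (intro vs.subspace_sum vs.subspace_scale) auto
    next
      fix v assume "v \<in> V"
      then obtain f where "v = (\<Sum>j<?K. sc (f j) (b j))" using b(3) by blast
      then show "\<exists>f\<in>{..<?K} \<rightarrow>\<^sub>E UNIV. v = (\<Sum>j<?K. sc (f j) (b j))"
        by (intro bexI[of _ "restrict f {..<?K}"]) auto
    qed
    from bij_betw_same_card[OF this] have "card (UNIV :: 'q set) ^ ?K = card (UNIV :: 'q set) ^ n"
      using cardV by (simp add: card_PiE)
    moreover have "card (UNIV :: 'q set) > 1"
      using card_mono[of "UNIV :: 'q set" "{0, 1}"] by simp
    ultimately show ?thesis by (simp add: power_inject_exp)
  qed
  define M where "M = mat n n (\<lambda>(i, j). b j i)"
  have M: "M \<in> carrier_mat n n" by (simp add: M_def)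
  have Mi: "M $$ (i, j) = b j i" if "i < n" "j < n" for i j using that by (simp add: M_def)
  have key: "A * M = M * F" if A: "A \<in> carrier_mat n n" and F: "F \<in> carrier_mat n n"
    and eq: "\<And>j. j < n \<Longrightarrow> mat_op n A (b j) = (\<Sum>i<n. sc (F $$ (i, j)) (b i))" for A F
  proof (rule eq_matI)
    fix i j assume "i < dim_row (M * F)" "j < dim_col (M * F)"
    then have ij: "i < n" "j < n" using M F by auto
    have "(A * M) $$ (i, j) = mat_op n A (b j) i"
      using ij by (simp add: index_mat_mult[OF A M] mat_op_def Mi)
    also have "\<dots> = (\<Sum>l<n. sc (F $$ (l, j)) (b l) i)" using eq[OF ij(2)] by (simp add: sum_fun_apply)
    also have "\<dots> = (M * F) $$ (i, j)"
      using ij by (simp add: index_mat_mult[OF M F] sc_def Mi mult.commute)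
    finally show "(A * M) $$ (i, j) = (M * F) $$ (i, j)" .
  qed (use A M F in auto)
  \<comment> \<open>The columns of the inverse are the coordinates of the unit vectors in the
    basis.\<close>
  have "\<exists>f. \<forall>j. (if j < n then (\<lambda>i. if i = j then 1 else 0) = (\<Sum>i<n. sc (f j i) (b i)) else True)"
    using b(3) n by (intro choice) (auto simp: V_def)
  then obtain f where f: "\<And>j. j < n \<Longrightarrow> (\<lambda>i. if i = j then 1 else 0) = (\<Sum>i<n. sc (f j i) (b i))" by metis
  define M' where "M' = mat n n (\<lambda>(i, j). f j i)"
  have M': "M' \<in> carrier_mat n n" by (simp add: M'_def)
  have MM': "M * M' = 1\<^sub>m n"
  proof (rule eq_matI)
    fix i j assume "i < dim_row (1\<^sub>m n)" "j < dim_col (1\<^sub>m n)"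
    then have ij: "i < n" "j < n" by auto
    have "(M * M') $$ (i, j) = (\<Sum>l<n. sc (f j l) (b l) i)"
      unfolding index_mat_mult[OF M M' ij] using ij by (simp add: sc_def Mi M'_def mult.commute)
    also have "\<dots> = (if i = j then 1 else 0)" using fun_cong[OF f[OF ij(2)], of i] by (simp add: sum_fun_apply)
    finally show "(M * M') $$ (i, j) = 1\<^sub>m n $$ (i, j)" using ij by simp
  qed (use M M' in auto)
  have M'M: "M' * M = 1\<^sub>m n" by (rule mat_mult_left_right_inverse[OF M M' MM'])
  have conj: "M' * A * M = F" if A: "A \<in> carrier_mat n n" and F: "F \<in> carrier_mat n n"
    and eq: "\<And>j. j < n \<Longrightarrow> mat_op n A (b j) = (\<Sum>i<n. sc (F $$ (i, j)) (b i))" for A F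
  proof -
    have "M' * A * M = M' * (M * F)" using key[OF that] A M M' by simp
    also have "\<dots> = F" using M M' F M'M by (simp flip: assoc_mult_mat)
    finally show ?thesis .
  qed
  \<comment> \<open>\<open>Suc j\<close> is not a multiple of \<open>N\<close>, so it stays below
    \<open>n\<close>.\<close>
  have bSuc: "b (Suc j) = (\<Sum>i<n. sc (if i = Suc j then 1 else 0) (b i))" if "j < n" "Suc (j mod tw.N) < tw.N" for j
  proof -
    have "Suc j mod tw.N \<noteq> 0" using that(2) by (simp add: mod_Suc)
    then have "Suc j \<noteq> n" using n by (metis mod_mult_self2_is_0)
    then have "Suc j < n" using that(1) by simp
    then have "(\<Sum>i<n. sc (if i = Suc j then 1 else 0) (b i)) = (\<Sum>i\<in>{Suc j}. sc (if i = Suc j then 1 else 0) (b i))"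
      by (intro sum.mono_neutral_right) auto
    then show ?thesis by simp
  qed
  have "\<exists>f. mat_op n X (b j) = (\<Sum>i<n. sc (f i) (b i)) \<and> (\<forall>i. lev (i div tw.N) > lev (j div tw.N) \<longrightarrow> f i = 0)
      \<and> (Suc (j mod tw.N) < tw.N \<longrightarrow> (\<forall>i. f i = (if i = Suc j then 1 else 0)))" if j: "j < n" for j
  proof (cases "Suc (j mod tw.N) < tw.N")
    case True
    then have "Suc j div tw.N = j div tw.N" by (simp add: div_Suc mod_Suc)
    then show ?thesis using b(5)[of j] bSuc[OF j True] j n True
      by (intro exI[of _ "\<lambda>i. if i = Suc j then 1 else 0"]) auto
  next
    case False
    then show ?thesis using b(6)[of j] j n by auto
  qed
  then have "\<forall>j. \<exists>f. j < n \<longrightarrow> mat_op n X (b j) = (\<Sum>i<n. sc (f i) (b i)) \<and> (\<forall>i. lev (i div tw.N) > lev (j div tw.N) \<longrightarrow> f i = 0)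
      \<and> (Suc (j mod tw.N) < tw.N \<longrightarrow> (\<forall>i. f i = (if i = Suc j then 1 else 0)))" by blast
  from choice[OF this] obtain f where f: "\<And>j. j < n \<Longrightarrow> mat_op n X (b j) = (\<Sum>i<n. sc (f j i) (b i))"
    "\<And>j i. j < n \<Longrightarrow> lev (i div tw.N) > lev (j div tw.N) \<Longrightarrow> f j i = 0"
    "\<And>j i. j < n \<Longrightarrow> Suc (j mod tw.N) < tw.N \<Longrightarrow> f j i = (if i = Suc j then 1 else 0)" by blast
  have X': "M' * X * M = mat n n (\<lambda>(i, j). f j i)"
    using f(1) by (intro conj X) auto
  have g': "\<exists>f. M' * g * M = mat n n (\<lambda>(i, j). f j i) \<and>
      (\<forall>i j. j < n \<longrightarrow> lev (i div tw.N) > lev (j div tw.N) \<longrightarrow> f j i = 0) \<and>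
      (\<forall>i j. j < n \<longrightarrow> lev (i div tw.N) = lev (j div tw.N) \<longrightarrow>
         f j i = (if i div tw.N = j div tw.N then coeff ([:c g, 1:] ^ (j mod tw.N)) (i mod tw.N) else 0))"
    if g: "g \<in> carrier G" for g
  proof -
    let ?P = "\<lambda>j f. mat_op n g (b j) = (\<Sum>i<n. sc (f i) (b i)) \<and>
      (\<forall>i. lev (i div tw.N) > lev (j div tw.N) \<longrightarrow> f i = 0) \<and>
      (\<forall>i. lev (i div tw.N) = lev (j div tw.N) \<longrightarrow>
         f i = (if i div tw.N = j div tw.N then coeff ([:c g, 1:] ^ (j mod tw.N)) (i mod tw.N) else 0))"
    have "\<forall>j. \<exists>f. j < n \<longrightarrow> ?P j f" using b(7)[OF _ g] unfolding n[symmetric] by blast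
    from choice[OF this] obtain f where f: "\<And>j. j < n \<Longrightarrow> ?P j (f j)" by blast
    have "M' * g * M = mat n n (\<lambda>(i, j). f j i)"
      using f carr g by (intro conj) auto
    then show ?thesis using f by blast
  qed
  show thesis
  proof (rule that[OF M M' MM' M'M n _ tw.N_pos b(4)])
    show "tw.N = card (c ` carrier G)" by (simp add: tw.N_def tw.C_def)
    fix g i j assume g: "g \<in> carrier G" and ij: "i < n" "j < n"
    from g'[OF g] ij show "lev (i div tw.N) > lev (j div tw.N) \<Longrightarrow> (M' * g * M) $$ (i, j) = 0"
      "lev (i div tw.N) = lev (j div tw.N) \<Longrightarrow> (M' * g * M) $$ (i, j) =
        (if i div tw.N = j div tw.N then coeff ([:c g, 1:] ^ (j mod tw.N)) (i mod tw.N) else 0)" by auto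
  qed (use f X' in auto)
qed

section \<open>Matrices over a square-zero extension of a finite field\<close>

definition mtr :: "nat \<Rightarrow> 'a::comm_monoid_add mat \<Rightarrow> 'a" where
  "mtr n A = (\<Sum>i<n. A $$ (i, i))"

lemma mtr_add:
  "A \<in> carrier_mat n n \<Longrightarrow> B \<in> carrier_mat n n \<Longrightarrow> mtr n (A + B) = mtr n A + mtr n B"
  by (auto simp: mtr_def sum.distrib)

lemma mtr_mult:
  assumes "A \<in> carrier_mat n n" "B \<in> carrier_mat n n"
  shows "mtr n (A * B) = (\<Sum>i<n. \<Sum>j<n. A $$ (i, j) * B $$ (j, i))"
  using assms by (simp add: mtr_def index_mat_mult del: index_mult_mat)

lemma mtr_comm:
  fixes A B :: "'a::comm_semiring_0 mat"
  assumes "A \<in> carrier_mat n n" "B \<in> carrier_mat n n"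
  shows "mtr n (A * B) = mtr n (B * A)"
  unfolding mtr_mult[OF assms] mtr_mult[OF assms(2,1)]
  by (subst sum.swap) (simp add: mult.commute)

text \<open>In the Leibniz expansion a permutation other than the identity moves two points
  \<open>i\<close> and \<open>p i\<close>, hence picks two off-diagonal entries of \<open>B\<close>,
  whose product vanishes. In the diagonal product only terms of first order survive.\<close>

lemma det_one_add_square_zero:
  fixes B :: "'a::comm_ring_1 mat"
  assumes B: "B \<in> carrier_mat n n"
    and zero: "\<And>i j k l. i < n \<Longrightarrow> j < n \<Longrightarrow> k < n \<Longrightarrow> l < n \<Longrightarrow> B $$ (i, j) * B $$ (k, l) = 0"
  shows "det (1\<^sub>m n + B) = 1 + mtr n B"
proof -
  let ?A = "1\<^sub>m n + B"
  have A: "?A \<in> carrier_mat n n" using B by simp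
  have nz: "(\<Prod>i=0..<n. ?A $$ (i, p i)) = 0" if p: "p permutes {0..<n}" "p \<noteq> id" for p
  proof -
    obtain i where i: "p i \<noteq> i" using p(2) by (auto simp: fun_eq_iff)
    then have "i \<in> {0..<n}" using p(1) by (metis permutes_not_in)
    let ?j = "p i"
    have j: "?j \<in> {0..<n}" using p(1) \<open>i \<in> {0..<n}\<close> by (simp add: permutes_in_image)
    have pj: "p ?j \<noteq> ?j" using i p(1) by (metis permutes_inj injD)
    have pj': "p ?j \<in> {0..<n}" using p(1) j by (metis permutes_in_image)
    have "(\<Prod>l=0..<n. ?A $$ (l, p l)) = ?A $$ (i, p i) * (?A $$ (?j, p ?j) * (\<Prod>l\<in>{0..<n} - {i} - {?j}. ?A $$ (l, p l)))"
      using i j \<open>i \<in> {0..<n}\<close> by (subst prod.remove[of _ i], simp, simp, subst prod.remove[of _ ?j]) auto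
    also have "\<dots> = (B $$ (i, p i) * B $$ (?j, p ?j)) * (\<Prod>l\<in>{0..<n} - {i} - {?j}. ?A $$ (l, p l))"
      using i j pj pj' \<open>i \<in> {0..<n}\<close> B by (simp add: mult.assoc)
    also have "\<dots> = 0" using zero j pj' \<open>i \<in> {0..<n}\<close> by simp
    finally show ?thesis .
  qed
  have prod_eq: "m \<le> n \<Longrightarrow> (\<Prod>i=0..<m. 1 + B $$ (i, i)) = 1 + (\<Sum>i<m. B $$ (i, i))" for m
  proof (induction m)
    case (Suc m)
    then have "(\<Sum>i<m. B $$ (i, i)) * B $$ (m, m) = 0"
      by (auto simp: sum_distrib_right intro!: sum.neutral zero)
    then show ?case using Suc by (simp add: algebra_simps)
  qed simp
  have "det ?A = (\<Sum>p | p permutes {0..<n}. signof p * (\<Prod>i=0..<n. ?A $$ (i, p i)))"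
    using A by (rule det_def')
  also have "\<dots> = (\<Sum>p\<in>{id}. signof p * (\<Prod>i=0..<n. ?A $$ (i, p i)))"
    using nz by (intro sum.mono_neutral_right) (auto simp: permutes_id finite_permutations)
  also have "\<dots> = 1 + mtr n B"
    using prod_eq[of n] B by (simp add: mtr_def signof_id)
  finally show ?thesis .
qed

text \<open>
  The models are $\mathbb{F}_q[t]/t^2$ with $v(b) = bt$ and $W_2(\mathbb{F}_q)$ with $v(b) = (0, b^p)$.
\<close>
locale length_two = red: comm_ring_hom red
  for red :: "'r::comm_ring_1 \<Rightarrow> 'q::finite_field" +
  fixes v :: "'q \<Rightarrow> 'r"
  assumes red_surj: "\<exists>x. red x = a"
    and v_add: "v (a + b) = v a + v b"
    and v_eq_0: "v a = 0 \<Longrightarrow> a = 0"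
    and red_eq_0: "red x = 0 \<longleftrightarrow> x \<in> range v"
    and mult_v: "x * v b = v (red x * b)"
begin

lemma v_0 [simp]: "v 0 = 0" using v_add[of 0 0] by simp
lemma v_minus: "v (- a) = - v a" using v_add[of a "- a"] by (simp add: eq_neg_iff_add_eq_0 add.commute)
lemma v_inj: "v a = v b \<Longrightarrow> a = b" using v_add[of a "- b"] v_eq_0[of "a - b"] by (simp add: v_minus)
lemma v_sum: "v (sum f I) = (\<Sum>i\<in>I. v (f i))"
  by (induction I rule: infinite_finite_induct) (auto simp: v_add)
lemma red_v [simp]: "red (v a) = 0" by (simp add: red_eq_0)
lemma v_mult: "v b * x = v (b * red x)" using mult_v[of x b] by (simp add: mult.commute)
lemma v_mult_v [simp]: "v a * v b = 0" by (simp add: mult_v)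

lemma finite_UNIV_r: "finite (UNIV :: 'r set)"
proof -
  obtain l where l: "\<And>a. red (l a) = a" using red_surj by metis
  have "UNIV \<subseteq> (\<lambda>(a, b). l a + v b) ` (UNIV \<times> UNIV)"
  proof
    fix x :: 'r
    have "red (x - l (red x)) = 0" using l by (simp add: red.hom_minus)
    then obtain b where "x - l (red x) = v b" by (auto simp: red_eq_0)
    then have "x = l (red x) + v b" by (simp add: algebra_simps)
    then show "x \<in> (\<lambda>(a, b). l a + v b) ` (UNIV \<times> UNIV)"
      by (intro image_eqI[of _ _ "(red x, b)"]) auto
  qed
  then show ?thesis by (rule finite_subset) simp
qed

section \<open>Matrices that reduce to the identity\<close>

abbreviation redm where "redm \<equiv> map_mat red"
abbreviation vm where "vm \<equiv> map_mat v"

text \<open>An isomorphism from the additive group of matrices over the residue field onto the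
  matrices that reduce to the identity; trace zero will correspond to determinant 1.\<close>

definition kmat :: "nat \<Rightarrow> 'q mat \<Rightarrow> 'r mat" where
  "kmat n z = 1\<^sub>m n + vm z"

lemma kmat_carrier [simp]: "z \<in> carrier_mat n n \<Longrightarrow> kmat n z \<in> carrier_mat n n"
  by (simp add: kmat_def)

text \<open>By \<open>mult_v\<close>, a ring element acts on the ideal through its
  reduction.\<close>

lemma mult_vm:
  assumes "A \<in> carrier_mat n n" "z \<in> carrier_mat n n"
  shows "A * vm z = vm (redm A * z)" "vm z * A = vm (z * redm A)"
proof -
  have c: "redm A \<in> carrier_mat n n" "vm z \<in> carrier_mat n n" using assms by auto
  show "A * vm z = vm (redm A * z)"
  proof (rule eq_matI)
    fix i j assume "i < dim_row (vm (redm A * z))" "j < dim_col (vm (redm A * z))"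
    then have ij: "i < n" "j < n" using assms by auto
    have "(A * vm z) $$ (i, j) = (\<Sum>l<n. v (red (A $$ (i, l)) * z $$ (l, j)))"
      unfolding index_mat_mult[OF assms(1) c(2) ij] using assms ij by (simp add: mult_v)
    also have "\<dots> = v ((redm A * z) $$ (i, j))"
      unfolding index_mat_mult[OF c(1) assms(2) ij] using assms ij by (simp add: v_sum)
    finally show "(A * vm z) $$ (i, j) = vm (redm A * z) $$ (i, j)" using assms ij by simp
  qed (use assms in auto)
  show "vm z * A = vm (z * redm A)"
  proof (rule eq_matI)
    fix i j assume "i < dim_row (vm (z * redm A))" "j < dim_col (vm (z * redm A))"
    then have ij: "i < n" "j < n" using assms by auto
    have "(vm z * A) $$ (i, j) = (\<Sum>l<n. v (z $$ (i, l) * red (A $$ (l, j))))"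
      unfolding index_mat_mult[OF c(2) assms(1) ij] using assms ij by (simp add: v_mult)
    also have "\<dots> = v ((z * redm A) $$ (i, j))"
      unfolding index_mat_mult[OF assms(2) c(1) ij] using assms ij by (simp add: v_sum)
    finally show "(vm z * A) $$ (i, j) = vm (z * redm A) $$ (i, j)" using assms ij by simp
  qed (use assms in auto)
qed

lemma redm_kmat: "z \<in> carrier_mat n n \<Longrightarrow> redm (kmat n z) = 1\<^sub>m n"
  by (intro eq_matI) (auto simp: kmat_def red.hom_add)

lemma vm_add: "z \<in> carrier_mat n n \<Longrightarrow> w \<in> carrier_mat n n \<Longrightarrow> vm (z + w) = vm z + vm w"
  by (intro eq_matI) (auto simp: v_add)

lemma kmat_inj: "z \<in> carrier_mat n n \<Longrightarrow> w \<in> carrier_mat n n \<Longrightarrow> kmat n z = kmat n w \<Longrightarrow> z = w"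
proof (rule eq_matI)
  fix i j assume c: "z \<in> carrier_mat n n" "w \<in> carrier_mat n n" and e: "kmat n z = kmat n w"
    and "i < dim_row w" "j < dim_col w"
  then have ij: "i < n" "j < n" by auto
  have "kmat n z $$ (i, j) = kmat n w $$ (i, j)" using e by simp
  then show "z $$ (i, j) = w $$ (i, j)" using c ij v_inj by (simp add: kmat_def)
qed auto

lemma mult_kmat:
  assumes "A \<in> carrier_mat n n" "z \<in> carrier_mat n n"
  shows "A * kmat n z = A + vm (redm A * z)" "kmat n z * A = A + vm (z * redm A)"
  using assms mult_vm[OF assms] mult_add_distrib_mat[OF assms(1) one_carrier_mat, of "vm z"]
    add_mult_distrib_mat[OF one_carrier_mat _ assms(1), of "vm z"]
  by (simp_all add: kmat_def)

lemma kmat_mult: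
  assumes "z \<in> carrier_mat n n" "w \<in> carrier_mat n n"
  shows "kmat n z * kmat n w = kmat n (z + w)"
proof -
  have "kmat n z * kmat n w = kmat n z + vm w"
    using assms mult_kmat(1)[of "kmat n z" n w] by (simp add: redm_kmat)
  also have "\<dots> = kmat n (z + w)"
    using assms by (simp add: kmat_def vm_add[OF assms] assoc_add_mat[of _ n n])
  finally show ?thesis .
qed

lemma kmat_0: "kmat n (0\<^sub>m n n) = 1\<^sub>m n"
  by (intro eq_matI) (auto simp: kmat_def)

text \<open>On the kernel, conjugation by \<open>A\<close> is conjugation by its reduction,
  expressed over the residue field alone; this is why both groups give the same module.\<close>

lemma kmat_conj:
  assumes "A \<in> carrier_mat n n" "z \<in> carrier_mat n n" "s' \<in> carrier_mat n n" "s' * redm A = 1\<^sub>m n"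
  shows "A * kmat n z = kmat n (redm A * z * s') * A"
proof -
  have "redm A * z * s' * redm A = redm A * z * (s' * redm A)"
    using assms by (intro assoc_mult_mat) auto
  also have "\<dots> = redm A * z" using assms by simp
  finally show ?thesis using assms by (simp add: mult_kmat[of _ n])
qed

lemma redm_eq_imp:
  assumes "A \<in> carrier_mat n n" "B \<in> carrier_mat n n" "redm A = redm B"
  obtains z where "z \<in> carrier_mat n n" "A = B + vm z"
proof -
  have "\<exists>b. A $$ (i, j) = B $$ (i, j) + v b" if "i < n" "j < n" for i j
  proof -
    have "redm A $$ (i, j) = redm B $$ (i, j)" using assms by simp
    then have "red (A $$ (i, j) - B $$ (i, j)) = 0" using assms(1,2) that by (simp add: red.hom_minus)
    then obtain b where "A $$ (i, j) - B $$ (i, j) = v b" by (auto simp: red_eq_0)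
    then show ?thesis by (intro exI[of _ b]) (simp add: algebra_simps)
  qed
  then have "\<forall>ij. \<exists>b. fst ij < n \<longrightarrow> snd ij < n \<longrightarrow> A $$ ij = B $$ ij + v b" by auto
  from choice[OF this] obtain f where f: "\<And>i j. i < n \<Longrightarrow> j < n \<Longrightarrow> A $$ (i, j) = B $$ (i, j) + v (f (i, j))" by auto
  show thesis
    by (rule that[of "mat n n f"]) (use assms f in \<open>auto intro!: eq_matI\<close>)
qed

lemma redm_eq_1:
  assumes "A \<in> carrier_mat n n" "redm A = 1\<^sub>m n"
  obtains z where "z \<in> carrier_mat n n" "A = kmat n z"
proof (rule redm_eq_imp[OF assms(1) one_carrier_mat])
  show "redm A = redm (1\<^sub>m n)" using assms(2) by (simp add: red.mat_hom_one)
qed (use that in \<open>auto simp: kmat_def\<close>)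

lemma det_kmat: "z \<in> carrier_mat n n \<Longrightarrow> det (kmat n z) = 1 + v (mtr n z)"
  unfolding kmat_def by (subst det_one_add_square_zero) (auto simp: mtr_def v_sum)

lemma lift_mat:
  assumes "s \<in> carrier_mat n n"
  obtains A where "A \<in> carrier_mat n n" "redm A = s"
proof -
  obtain l where l: "\<And>a. red (l a) = a" using red_surj by metis
  show thesis
    by (rule that[of "map_mat l s"]) (use assms l in \<open>auto intro!: eq_matI\<close>)
qed

text \<open>Arbitrary lifts of \<open>s\<close> and \<open>s'\<close> have products
  \<open>kmat n z\<close> and \<open>kmat n w\<close>, whose inverses are
  \<open>kmat n (- z)\<close> and \<open>kmat n (- w)\<close>. The resulting right and left inverses
  of \<open>A\<close> coincide.\<close>

lemma lift_inverse:
  assumes "s \<in> carrier_mat n n" "s' \<in> carrier_mat n n" "s * s' = 1\<^sub>m n" "s' * s = 1\<^sub>m n"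
  obtains A A' where "A \<in> carrier_mat n n" "A' \<in> carrier_mat n n" "redm A = s" "redm A' = s'"
    "A * A' = 1\<^sub>m n" "A' * A = 1\<^sub>m n"
proof -
  obtain A where A: "A \<in> carrier_mat n n" "redm A = s" using lift_mat assms by blast
  obtain B where B: "B \<in> carrier_mat n n" "redm B = s'" using lift_mat assms by blast
  have "redm (A * B) = 1\<^sub>m n" using red.mat_hom_mult[OF A(1) B(1)] A B assms by simp
  then obtain z where z: "z \<in> carrier_mat n n" "A * B = kmat n z" using A B redm_eq_1 by (metis mult_carrier_mat)
  have "redm (B * A) = 1\<^sub>m n" using red.mat_hom_mult[OF B(1) A(1)] A B assms by simp
  then obtain w where w: "w \<in> carrier_mat n n" "B * A = kmat n w" using A B redm_eq_1 by (metis mult_carrier_mat)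
  have k: "kmat n u * kmat n (- u) = 1\<^sub>m n" "kmat n (- u) * kmat n u = 1\<^sub>m n" if "u \<in> carrier_mat n n" for u
  proof -
    have "u + - u = 0\<^sub>m n n" "- u + u = 0\<^sub>m n n" "- u \<in> carrier_mat n n"
      using that by (auto intro!: eq_matI)
    then show "kmat n u * kmat n (- u) = 1\<^sub>m n" "kmat n (- u) * kmat n u = 1\<^sub>m n"
      using that by (simp_all add: kmat_mult kmat_0)
  qed
  define R L where "R = B * kmat n (- z)" and "L = kmat n (- w) * B"
  have R: "R \<in> carrier_mat n n" and L: "L \<in> carrier_mat n n" using B z w by (auto simp: R_def L_def intro!: mult_carrier_mat[of _ n n])
  have AR: "A * R = 1\<^sub>m n"
    using assoc_mult_mat[OF A(1) B(1), of "kmat n (- z)" n] z k[OF z(1)] by (simp add: R_def)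
  have LA: "L * A = 1\<^sub>m n"
    using assoc_mult_mat[of "kmat n (- w)" n n B n A n] A B w k[OF w(1)] by (simp add: L_def)
  have "L = L * (A * R)" using AR L by simp
  also have "\<dots> = R" using assoc_mult_mat[OF L A(1) R] LA R by simp
  finally have RA: "R * A = 1\<^sub>m n" using LA by simp
  have "redm R = s'" using red.mat_hom_mult[OF B(1), of "kmat n (- z)" n] B z assms by (simp add: R_def redm_kmat)
  then show thesis using that[OF A(1) R A(2) _ AR RA] by simp
qed

end

section \<open>Extending a character over a $p$-subgroup of its stabiliser\<close>

text \<open>
  \<open>H\<close> is a subgroup of \<open>Pt\<close>, decorated with parameters \<open>e\<close>, that covers \<open>Pt\<close> modulo \<open>K\<close>; the
  extension is \<open>\<chi> (k \<otimes> h) = \<psi> k * \<eta> e\<close>.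
\<close>
lemma extend_character:
  fixes G (structure) and S (structure) and \<psi> :: "'g \<Rightarrow> complex" and \<eta> :: "'e::ab_group_add \<Rightarrow> complex"
    and H :: "('g \<times> 'e) set"
  assumes G: "group G" and S: "group S" and \<pi>: "\<pi> \<in> hom G S"
    and Pt: "subgroup Pt G"
    and K: "K = {k \<in> carrier G. \<pi> k = \<one>\<^bsub>S\<^esub>}" and KPt: "K \<subseteq> Pt"
    and \<psi>: "\<And>k k'. k \<in> K \<Longrightarrow> k' \<in> K \<Longrightarrow> \<psi> (k \<otimes> k') = \<psi> k * \<psi> k'"
    and H: "\<And>h e. (h, e) \<in> H \<Longrightarrow> h \<in> Pt \<and> \<eta> e \<noteq> 0"
    and Hm: "\<And>h e h' e'. (h, e) \<in> H \<Longrightarrow> (h', e') \<in> H \<Longrightarrow> (h \<otimes> h', e + e') \<in> H \<and> \<eta> (e + e') = \<eta> e * \<eta> e'"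
    and HK: "\<And>h e. (h, e) \<in> H \<Longrightarrow> h \<in> K \<Longrightarrow> \<psi> h = \<eta> e"
    and conj: "\<And>h e k. (h, e) \<in> H \<Longrightarrow> k \<in> K \<Longrightarrow> \<psi> (h \<otimes> k \<otimes> inv h) = \<psi> k"
    and cov: "\<And>y. y \<in> Pt \<Longrightarrow> \<exists>h e. (h, e) \<in> H \<and> \<pi> h = \<pi> y"
  shows "\<exists>\<chi>. (\<forall>y\<in>Pt. \<forall>y'\<in>Pt. \<chi> (y \<otimes> y') = \<chi> y * \<chi> y') \<and> (\<forall>k\<in>K. \<chi> k = \<psi> k)"
proof -
  interpret G: group G by fact
  interpret S: group S by fact
  interpret \<pi>: group_hom G S \<pi> by (intro group_hom.intro group_hom_axioms.intro G S \<pi>)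
  have PtG: "Pt \<subseteq> carrier G" using subgroup.subset[OF Pt] .
  have Kc: "y \<otimes> inv h \<in> K" if "y \<in> Pt" "h \<in> Pt" "\<pi> h = \<pi> y" for y h
    using that PtG by (auto simp: K subset_iff)
  \<comment> \<open>\<open>H\<close> is closed under products but not assumed closed under inverses,
    so \<open>h1\<close> and \<open>h2\<close> are compared through a third element
    \<open>h3\<close> over the inverse of \<open>y\<close>: their products with \<open>h3\<close>
    lie in \<open>K\<close>, where \<open>\<psi>\<close> and \<open>\<eta>\<close> agree.\<close>
  have key: "\<psi> (y \<otimes> inv h1) * \<eta> e1 = \<psi> (y \<otimes> inv h2) * \<eta> e2"
    if y: "y \<in> Pt" and h: "(h1, e1) \<in> H" "(h2, e2) \<in> H" "\<pi> h1 = \<pi> y" "\<pi> h2 = \<pi> y" for y h1 e1 h2 e2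
  proof -
    obtain h3 e3 where h3: "(h3, e3) \<in> H" "\<pi> h3 = \<pi> (inv y)"
      using cov[of "inv y"] y subgroup.m_inv_closed[OF Pt] by blast
    have c: "y \<in> carrier G" "h1 \<in> carrier G" "h2 \<in> carrier G" "h3 \<in> carrier G"
      using y h h3 H PtG by blast+
    have "h1 \<otimes> h3 \<in> K" "h2 \<otimes> h3 \<in> K" using h(3,4) h3(2) c by (auto simp: K)
    then have s: "\<psi> (h1 \<otimes> h3) = \<eta> e1 * \<eta> e3" "\<psi> (h2 \<otimes> h3) = \<eta> e2 * \<eta> e3"
      using HK Hm h h3 by metis+
    have "(y \<otimes> inv h1) \<otimes> (h1 \<otimes> h3) = (y \<otimes> inv h2) \<otimes> (h2 \<otimes> h3)"
      using c by (metis G.inv_closed G.inv_solve_right G.m_assoc G.m_closed)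
    moreover have "y \<otimes> inv h1 \<in> K" "y \<otimes> inv h2 \<in> K" using Kc y h H by auto
    ultimately have "\<psi> (y \<otimes> inv h1) * \<psi> (h1 \<otimes> h3) = \<psi> (y \<otimes> inv h2) * \<psi> (h2 \<otimes> h3)"
      using \<psi> \<open>h1 \<otimes> h3 \<in> K\<close> \<open>h2 \<otimes> h3 \<in> K\<close> by metis
    then show ?thesis using s H[OF h3(1)] by simp
  qed
  have "\<forall>y. \<exists>he. y \<in> Pt \<longrightarrow> he \<in> H \<and> \<pi> (fst he) = \<pi> y" using cov by force
  from choice[OF this] obtain t where t: "\<And>y. y \<in> Pt \<Longrightarrow> t y \<in> H \<and> \<pi> (fst (t y)) = \<pi> y" by blast
  define \<chi> where "\<chi> y = \<psi> (y \<otimes> inv (fst (t y))) * \<eta> (snd (t y))" for y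
  have \<chi>: "\<chi> y = \<psi> (y \<otimes> inv h) * \<eta> e" if "y \<in> Pt" "(h, e) \<in> H" "\<pi> h = \<pi> y" for y h e
    unfolding \<chi>_def by (rule key) (use t that in auto)
  have "\<chi> (y \<otimes> y') = \<chi> y * \<chi> y'" if y: "y \<in> Pt" "y' \<in> Pt" for y y'
  proof -
    obtain h e where h: "(h, e) \<in> H" "\<pi> h = \<pi> y" using cov y by blast
    obtain h' e' where h': "(h', e') \<in> H" "\<pi> h' = \<pi> y'" using cov y by blast
    have c: "y \<in> carrier G" "y' \<in> carrier G" "h \<in> carrier G" "h' \<in> carrier G"
      using y h h' H PtG by blast+
    have K1: "y \<otimes> inv h \<in> K" and K2: "y' \<otimes> inv h' \<in> K" using Kc y h h' H by auto
    have K3: "h \<otimes> (y' \<otimes> inv h') \<otimes> inv h \<in> K" using K2 c by (auto simp: K)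
    have "\<chi> (y \<otimes> y') = \<psi> (y \<otimes> y' \<otimes> inv (h \<otimes> h')) * \<eta> (e + e')"
      using subgroup.m_closed[OF Pt] y h h' c Hm by (intro \<chi>) auto
    \<comment> \<open>The kernel part of \<open>y'\<close> gets conjugated by \<open>h\<close>,
      which does not change the value of \<open>\<psi>\<close>.\<close>
    also have "y \<otimes> y' \<otimes> inv (h \<otimes> h') = (y \<otimes> inv h) \<otimes> (h \<otimes> (y' \<otimes> inv h') \<otimes> inv h)"
      using c by (simp add: G.inv_mult_group G.m_assoc) (metis G.inv_closed G.l_inv G.m_assoc G.m_closed G.l_one)
    also have "\<psi> \<dots> = \<psi> (y \<otimes> inv h) * \<psi> (y' \<otimes> inv h')"
      using \<psi>[OF K1 K3] conj[OF h(1) K2] by simp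
    also have "\<eta> (e + e') = \<eta> e * \<eta> e'" using Hm h h' by blast
    finally show ?thesis using \<chi>[OF y(1) h] \<chi>[OF y(2) h'] by simp
  qed
  moreover have "\<chi> k = \<psi> k" if k: "k \<in> K" for k
  proof -
    obtain h e where h: "(h, e) \<in> H" "\<pi> h = \<pi> k" using cov k KPt by blast
    have c: "k \<in> carrier G" "h \<in> carrier G" using k KPt h H PtG by blast+
    then have hK: "h \<in> K" using h k by (simp add: K)
    have kh: "k \<otimes> inv h \<in> K" using Kc[of k h] k KPt h H by auto
    have "\<chi> k = \<psi> (k \<otimes> inv h) * \<psi> h" using \<chi>[of k h e] k KPt h HK[OF h(1) hK] by auto
    also have "\<dots> = \<psi> (k \<otimes> inv h \<otimes> h)" using \<psi>[OF kh hK] by simp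
    also have "k \<otimes> inv h \<otimes> h = k" using c by (simp add: G.m_assoc)
    finally show ?thesis .
  qed
  ultimately show ?thesis by blast
qed

text \<open>
  Block upper triangular with respect to the levels; the blocks within a level are diagonal and
  describe the substitution \<open>t \<mapsto> t + e\<close> on polynomials in the basis \<open>1, t, \<dots>, t\<^bsup>N-1\<^esup>\<close>.
\<close>
definition shift_mats :: "nat \<Rightarrow> nat \<Rightarrow> (nat \<Rightarrow> nat) \<Rightarrow> 'a::comm_ring_1 \<Rightarrow> 'a mat set" where
  "shift_mats n N lev e = {h \<in> carrier_mat n n. \<forall>i<n. \<forall>j<n.
     (lev (i div N) > lev (j div N) \<longrightarrow> h $$ (i, j) = 0) \<and>
     (lev (i div N) = lev (j div N) \<longrightarrow>
       h $$ (i, j) = (if i div N = j div N then coeff ([:e, 1:] ^ (j mod N)) (i mod N) else 0))}"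

text \<open>The substitutions by \<open>e'\<close> and \<open>e\<close> compose to the substitution
  by \<open>e + e'\<close>; as they preserve the polynomials of degree below \<open>N\<close>, the
  truncated sum loses nothing.\<close>

lemma coeff_shift_compose:
  fixes e e' :: "'a::comm_ring_1"
  assumes "j < N"
  shows "(\<Sum>t<N. coeff ([:e, 1:] ^ t) i * coeff ([:e', 1:] ^ j) t) = coeff ([:e + e', 1:] ^ j) i"
proof -
  let ?p = "[:e', 1:] ^ j"
  have deg: "degree ?p \<le> N - 1" using degree_power_le[of "[:e', 1:]" j] assms by simp
  have "[:e + e', 1:] ^ j = ?p \<circ>\<^sub>p [:e, 1:]"
    by (simp add: pcompose_hom.hom_power pcompose_pCons add.commute)
  also have "\<dots> = (\<Sum>t\<le>degree ?p. Polynomial.smult (coeff ?p t) ([:e, 1:] ^ t))"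
  proof -
    have m: "monom a t \<circ>\<^sub>p [:e, 1:] = Polynomial.smult a ([:e, 1:] ^ t)" for a t
      by (simp add: monom_altdef pcompose_smult pcompose_hom.hom_power pcompose_pCons)
    have "?p \<circ>\<^sub>p [:e, 1:] = (\<Sum>t\<le>degree ?p. monom (coeff ?p t) t) \<circ>\<^sub>p [:e, 1:]"
      by (simp only: poly_as_sum_of_monoms)
    then show ?thesis by (simp only: pcompose_sum m)
  qed
  also have "\<dots> = (\<Sum>t<N. Polynomial.smult (coeff ?p t) ([:e, 1:] ^ t))"
    using deg assms by (intro sum.mono_neutral_left) (auto simp: coeff_eq_0)
  finally show ?thesis by (simp add: coeff_sum mult.commute)
qed

text \<open>A product of entries at \<open>(i, l)\<close> and \<open>(l, j)\<close> survives only if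
  the levels do not decrease from \<open>i\<close> over \<open>l\<close> to \<open>j\<close>. If the
  outer levels agree, everything happens within one level, where the blocks are diagonal and compose
  as substitutions.\<close>

lemma shift_mats_mult:
  assumes n: "n = m * N" and N: "N > 0"
    and h: "h \<in> shift_mats n N lev e" and h': "h' \<in> shift_mats n N lev e'"
  shows "h * h' \<in> shift_mats n N lev (e + e')"
proof -
  have c: "h \<in> carrier_mat n n" "h' \<in> carrier_mat n n" using h h' by (auto simp: shift_mats_def)
  have z: "h $$ (i, j) = 0" "h' $$ (i, j) = 0" if "i < n" "j < n" "lev (i div N) > lev (j div N)" for i j
    using h h' that by (auto simp: shift_mats_def)
  have s: "h $$ (i, j) = (if i div N = j div N then coeff ([:e, 1:] ^ (j mod N)) (i mod N) else 0)"
    "h' $$ (i, j) = (if i div N = j div N then coeff ([:e', 1:] ^ (j mod N)) (i mod N) else 0)"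
    if "i < n" "j < n" "lev (i div N) = lev (j div N)" for i j
    using h h' that by (auto simp: shift_mats_def)
  show ?thesis
    unfolding shift_mats_def
  proof (intro CollectI conjI allI impI)
    show "h * h' \<in> carrier_mat n n" using c by simp
    fix i j assume ij: "i < n" "j < n"
    { assume "lev (i div N) > lev (j div N)"
      then have "h $$ (i, l) * h' $$ (l, j) = 0" if "l < n" for l
        using z[of i l] z[of l j] ij that by (cases "lev (l div N) > lev (j div N)") auto
      then show "(h * h') $$ (i, j) = 0" using ij by (simp add: index_mat_mult[OF c] del: index_mult_mat) }
    assume lev: "lev (i div N) = lev (j div N)"
    have "h $$ (i, l) * h' $$ (l, j) = (if i div N = j div N \<and> l div N = j div N
        then coeff ([:e, 1:] ^ (l mod N)) (i mod N) * coeff ([:e', 1:] ^ (j mod N)) (l mod N) else 0)" if l: "l < n" for l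
    proof (cases "lev (l div N)" "lev (j div N)" rule: linorder_cases)
      case less
      then show ?thesis using z(1)[of i l] lev ij l by auto
    next
      case equal
      then show ?thesis using s(1)[of i l] s(2)[of l j] lev ij l by auto
    next
      case greater
      then show ?thesis using z(2)[of l j] ij l by auto
    qed
    then have "(h * h') $$ (i, j) = (\<Sum>l<m*N. if i div N = j div N \<and> l div N = j div N
        then coeff ([:e, 1:] ^ (l mod N)) (i mod N) * coeff ([:e', 1:] ^ (j mod N)) (l mod N) else 0)"
      using ij n by (simp add: index_mat_mult[OF c] del: index_mult_mat)
    also have "\<dots> = (\<Sum>s<m. \<Sum>t<N. if i div N = j div N \<and> s = j div N
        then coeff ([:e, 1:] ^ t) (i mod N) * coeff ([:e', 1:] ^ (j mod N)) t else 0)"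
      by (rule sum_div_mod[OF N])
    also have "\<dots> = (\<Sum>s\<in>{j div N}. \<Sum>t<N. if i div N = j div N \<and> s = j div N
        then coeff ([:e, 1:] ^ t) (i mod N) * coeff ([:e', 1:] ^ (j mod N)) t else 0)"
      using ij n N by (intro sum.mono_neutral_right) (auto simp: less_mult_imp_div_less)
    also have "\<dots> = (if i div N = j div N then coeff ([:e + e', 1:] ^ (j mod N)) (i mod N) else 0)"
      using N by (simp add: coeff_shift_compose)
    finally show "(h * h') $$ (i, j) = (if i div N = j div N then coeff ([:e + e', 1:] ^ (j mod N)) (i mod N) else 0)" .
  qed
qed

lemma div_mod_Suc: "0 < Suc j mod N \<Longrightarrow> Suc j div N = j div N \<and> Suc (j mod N) = Suc j mod N"
  by (auto simp: div_Suc mod_Suc split: if_splits)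

lemma coeff_linear_power_gt: "i > j \<Longrightarrow> coeff ([:e, 1:] ^ j) i = (0::'a::comm_ring_1)"
  using degree_power_le[of "[:e, 1:]" j] by (intro coeff_eq_0) simp

text \<open>The levels do not decrease along the blocks and a substitution is triangular in the
  degree, so the matrix is upper triangular; its diagonal entries are leading coefficients of monic
  polynomials.\<close>

lemma det_shift_mats:
  assumes n: "n = m * N" and N: "N > 0" and mono: "\<And>s t. s \<le> t \<Longrightarrow> t < m \<Longrightarrow> lev s \<le> lev t"
    and h: "h \<in> shift_mats n N lev e"
  shows "det h = 1"
proof -
  have c: "h \<in> carrier_mat n n" using h by (simp add: shift_mats_def)
  have "upper_triangular h"
  proof (rule upper_triangularI)
    fix i j assume ji: "j < i" "i < dim_row h"
    then have ij: "i < n" "j < n" using c by auto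
    have dl: "j div N \<le> i div N" using ji by (simp add: div_le_mono)
    have "lev (j div N) \<le> lev (i div N)" using dl ij n by (intro mono) (auto simp: less_mult_imp_div_less)
    then consider "lev (i div N) > lev (j div N)" | "lev (i div N) = lev (j div N)" by linarith
    then show "h $$ (i, j) = 0"
    proof cases
      case 2
      have "j mod N < i mod N" if "i div N = j div N"
        using ji(1) that by (metis div_mult_mod_eq nat_add_left_cancel_less)
      then show ?thesis using 2 h ij by (auto simp: shift_mats_def coeff_linear_power_gt)
    qed (use h ij in \<open>auto simp: shift_mats_def\<close>)
  qed
  moreover have "diag_mat h = map (\<lambda>_. 1) [0..<n]"
    unfolding diag_mat_def using c h
    by (auto simp: shift_mats_def coeff_linear_poly_power)
  ultimately show ?thesis using det_upper_triangular[OF _ c] by (simp add: map_replicate_const)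
qed

section \<open>Substitution matrices over the extension ring\<close>

context length_two
begin

lemma red_of_nat: "red (of_nat k) = of_nat k"
  by (induction k) (auto simp: red.hom_add)

lemma red_coeff_shift: "red (coeff ([:e, 1:] ^ j) i) = coeff ([:red e, 1:] ^ j) i"
proof (cases "i \<le> j")
  case True
  then show ?thesis by (simp add: coeff_linear_poly_power red.hom_mult red.hom_power red_of_nat)
qed (simp add: coeff_linear_power_gt)

text \<open>The blocks within a level are dictated by \<open>e\<close> and reduce correctly, since
  their entries are integer polynomials in \<open>e\<close>; the entries with strictly increasing
  level can be lifted arbitrarily.\<close>

lemma lift_shift_mat:
  assumes g: "g \<in> shift_mats n N lev (red e)"
  obtains h where "h \<in> shift_mats n N lev e" "redm h = g"
proof -
  obtain l where l: "\<And>a. red (l a) = a" using red_surj by metis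
  define h where "h = mat n n (\<lambda>(i, j). if lev (i div N) > lev (j div N) then 0 else
     if lev (i div N) = lev (j div N) then (if i div N = j div N then coeff ([:e, 1:] ^ (j mod N)) (i mod N) else 0)
     else l (g $$ (i, j)))"
  have "h \<in> shift_mats n N lev e" by (auto simp: h_def shift_mats_def)
  moreover have "redm h = g"
    using g by (intro eq_matI) (auto simp: h_def shift_mats_def l red_coeff_shift)
  ultimately show thesis by (rule that)
qed

text \<open>As \<open>v f\<close> squares to zero, \<open>(t + v f)^j\<close> is
  \<open>t^j + j t^(j-1) v f\<close>, so within a level \<open>w\<close> has only the entries
  \<open>j f\<close> directly above the diagonal of each block. In the trace these meet the entries
  1 of \<open>X\<close> directly below the diagonal, while entries between different levels meet
  zeros.\<close>

lemma mtr_kernel_shift: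
  assumes n: "n = m * N" and N: "N > 0" and w: "w \<in> carrier_mat n n" and X: "X \<in> carrier_mat n n"
    and h: "kmat n w \<in> shift_mats n N lev (v f)"
    and X0: "\<And>i j. i < n \<Longrightarrow> j < n \<Longrightarrow> lev (i div N) > lev (j div N) \<Longrightarrow> X $$ (i, j) = 0"
    and X1: "\<And>i j. i < n \<Longrightarrow> j < n \<Longrightarrow> Suc (j mod N) < N \<Longrightarrow> X $$ (i, j) = (if i = Suc j then 1 else 0)"
  shows "mtr n (X * w) = of_nat (m * \<Sum>{..<N}) * f"
proof -
  have k: "kmat n w $$ (i, j) = (if i = j then 1 else 0) + v (w $$ (i, j))" if "i < n" "j < n" for i j
    using that w by (simp add: kmat_def)
  have w0: "w $$ (i, j) = 0" if "i < n" "j < n" "lev (i div N) > lev (j div N)" for i j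
  proof -
    have "kmat n w $$ (i, j) = 0" using h that by (auto simp: shift_mats_def)
    moreover have "i \<noteq> j" using that by auto
    ultimately show ?thesis using k[OF that(1,2)] v_eq_0 by simp
  qed
  have w1: "w $$ (i, j) = (if i div N = j div N \<and> Suc (i mod N) = j mod N then of_nat (j mod N) * f else 0)"
    if ij: "i < n" "j < n" "lev (i div N) = lev (j div N)" for i j
  proof -
    have e: "(if i = j then 1 else 0) + v (w $$ (i, j)) =
        (if i div N = j div N then coeff ([:v f, 1:] ^ (j mod N)) (i mod N) else 0)"
      using h ij k[OF ij(1,2)] by (auto simp: shift_mats_def)
    consider "i div N \<noteq> j div N" | "i div N = j div N" "i mod N > j mod N" | "i = j"
      | "i div N = j div N" "Suc (i mod N) = j mod N" | "i div N = j div N" "Suc (i mod N) < j mod N"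
      by (metis div_mult_mod_eq linorder_neqE_nat Suc_lessI)
    then have "v (w $$ (i, j)) = v (if i div N = j div N \<and> Suc (i mod N) = j mod N then of_nat (j mod N) * f else 0)"
    proof cases
      case 1
      then have "i \<noteq> j" by auto
      then show ?thesis using e 1 by simp
    next
      case 2
      then have "i \<noteq> j" by auto
      then show ?thesis using e 2 by (simp add: coeff_linear_power_gt)
    next
      case 3
      then show ?thesis using e by (auto simp: coeff_linear_poly_power)
    next
      case 4
      have "j mod N choose (i mod N) = j mod N"
        using 4(2) by (metis binomial_Suc_n)
      moreover have "j mod N - i mod N = 1" using 4(2) by simp
      moreover have "of_nat (j mod N) * v f = v (of_nat (j mod N) * f)" by (simp add: mult_v red_of_nat)
      moreover have "i mod N \<le> j mod N" "i \<noteq> j" using 4 by auto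
      ultimately show ?thesis using e 4 by (simp add: coeff_linear_poly_power)
    next
      case 5
      \<comment> \<open>The exponent of \<open>v f\<close> is at least 2.\<close>
      then obtain r where "j mod N - i mod N = Suc (Suc r)" by (metis Suc_diff_Suc Suc_lessD diff_Suc_1 less_imp_Suc_add)
      moreover have "i mod N \<le> j mod N" "i \<noteq> j" using 5 by auto
      ultimately show ?thesis using e 5 by (simp add: coeff_linear_poly_power flip: mult.assoc)
    qed
    then show ?thesis by (rule v_inj)
  qed
  have "mtr n (X * w) = (\<Sum>i<n. \<Sum>j<n. X $$ (i, j) * w $$ (j, i))" by (rule mtr_mult[OF X w])
  also have "\<dots> = (\<Sum>i<n. of_nat (i mod N) * f)"
  proof (rule sum.cong[OF refl])
    fix i assume "i \<in> {..<n}"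
    then have i: "i < n" by simp
    have same: "i div N = j div N \<and> Suc (j mod N) = i mod N" if "i mod N > 0" "j = i - 1" for j
    proof -
      have "i = Suc j" using that by (cases i) auto
      then show ?thesis using that div_mod_Suc[of j N] by simp
    qed
    have t: "X $$ (i, j) * w $$ (j, i) = (if i mod N > 0 \<and> j = i - 1 then of_nat (i mod N) * f else 0)" if j: "j < n" for j
    proof (cases "lev (i div N)" "lev (j div N)" rule: linorder_cases)
      case less
      then show ?thesis using same[of j] w0[of j i] i j less by auto
    next
      case equal
      show ?thesis
      proof (cases "i div N = j div N \<and> Suc (j mod N) = i mod N")
        case True
        then have ij: "i = Suc j" by (metis add_Suc_right div_mult_mod_eq)
        have "Suc (j mod N) < N" using True N by (metis mod_less_divisor)
        then show ?thesis using X1[OF i j] w1[OF j i] True ij equal by simp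
      next
        case False
        then show ?thesis using same[of j] w1[OF j i] equal by auto
      qed
    next
      case greater
      then show ?thesis using same[of j] X0[OF i j] greater by auto
    qed
    have "(\<Sum>j<n. X $$ (i, j) * w $$ (j, i)) = (\<Sum>j<n. if i mod N > 0 \<and> j = i - 1 then of_nat (i mod N) * f else 0)"
      by (intro sum.cong refl t) simp
    also have "\<dots> = (\<Sum>j\<in>{i - 1}. if i mod N > 0 \<and> j = i - 1 then of_nat (i mod N) * f else 0)"
      using i by (intro sum.mono_neutral_right) auto
    also have "\<dots> = of_nat (i mod N) * f" by auto
    finally show "(\<Sum>j<n. X $$ (i, j) * w $$ (j, i)) = of_nat (i mod N) * f" .
  qed
  also have "\<dots> = (\<Sum>s<m. \<Sum>t<N. of_nat t * f)" unfolding n by (rule sum_div_mod[OF N])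
  also have "\<dots> = of_nat (m * \<Sum>{..<N}) * f"
    by (simp add: sum_distrib_right mult.assoc)
  finally show ?thesis .
qed

text \<open>
  The factor \<open>\<kappa>\<close> is a multiple of $N(N-1)/2$ for the power $N$ = \<open>card C\<close> of $p$, so it vanishes unless
  $p = N = 2$, where the value of \<open>\<eta>\<close> on a lift of the nonzero element of \<open>C\<close> has to be a square root.
\<close>
lemma exists_additive_extension:
  fixes \<theta> :: "'q \<Rightarrow> complex" and C :: "'q set" and m :: nat
  assumes \<theta>: "\<And>a b. \<theta> (a + b) = \<theta> a * \<theta> b" "\<theta> 0 = 1"
    and C: "0 \<in> C" "\<And>a b. a \<in> C \<Longrightarrow> b \<in> C \<Longrightarrow> a + b \<in> C"
  defines "\<kappa> \<equiv> of_nat (m * \<Sum>{..<card C}) :: 'q"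
  shows "\<exists>\<eta>. (\<forall>e e'. red e \<in> C \<longrightarrow> red e' \<in> C \<longrightarrow> \<eta> (e + e') = \<eta> e * \<eta> e') \<and> (\<forall>f. \<eta> (v f) = \<theta> (\<kappa> * f))
    \<and> (\<forall>e. \<eta> e \<noteq> 0)"
proof (cases "\<kappa> = 0")
  case True
  then show ?thesis using \<theta>(2) by (intro exI[of _ "\<lambda>_. 1"]) simp
next
  case False
  let ?p = "CHAR('q)"
  have p: "prime ?p" by simp
  have nd: "\<not> ?p dvd m * \<Sum>{..<card C}" using False by (simp add: \<kappa>_def of_nat_eq_0_iff_char_dvd del: of_nat_mult)
  let ?G = "\<lparr>carrier = (UNIV :: 'q set), mult = (+), one = 0\<rparr>"
  have G: "group ?G" by (rule groupI) (auto simp: add.assoc intro: exI[of _ "- _"])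
  \<comment> \<open>\<open>C\<close> is assumed closed under addition; in characteristic $p$ the
    negative of \<open>a\<close> is its multiple by \<open>?p - 1\<close>.\<close>
  have neg: "- a \<in> C" if "a \<in> C" for a
  proof -
    have "of_nat k * a \<in> C" for k
      by (induction k) (auto simp: C algebra_simps that)
    then have "of_nat (?p - 1) * a \<in> C" by blast
    moreover have "of_nat (?p - 1) * a + a = of_nat ?p * a"
      using prime_gt_0_nat[OF p] by (metis Suc_diff_1 distrib_right mult_1 of_nat_Suc add.commute)
    ultimately have "- a = of_nat (?p - 1) * a"
      using minus_unique[of a "of_nat (?p - 1) * a"] by (simp add: add.commute)
    then show ?thesis using \<open>of_nat (?p - 1) * a \<in> C\<close> by simp
  qed
  have "subgroup C ?G"
  proof (rule group.subgroupI[OF G])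
    fix a assume "a \<in> C"
    moreover have "inv\<^bsub>?G\<^esub> a = - a" by (rule group.inv_equality[OF G]) auto
    ultimately show "inv\<^bsub>?G\<^esub> a \<in> C" using neg by simp
  qed (use C in auto)
  from group.lagrange[OF G this] have "card C dvd card (UNIV :: 'q set)"
    by (metis dvd_triv_right order_def partial_object.select_convs(1))
  then obtain r where r: "card C = ?p ^ r"
    using card_finite_field_prime_power[where 'a = 'q] divides_primepow_nat[OF p] by metis
  have r0: "r \<noteq> 0"
  proof
    assume "r = 0"
    then have "card C = 1" using r by simp
    then have "\<Sum>{..<card C} = 0" by (simp only:) simp
    then show False using nd by (metis dvd_0_right mult_0_right)
  qed
  have gauss: "2 * \<Sum>{..<card C} = card C * (card C - 1)"
  proof -
    have "2 * \<Sum>{..<k} = k * (k - 1)" for k :: nat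
    proof (induction k)
      case (Suc k)
      then show ?case by (cases k) (auto simp: algebra_simps)
    qed simp
    then show ?thesis .
  qed
  have nd': "\<not> ?p dvd \<Sum>{..<card C}" using nd by auto
  \<comment> \<open>Twice the sum is divisible by $p$, as $p$ divides \<open>card C\<close>, while
    the sum itself is not; so $p = 2$.\<close>
  have "?p dvd 2 * \<Sum>{..<card C}" unfolding gauss using r r0 by (simp add: dvd_power)
  then have "?p dvd 2" using nd' p prime_dvd_mult_iff by blast
  then have p2: "?p = 2" using p by (simp add: primes_dvd_imp_eq two_is_prime_nat)
  \<comment> \<open>If 4 divides \<open>card C\<close>, then \<open>N (N - 1) / 2\<close> with
    \<open>N = card C\<close> is already even.\<close>
  have "r = 1"
  proof (rule ccontr)
    assume "r \<noteq> 1"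
    then obtain r' where "r = Suc (Suc r')" using r0 by (metis One_nat_def not0_implies_Suc)
    then have "card C = 2 * (2 * 2 ^ r')" using r p2 by simp
    then have "2 * \<Sum>{..<card C} = 2 * (2 * (2 ^ r' * (card C - 1)))" using gauss by simp
    then have "\<Sum>{..<card C} = 2 * (2 ^ r' * (card C - 1))" by (metis mult_left_cancel zero_neq_numeral)
    then have "2 dvd \<Sum>{..<card C}" by (metis dvd_triv_left)
    then show False using nd' p2 by simp
  qed
  then have cC: "card C = 2" using r p2 by simp
  then obtain x y where xy: "C = {x, y}" "x \<noteq> y" by (auto simp: card_2_iff)
  then have "C = {0, y} \<and> y \<noteq> 0 \<or> C = {0, x} \<and> x \<noteq> 0" using C(1) by auto
  then obtain c0 where c0: "C = {0, c0}" "c0 \<noteq> 0" by blast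
  obtain e0 where e0: "red e0 = c0" using red_surj by blast
  have "(2 :: 'q) = 0" using of_nat_CHAR[where 'a = 'q] p2 by simp
  then have two: "a + a = 0" for a :: 'q by (metis mult_2 mult_zero_left)
  have "red (e0 + e0) = 0" unfolding red.hom_add e0 by (rule two)
  then obtain w where w: "e0 + e0 = v w" by (auto simp: red_eq_0)
  \<comment> \<open>The square of \<open>\<eta> e0\<close> has to be \<open>\<eta> (v w)\<close>,
    and \<open>w\<close> need not vanish: for Witt vectors, doubling \<open>(c0, y)\<close> in
    characteristic 2 gives \<open>(0, c0^2)\<close>.\<close>
  define \<omega> where "\<omega> = csqrt (\<theta> (\<kappa> * w))"
  have \<omega>: "\<omega> * \<omega> = \<theta> (\<kappa> * w)" by (simp add: \<omega>_def flip: power2_eq_square)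
  have nz: "\<theta> a \<noteq> 0" for a using \<theta>(1)[of a "- a"] \<theta>(2) by auto
  have \<omega>0: "\<omega> \<noteq> 0" using \<omega> nz by auto
  define g where "g x = (THE f. x = v f)" for x
  have g: "g (v f) = f" for f unfolding g_def by (rule the_equality) (auto dest: v_inj)
  define \<eta> where "\<eta> e = (if red e = 0 then \<theta> (\<kappa> * g e) else \<omega> * \<theta> (\<kappa> * g (e - e0)))" for e
  have \<eta>0: "\<eta> (v f) = \<theta> (\<kappa> * f)" for f by (simp add: \<eta>_def g)
  have \<eta>1: "\<eta> (e0 + v f) = \<omega> * \<theta> (\<kappa> * f)" for f using e0 c0 by (simp add: \<eta>_def g red.hom_add)
  have form: "(\<exists>f. e = v f) \<or> (\<exists>f. e = e0 + v f)" if "red e \<in> C" for e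
  proof (cases "red e = 0")
    case False
    then have "red (e - e0) = 0" using that c0 e0 by (simp add: red.hom_minus)
    then obtain f where "e - e0 = v f" by (auto simp: red_eq_0)
    then have "e = e0 + v f" by (simp add: algebra_simps)
    then show ?thesis by blast
  qed (auto simp: red_eq_0)
  have "\<eta> (e + e') = \<eta> e * \<eta> e'" if e: "red e \<in> C" "red e' \<in> C" for e e'
  proof -
    have 1: "\<eta> (v f + v f') = \<eta> (v f) * \<eta> (v f')" for f f'
      by (simp add: \<eta>0 distrib_left \<theta> flip: v_add)
    have 2: "\<eta> (e0 + v f + v f') = \<eta> (e0 + v f) * \<eta> (v f')" for f f'
      using \<eta>1[of "f + f'"] by (simp add: \<eta>0 \<eta>1 distrib_left \<theta> v_add add.assoc)
    have 3: "\<eta> (e0 + v f + (e0 + v f')) = \<eta> (e0 + v f) * \<eta> (e0 + v f')" for f f'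
    proof -
      have "e0 + v f + (e0 + v f') = v (w + f + f')" by (simp add: v_add flip: w)
      then show ?thesis using \<omega> by (simp add: \<eta>0 \<eta>1 distrib_left \<theta>)
    qed
    consider f f' where "e = v f" "e' = v f'" | f f' where "e = e0 + v f" "e' = v f'"
      | f f' where "e = v f'" "e' = e0 + v f" | f f' where "e = e0 + v f" "e' = e0 + v f'"
      using form[OF e(1)] form[OF e(2)] by blast
    then show ?thesis
    proof cases
      case 3
      have "\<eta> (e + e') = \<eta> (e0 + v f + v f')" unfolding 3 by (simp add: add_ac)
      then show ?thesis unfolding 2 3 by simp
    qed (use 1 2 3 in simp_all)
  qed
  then show ?thesis using \<eta>0 nz \<omega>0 by (intro exI[of _ \<eta>]) (auto simp: \<eta>_def)
qed

end

section \<open>Reduction of special linear groups and extension of characters\<close>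

lemma SL_simps:
  "A \<in> carrier (SL TYPE('a::comm_ring_1) n) \<longleftrightarrow> A \<in> carrier_mat n n \<and> det A = 1"
  "A \<otimes>\<^bsub>SL TYPE('a) n\<^esub> B = A * B" "\<one>\<^bsub>SL TYPE('a) n\<^esub> = 1\<^sub>m n"
  by (auto simp: SL_def)

context length_two
begin

lemma redm_hom: "redm \<in> hom (SL TYPE('r) n) (SL TYPE('q) n)"
  by (auto intro!: homI simp: SL_simps red.mat_hom_mult)

lemma redm_mult: "A \<in> carrier_mat n n \<Longrightarrow> B \<in> carrier_mat n n \<Longrightarrow> redm (A * B) = redm A * redm B"
  by (rule red.mat_hom_mult)

lemma kmat_in_SL: "z \<in> carrier_mat n n \<Longrightarrow> kmat n z \<in> carrier (SL TYPE('r) n) \<longleftrightarrow> mtr n z = 0"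
  by (auto simp: SL_simps det_kmat v_eq_0)

lemma kernel_SL:
  "{k \<in> carrier (SL TYPE('r) n). redm k = 1\<^sub>m n} = kmat n ` {z \<in> carrier_mat n n. mtr n z = 0}"
proof (intro equalityI subsetI)
  fix k assume k: "k \<in> {k \<in> carrier (SL TYPE('r) n). redm k = 1\<^sub>m n}"
  then have "k \<in> carrier_mat n n" "redm k = 1\<^sub>m n" by (auto simp: SL_simps)
  then obtain z where z: "z \<in> carrier_mat n n" "k = kmat n z" by (rule redm_eq_1)
  then show "k \<in> kmat n ` {z \<in> carrier_mat n n. mtr n z = 0}" using k kmat_in_SL[OF z(1)] by auto
qed (auto simp: kmat_in_SL redm_kmat)

text \<open>\<open>extend_character\<close> applies to those lifts of \<open>P\<close> that have
  substitution form in a basis adapted to \<open>X\<close> and \<open>P\<close>. They cover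
  \<open>P\<close> because the form can be lifted, they are closed under products, and on those in
  the kernel \<open>mtr_kernel_shift\<close> evaluates the character.\<close>

theorem exists_extension:
  fixes X :: "'q mat" and c :: "'q mat \<Rightarrow> 'q" and \<theta> :: "'q \<Rightarrow> complex"
  assumes \<theta>: "\<And>a b. \<theta> (a + b) = \<theta> a * \<theta> b" "\<theta> 0 = 1"
    and X: "X \<in> carrier_mat n n"
    and P: "subgroup P (SL TYPE('q) n)" "card P = CHAR('q) ^ k"
    and c: "\<And>g h. g \<in> P \<Longrightarrow> h \<in> P \<Longrightarrow> c (g * h) = c g + c h"
    and twist: "\<And>g. g \<in> P \<Longrightarrow> g * X = X * g + c g \<cdot>\<^sub>m g"
  defines "Pt \<equiv> {y \<in> carrier (SL TYPE('r) n). redm y \<in> P}"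
  shows "\<exists>\<chi> :: 'r mat \<Rightarrow> complex. (\<forall>y\<in>Pt. \<forall>y'\<in>Pt. \<chi> (y * y') = \<chi> y * \<chi> y') \<and>
    (\<forall>z\<in>carrier_mat n n. mtr n z = 0 \<longrightarrow> \<chi> (kmat n z) = \<theta> (mtr n (X * z)))"
proof -
  let ?R = "SL TYPE('r) n" and ?S = "SL TYPE('q) n"
  interpret R: group ?R by (rule group_SL)
  interpret S: group ?S by (rule group_SL)
  interpret P: group "?S\<lparr>carrier := P\<rparr>" by (rule subgroup.subgroup_is_group[OF P(1) S.group_axioms])
  interpret \<pi>: group_hom ?R ?S redm
    by (intro group_hom.intro group_hom_axioms.intro R.group_axioms S.group_axioms redm_hom)
  have PS: "P \<subseteq> carrier ?S" using subgroup.subset[OF P(1)] .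
  have Pc: "g \<in> carrier_mat n n" "det g = 1" if "g \<in> P" for g using PS that by (auto simp: SL_simps)
  have P1: "1\<^sub>m n \<in> P" using subgroup.one_closed[OF P(1)] by (simp add: SL_simps)
  have cP: "carrier (?S\<lparr>carrier := P\<rparr>) = P" by simp
  obtain M M' m N lev where M: "M \<in> carrier_mat n n" "M' \<in> carrier_mat n n" "M * M' = 1\<^sub>m n" "M' * M = 1\<^sub>m n"
    and n: "n = m * N" and N: "N = card (c ` P)" "N > 0"
    and mono: "\<And>s t. s \<le> t \<Longrightarrow> t < m \<Longrightarrow> lev s \<le> (lev t :: nat)"
    and X0: "\<And>i j. i < n \<Longrightarrow> j < n \<Longrightarrow> lev (i div N) > lev (j div N) \<Longrightarrow> (M' * X * M) $$ (i, j) = 0"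
    and X1: "\<And>i j. i < n \<Longrightarrow> j < n \<Longrightarrow> Suc (j mod N) < N \<Longrightarrow> (M' * X * M) $$ (i, j) = (if i = Suc j then 1 else 0)"
    and g0: "\<And>g i j. g \<in> P \<Longrightarrow> i < n \<Longrightarrow> j < n \<Longrightarrow> lev (i div N) > lev (j div N) \<Longrightarrow> (M' * g * M) $$ (i, j) = 0"
    and g1: "\<And>g i j. g \<in> P \<Longrightarrow> i < n \<Longrightarrow> j < n \<Longrightarrow> lev (i div N) = lev (j div N) \<Longrightarrow> (M' * g * M) $$ (i, j) =
        (if i div N = j div N then coeff ([:c g, 1:] ^ (j mod N)) (i mod N) else 0)"
  proof (rule exists_adapted_matrix[OF X P.group_axioms, of k c], goal_cases)
    case (7 M M' m N lev)
    show ?case by (rule 7(1)[OF 7(2-13)[unfolded cP]])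
  next
    case 1 then show ?case using P(2) by (simp add: order_def)
  next
    case 2 then show ?case using Pc by auto
  next
    case (5 g h) then show ?case using c by simp
  next
    case (6 g) then show ?case using twist by simp
  qed (simp_all add: SL_def)
  have shift_P: "M' * g * M \<in> shift_mats n N lev (c g)" if "g \<in> P" for g
    using that M Pc g0 g1 by (auto simp: shift_mats_def)
  \<comment> \<open>The change of basis is lifted as well, so that lifts of \<open>P\<close> can be
    brought into block form over the ring.\<close>
  obtain L L' where L: "L \<in> carrier_mat n n" "L' \<in> carrier_mat n n" "redm L = M" "redm L' = M'"
    "L * L' = 1\<^sub>m n" "L' * L = 1\<^sub>m n" using lift_inverse[OF M] by blast
  have LL: "L' * (L * B) = B" "L * (L' * B) = B" if "B \<in> carrier_mat n n" for B
    using that L assoc_mult_mat[of L' n n L n B n] assoc_mult_mat[of L n n L' n B n] by simp_all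
  have MM: "M' * (M * B) = B" "M * (M' * B) = B" if "B \<in> carrier_mat n n" for B
    using that M assoc_mult_mat[of M' n n M n B n] assoc_mult_mat[of M n n M' n B n] by simp_all
  have detL: "det L * det L' = 1" using det_mult[OF L(1,2)] L(5) by simp
  have "1\<^sub>m n * 1\<^sub>m n = (1\<^sub>m n :: 'q mat)" by simp
  from c[OF P1 P1, unfolded this] have c1: "c (1\<^sub>m n) = 0"
    using add_cancel_right_right[of "c (1\<^sub>m n)" "c (1\<^sub>m n)"] by blast
  have C0: "0 \<in> c ` P" using c1 P1 by (metis image_eqI)
  have Cadd: "a + b \<in> c ` P" if "a \<in> c ` P" "b \<in> c ` P" for a b
    using that c subgroup.m_closed[OF P(1)] by (force simp: SL_simps)
  obtain \<eta> where \<eta>: "\<And>e e'. red e \<in> c ` P \<Longrightarrow> red e' \<in> c ` P \<Longrightarrow> \<eta> (e + e') = \<eta> e * \<eta> e'"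
    "\<And>f. \<eta> (v f) = \<theta> (of_nat (m * \<Sum>{..<N}) * f)" "\<And>e. \<eta> e \<noteq> 0"
    using exists_additive_extension[OF \<theta> C0 Cadd, where m = m] unfolding N(1) by blast
  \<comment> \<open>The parameter \<open>e\<close> is recorded next to \<open>h\<close> because for
    \<open>N = 1\<close> the matrix does not determine it.\<close>
  define H where "H = {(h, e). h \<in> Pt \<and> red e = c (redm h) \<and> L' * h * L \<in> shift_mats n N lev e}"
  \<comment> \<open>The choice is unique, as \<open>kmat\<close> is injective.\<close>
  define \<psi> where "\<psi> k = \<theta> (mtr n (X * (SOME z. z \<in> carrier_mat n n \<and> k = kmat n z)))" for k
  have \<psi>: "\<psi> (kmat n z) = \<theta> (mtr n (X * z))" if "z \<in> carrier_mat n n" for z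
  proof -
    have "(SOME w. w \<in> carrier_mat n n \<and> kmat n z = kmat n w) = z"
    proof (rule some_equality)
      fix w assume "w \<in> carrier_mat n n \<and> kmat n z = kmat n w"
      then show "w = z" using kmat_inj[OF that, of w] by metis
    qed (use that in simp)
    then show ?thesis by (simp add: \<psi>_def)
  qed
  define K where "K = {k \<in> carrier ?R. redm k = \<one>\<^bsub>?S\<^esub>}"
  have K: "K = kmat n ` {z \<in> carrier_mat n n. mtr n z = 0}"
    unfolding K_def SL_simps(3) by (rule kernel_SL)
  have PtR: "y \<in> carrier_mat n n" "det y = 1" "redm y \<in> P" if "y \<in> Pt" for y
    using that by (auto simp: Pt_def SL_simps)
  have sub: "subgroup Pt ?R"
  proof (rule R.subgroupI)
    have "1\<^sub>m n \<in> Pt" using P1 by (simp add: Pt_def SL_simps red.mat_hom_one)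
    then show "Pt \<noteq> {}" by blast
    fix a assume "a \<in> Pt"
    then show "inv\<^bsub>?R\<^esub> a \<in> Pt" using subgroup.m_inv_closed[OF P(1)] by (auto simp: Pt_def)
    fix b assume "b \<in> Pt"
    then show "a \<otimes>\<^bsub>?R\<^esub> b \<in> Pt" using \<open>a \<in> Pt\<close> subgroup.m_closed[OF P(1)] by (auto simp: Pt_def)
  qed (auto simp: Pt_def)
  have "\<exists>\<chi>. (\<forall>y\<in>Pt. \<forall>y'\<in>Pt. \<chi> (y \<otimes>\<^bsub>?R\<^esub> y') = \<chi> y * \<chi> y') \<and> (\<forall>k\<in>K. \<chi> k = \<psi> k)"
  proof (rule extend_character[OF R.group_axioms S.group_axioms redm_hom sub K_def, of \<psi> H \<eta>])
    show "K \<subseteq> Pt" using P1 by (auto simp: K_def Pt_def SL_simps)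
  next
    fix k k' assume "k \<in> K" "k' \<in> K"
    then obtain z z' where z: "z \<in> carrier_mat n n" "z' \<in> carrier_mat n n" "k = kmat n z" "k' = kmat n z'"
      by (auto simp: K)
    then have "\<psi> (k * k') = \<theta> (mtr n (X * (z + z')))" by (simp add: kmat_mult \<psi>)
    also have "X * (z + z') = X * z + X * z'" using X z by (simp add: mult_add_distrib_mat)
    also have "mtr n \<dots> = mtr n (X * z) + mtr n (X * z')" using X z by (intro mtr_add) auto
    finally show "\<psi> (k \<otimes>\<^bsub>?R\<^esub> k') = \<psi> k * \<psi> k'" using z by (simp add: SL_simps \<psi> \<theta>)
  next
    fix h e assume "(h, e) \<in> H"
    then show "h \<in> Pt \<and> \<eta> e \<noteq> 0" using \<eta>(3) by (simp add: H_def)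
  next
    fix h e h' e' assume hH: "(h, e) \<in> H" "(h', e') \<in> H"
    then have h: "h \<in> Pt" "h' \<in> Pt" "red e = c (redm h)" "red e' = c (redm h')"
      "L' * h * L \<in> shift_mats n N lev e" "L' * h' * L \<in> shift_mats n N lev e'" by (auto simp: H_def)
    note hc = PtR[OF h(1)] PtR[OF h(2)]
    have "L' * (h * h') * L = (L' * h * L) * (L' * h' * L)"
    proof -
      have "(L' * h * L) * (L' * h' * L) = L' * h * (L * (L' * (h' * L)))"
        using L hc by (simp add: assoc_mult_mat[of _ n n _ n _ n])
      also have "L * (L' * (h' * L)) = h' * L"
        using L hc assoc_mult_mat[of L n n L' n "h' * L" n] by simp
      finally show ?thesis using L hc by (simp add: assoc_mult_mat[of _ n n _ n _ n])
    qed
    then have "L' * (h * h') * L \<in> shift_mats n N lev (e + e')"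
      using shift_mats_mult[OF n N(2) h(5,6)] by simp
    moreover have "h * h' \<in> Pt" using subgroup.m_closed[OF sub h(1,2)] by (simp add: SL_simps)
    moreover have "red (e + e') = c (redm (h * h'))"
      using h hc c by (simp add: red.hom_add red.mat_hom_mult)
    moreover have "\<eta> (e + e') = \<eta> e * \<eta> e'" using h hc by (intro \<eta>) auto
    ultimately show "(h \<otimes>\<^bsub>?R\<^esub> h', e + e') \<in> H \<and> \<eta> (e + e') = \<eta> e * \<eta> e'"
      by (simp add: H_def SL_simps)
  next
    fix h e assume hH: "(h, e) \<in> H" "h \<in> K"
    then obtain z where z: "z \<in> carrier_mat n n" "mtr n z = 0" "h = kmat n z" by (auto simp: K)
    \<comment> \<open>In the kernel \<open>redm h\<close> is the identity, where \<open>c\<close>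
      vanishes; so \<open>e\<close> has the form \<open>v f\<close>.\<close>
    have "red e = 0" using hH z c1 by (simp add: H_def redm_kmat)
    then obtain f where f: "e = v f" by (auto simp: red_eq_0)
    let ?w = "M' * z * M"
    have w: "?w \<in> carrier_mat n n" using M z by simp
    have "L' * kmat n z * L = kmat n ?w"
    proof -
      have "L' * kmat n z = kmat n (M' * z * M) * L'"
        using kmat_conj[OF L(2) z(1) M(1)] M L by simp
      then have "L' * kmat n z * L = kmat n ?w * (L' * L)"
        using L w by (simp add: assoc_mult_mat[of _ n n _ n _ n])
      then show ?thesis using right_mult_one_mat[OF kmat_carrier[OF w]] L by simp
    qed
    then have "kmat n ?w \<in> shift_mats n N lev (v f)" using hH f z by (simp add: H_def)
    from mtr_kernel_shift[OF n N(2) w _ this X0 X1]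
    have "mtr n ((M' * X * M) * ?w) = of_nat (m * \<Sum>{..<N}) * f" using M X by simp
    moreover have "(M' * X * M) * ?w = M' * (X * z * M)"
    proof -
      have "(M' * X * M) * ?w = M' * X * (M * (M' * (z * M)))"
        using M X z by (simp add: assoc_mult_mat[of _ n n _ n _ n])
      also have "M * (M' * (z * M)) = z * M"
        using M z assoc_mult_mat[of M n n M' n "z * M" n] by simp
      finally show ?thesis using M X z by (simp add: assoc_mult_mat[of _ n n _ n _ n])
    qed
    moreover have "mtr n (M' * (X * z * M)) = mtr n (X * z)"
    proof -
      have "mtr n (M' * (X * z * M)) = mtr n (X * z * M * M')" using M X z by (intro mtr_comm) auto
      also have "X * z * M * M' = X * z * (M * M')" using M X z by (intro assoc_mult_mat) auto
      finally show ?thesis using M X z by simp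
    qed
    ultimately show "\<psi> h = \<eta> e" using z f by (simp add: \<psi> \<eta>(2))
  next
    fix h e k assume hH: "(h, e) \<in> H" "k \<in> K"
    then obtain z where z: "z \<in> carrier_mat n n" "mtr n z = 0" "k = kmat n z" by (auto simp: K)
    have h: "h \<in> Pt" using hH by (simp add: H_def)
    let ?s = "redm h" and ?s' = "inv\<^bsub>?S\<^esub> (redm h)"
    have s: "?s \<in> P" "?s' \<in> P" using PtR[OF h] subgroup.m_inv_closed[OF P(1)] by auto
    have ss: "?s' * ?s = 1\<^sub>m n" "?s * ?s' = 1\<^sub>m n"
      using S.l_inv[of ?s] S.r_inv[of ?s] s PS by (auto simp: SL_simps)
    note sc = Pc(1)[OF s(1)] Pc(1)[OF s(2)] PtR(1)[OF h]
    have "h * k = kmat n (?s * z * ?s') * h" using kmat_conj[OF sc(3) z(1) sc(2) ss(1)] z by simp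
    have "mtr n (?s * z * ?s') = mtr n (?s' * (?s * z))" using sc z by (intro mtr_comm) auto
    also have "?s' * (?s * z) = z" using assoc_mult_mat[OF sc(2,1) z(1)] ss z by simp
    finally have "kmat n (?s * z * ?s') \<in> carrier ?R"
      using kmat_in_SL[of "?s * z * ?s'" n] sc z by simp
    moreover have "h \<in> carrier ?R" using h by (simp add: Pt_def)
    moreover have "h \<otimes>\<^bsub>?R\<^esub> k = kmat n (?s * z * ?s') \<otimes>\<^bsub>?R\<^esub> h"
      using \<open>h * k = kmat n (?s * z * ?s') * h\<close> by (simp add: SL_simps)
    ultimately have "h \<otimes>\<^bsub>?R\<^esub> k \<otimes>\<^bsub>?R\<^esub> inv\<^bsub>?R\<^esub> h = kmat n (?s * z * ?s')"
      by (simp add: R.m_assoc)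
    then have "\<psi> (h \<otimes>\<^bsub>?R\<^esub> k \<otimes>\<^bsub>?R\<^esub> inv\<^bsub>?R\<^esub> h) = \<theta> (mtr n (X * (?s * z * ?s')))"
      using sc z by (simp add: \<psi>)
    also have "mtr n (X * (?s * z * ?s')) = mtr n (?s' * (X * ?s * z))"
    proof -
      have "X * (?s * z * ?s') = X * ?s * z * ?s'" using sc z X by (simp add: assoc_mult_mat[of _ n n _ n _ n])
      then show ?thesis using mtr_comm[of "X * ?s * z" n ?s'] sc z X by simp
    qed
    \<comment> \<open>Conjugating \<open>X\<close> by \<open>?s\<close> changes it by the scalar
      \<open>c ?s\<close>, which contributes \<open>c ?s\<close> times the trace of
      \<open>z\<close>, that is 0.\<close>
    also have "mtr n (?s' * (X * ?s * z)) = mtr n (X * z)"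
    proof -
      have "?s' * (?s * X) = X" using assoc_mult_mat[OF sc(2,1) X] ss X by simp
      then have "X = ?s' * (X * ?s + c ?s \<cdot>\<^sub>m ?s)" using twist[OF s(1)] by simp
      also have "\<dots> = ?s' * (X * ?s) + c ?s \<cdot>\<^sub>m 1\<^sub>m n"
        using mult_add_distrib_mat[OF sc(2) mult_carrier_mat[OF X sc(1)], of "c ?s \<cdot>\<^sub>m ?s"]
          mult_smult_distrib[OF sc(2) sc(1)] sc ss by simp
      finally have e: "X = ?s' * (X * ?s) + c ?s \<cdot>\<^sub>m 1\<^sub>m n" .
      have "X * z = (?s' * (X * ?s)) * z + (c ?s \<cdot>\<^sub>m 1\<^sub>m n) * z"
        using sc X z by (subst e) (simp add: add_mult_distrib_mat[of _ n n])
      also have "(c ?s \<cdot>\<^sub>m 1\<^sub>m n) * z = c ?s \<cdot>\<^sub>m z" using z mult_smult_assoc_mat[OF one_carrier_mat z(1)] by simp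
      finally have "mtr n (X * z) = mtr n (?s' * (X * ?s) * z) + mtr n (c ?s \<cdot>\<^sub>m z)"
        using sc X z by (simp only:) (intro mtr_add; auto intro!: mult_carrier_mat[of _ n n])
      moreover have "mtr n (c ?s \<cdot>\<^sub>m z) = c ?s * mtr n z" using z(1) by (simp add: mtr_def sum_distrib_left)
      ultimately show ?thesis using z sc X by (simp add: assoc_mult_mat[of _ n n _ n _ n])
    qed
    finally show "\<psi> (h \<otimes>\<^bsub>?R\<^esub> k \<otimes>\<^bsub>?R\<^esub> inv\<^bsub>?R\<^esub> h) = \<psi> k" using z by (simp add: \<psi>)
  next
    fix y assume y: "y \<in> Pt"
    let ?s = "redm y"
    have s: "?s \<in> P" using PtR[OF y] by simp
    \<comment> \<open>Any lift of \<open>c ?s\<close> will do: it gives a lift of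
      \<open>M' * ?s * M\<close> in substitution form, and conjugating back by \<open>L\<close>
      yields the element of \<open>H\<close>.\<close>
    obtain e where e: "red e = c ?s" using red_surj by blast
    obtain h0 where h0: "h0 \<in> shift_mats n N lev e" "redm h0 = M' * ?s * M"
      using lift_shift_mat[of "M' * ?s * M" n N lev e] shift_P[OF s] e by auto
    have h0c: "h0 \<in> carrier_mat n n" using h0 by (simp add: shift_mats_def)
    let ?h = "L * h0 * L'"
    have "det ?h = 1"
      using det_mult[of "L * h0" n L'] det_mult[of L n h0] L h0c det_shift_mats[OF n N(2) mono h0(1)] detL by simp
    moreover have red: "redm ?h = ?s"
    proof -
      have "redm ?h = M * (M' * ?s * M) * M'"
        unfolding redm_mult[OF mult_carrier_mat[OF L(1) h0c] L(2)] redm_mult[OF L(1) h0c] L(3,4) h0(2) ..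
      also have "\<dots> = ?s" using M Pc(1)[OF s] by (simp add: assoc_mult_mat[of _ n n _ n _ n] MM)
      finally show ?thesis .
    qed
    moreover have "L' * ?h * L = h0"
    proof -
      show ?thesis using L h0c by (simp add: assoc_mult_mat[of _ n n _ n _ n] LL)
    qed
    ultimately have "(?h, e) \<in> H" using h0 L h0c e s by (simp add: H_def Pt_def SL_simps)
    then show "\<exists>h e. (h, e) \<in> H \<and> redm h = redm y" using red by blast
  qed
  then obtain \<chi> where \<chi>: "\<And>y y'. y \<in> Pt \<Longrightarrow> y' \<in> Pt \<Longrightarrow> \<chi> (y * y') = \<chi> y * \<chi> y'" "\<And>k. k \<in> K \<Longrightarrow> \<chi> k = \<psi> k"
    by (auto simp: SL_simps)
  have "\<chi> (kmat n z) = \<theta> (mtr n (X * z))" if "z \<in> carrier_mat n n" "mtr n z = 0" for z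
    using that \<chi>(2)[of "kmat n z"] by (simp add: K \<psi>)
  then show ?thesis using \<chi>(1) by blast
qed

end

section \<open>Extensions of groups with abelian kernel\<close>

text \<open>An extension of \<open>S\<close> by the abelian group \<open>Z\<close>. The data
  \<open>S\<close>, \<open>Z\<close>, \<open>act\<close> and \<open>\<Lambda>\<close> are what the
  two special linear groups will share. Characters are extensional, so that those agreeing on
  \<open>Z\<close> are equal.\<close>

locale ext_data = G: group G + S: group S + Z: comm_group Z
  for G :: "'g monoid" and S :: "'s monoid" and Z :: "'z monoid" +
  fixes \<pi> :: "'g \<Rightarrow> 's" and \<kappa> :: "'z \<Rightarrow> 'g" and act :: "'s \<Rightarrow> 'z \<Rightarrow> 'z"
    and \<Lambda> :: "('z \<Rightarrow> complex) set"
  assumes finite_G: "finite (carrier G)"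
    and \<pi>_hom: "\<pi> \<in> hom G S" and \<pi>_surj: "\<pi> ` carrier G = carrier S"
    and \<kappa>_hom: "\<kappa> \<in> hom Z G" and \<kappa>_inj: "inj_on \<kappa> (carrier Z)"
    and \<kappa>_image: "\<kappa> ` carrier Z = {y \<in> carrier G. \<pi> y = \<one>\<^bsub>S\<^esub>}"
    and act_closed: "s \<in> carrier S \<Longrightarrow> z \<in> carrier Z \<Longrightarrow> act s z \<in> carrier Z"
    and conj: "y \<in> carrier G \<Longrightarrow> z \<in> carrier Z \<Longrightarrow> y \<otimes>\<^bsub>G\<^esub> \<kappa> z = \<kappa> (act (\<pi> y) z) \<otimes>\<^bsub>G\<^esub> y"
    and \<Lambda>_ext: "\<phi> \<in> \<Lambda> \<Longrightarrow> \<phi> \<in> extensional (carrier Z)"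
    and \<Lambda>_mult: "\<phi> \<in> \<Lambda> \<Longrightarrow> z \<in> carrier Z \<Longrightarrow> z' \<in> carrier Z \<Longrightarrow> \<phi> (z \<otimes>\<^bsub>Z\<^esub> z') = \<phi> z * \<phi> z'"
    and \<Lambda>_one: "\<phi> \<in> \<Lambda> \<Longrightarrow> \<phi> \<one>\<^bsub>Z\<^esub> = 1"
    and \<Lambda>_act: "\<phi> \<in> \<Lambda> \<Longrightarrow> s \<in> carrier S \<Longrightarrow> restrict (\<lambda>z. \<phi> (act s z)) (carrier Z) \<in> \<Lambda>"
begin

text \<open>A right action of \<open>S\<close> on characters, dual to \<open>act\<close>.\<close>

definition tw :: "('z \<Rightarrow> complex) \<Rightarrow> 's \<Rightarrow> 'z \<Rightarrow> complex" where
  "tw \<phi> s = restrict (\<lambda>z. \<phi> (act s z)) (carrier Z)"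

sublocale \<pi>: group_hom G S \<pi>
  by (intro group_hom.intro group_hom_axioms.intro G.group_axioms S.group_axioms \<pi>_hom)

sublocale \<kappa>: group_hom Z G \<kappa>
  by (intro group_hom.intro group_hom_axioms.intro G.group_axioms Z.group_axioms \<kappa>_hom)

lemma \<pi>_\<kappa> [simp]: "z \<in> carrier Z \<Longrightarrow> \<pi> (\<kappa> z) = \<one>\<^bsub>S\<^esub>"
  using \<kappa>_image by blast

lemma kernelE:
  assumes "y \<in> carrier G" "\<pi> y = \<one>\<^bsub>S\<^esub>"
  obtains z where "z \<in> carrier Z" "y = \<kappa> z"
  using assms \<kappa>_image by blast

lemma finite_S: "finite (carrier S)"
  unfolding \<pi>_surj[symmetric] using finite_G by (rule finite_imageI)

lemma finite_Z: "finite (carrier Z)"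
proof (rule finite_imageD[OF _ \<kappa>_inj])
  show "finite (\<kappa> ` carrier Z)" unfolding \<kappa>_image using finite_G by simp
qed

lemma liftE:
  assumes "s \<in> carrier S" obtains y where "y \<in> carrier G" "\<pi> y = s"
proof -
  have "s \<in> \<pi> ` carrier G" using assms by (simp only: \<pi>_surj)
  then show thesis using that by auto
qed

text \<open>\<open>conj\<close> for a product of lifts, together with injectivity of
  \<open>\<kappa>\<close>, forces \<open>act\<close> to be an action.\<close>

lemma act_mult:
  assumes s: "s \<in> carrier S" "t \<in> carrier S" and z: "z \<in> carrier Z"
  shows "act (s \<otimes>\<^bsub>S\<^esub> t) z = act s (act t z)"
proof -
  obtain y where y: "y \<in> carrier G" "\<pi> y = s" using liftE s by blast
  obtain y' where y': "y' \<in> carrier G" "\<pi> y' = t" using liftE s by blast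
  have "\<kappa> (act (s \<otimes>\<^bsub>S\<^esub> t) z) \<otimes>\<^bsub>G\<^esub> (y \<otimes>\<^bsub>G\<^esub> y') = (y \<otimes>\<^bsub>G\<^esub> y') \<otimes>\<^bsub>G\<^esub> \<kappa> z"
    using conj[of "y \<otimes>\<^bsub>G\<^esub> y'" z] y y' z by simp
  also have "\<dots> = y \<otimes>\<^bsub>G\<^esub> (\<kappa> (act t z) \<otimes>\<^bsub>G\<^esub> y')"
    using conj[OF y'(1) z] y y' z by (simp add: G.m_assoc)
  also have "\<dots> = (y \<otimes>\<^bsub>G\<^esub> \<kappa> (act t z)) \<otimes>\<^bsub>G\<^esub> y'"
    using y y' z s act_closed by (simp add: G.m_assoc)
  also have "\<dots> = \<kappa> (act s (act t z)) \<otimes>\<^bsub>G\<^esub> (y \<otimes>\<^bsub>G\<^esub> y')"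
    using conj[OF y(1), of "act t z"] y y' z s act_closed by (simp add: G.m_assoc)
  finally have "\<kappa> (act (s \<otimes>\<^bsub>S\<^esub> t) z) = \<kappa> (act s (act t z))"
    using y y' z s act_closed by (simp add: G.right_cancel)
  then show ?thesis using \<kappa>_inj act_closed s z by (auto dest: inj_onD)
qed

lemma act_one: "z \<in> carrier Z \<Longrightarrow> act \<one>\<^bsub>S\<^esub> z = z"
  using conj[of "\<one>\<^bsub>G\<^esub>" z] act_closed[of "\<one>\<^bsub>S\<^esub>" z] \<kappa>_inj by (auto dest: inj_onD)

lemma tw_in: "\<phi> \<in> \<Lambda> \<Longrightarrow> s \<in> carrier S \<Longrightarrow> tw \<phi> s \<in> \<Lambda>"
  unfolding tw_def by (rule \<Lambda>_act)

lemma tw_apply: "z \<in> carrier Z \<Longrightarrow> tw \<phi> s z = \<phi> (act s z)"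
  by (simp add: tw_def)

lemma tw_mult: "s \<in> carrier S \<Longrightarrow> t \<in> carrier S \<Longrightarrow> tw \<phi> (s \<otimes>\<^bsub>S\<^esub> t) = tw (tw \<phi> s) t"
  by (auto simp: tw_def fun_eq_iff act_mult act_closed)

lemma tw_one:
  assumes "\<phi> \<in> \<Lambda>" shows "tw \<phi> \<one>\<^bsub>S\<^esub> = \<phi>"
proof
  fix z show "tw \<phi> \<one>\<^bsub>S\<^esub> z = \<phi> z"
    using extensional_arb[OF \<Lambda>_ext[OF assms], of z] by (simp add: tw_def act_one)
qed

lemma stabilizer_subgroup:
  assumes "\<phi> \<in> \<Lambda>" shows "subgroup {s \<in> carrier S. tw \<phi> s = \<phi>} S"
proof (rule S.subgroupI)
  show "{s \<in> carrier S. tw \<phi> s = \<phi>} \<noteq> {}" using tw_one[OF assms] by blast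
  fix a assume a: "a \<in> {s \<in> carrier S. tw \<phi> s = \<phi>}"
  then have "tw \<phi> \<one>\<^bsub>S\<^esub> = tw \<phi> (inv\<^bsub>S\<^esub> a)"
    using tw_mult[of a "inv\<^bsub>S\<^esub> a" \<phi>] by simp
  then show "inv\<^bsub>S\<^esub> a \<in> {s \<in> carrier S. tw \<phi> s = \<phi>}" using a tw_one[OF assms] by simp
  fix b assume "b \<in> {s \<in> carrier S. tw \<phi> s = \<phi>}"
  then show "a \<otimes>\<^bsub>S\<^esub> b \<in> {s \<in> carrier S. tw \<phi> s = \<phi>}" using a by (simp add: tw_mult)
qed auto

text \<open>Each fibre of \<open>\<pi>\<close> is a coset of the kernel and has as many elements as
  \<open>Z\<close>.\<close>

lemma card_preimage:
  assumes "A \<subseteq> carrier S"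
  shows "card {y \<in> carrier G. \<pi> y \<in> A} = card (carrier Z) * card A"
proof -
  have "\<forall>s\<in>carrier S. \<exists>y. y \<in> carrier G \<and> \<pi> y = s" by (auto elim: liftE)
  from bchoice[OF this] obtain l where l: "\<And>s. s \<in> carrier S \<Longrightarrow> l s \<in> carrier G \<and> \<pi> (l s) = s" by blast
  have "bij_betw (\<lambda>(z, s). \<kappa> z \<otimes>\<^bsub>G\<^esub> l s) (carrier Z \<times> A) {y \<in> carrier G. \<pi> y \<in> A}"
  proof (rule bij_betwI')
    fix x y assume xy: "x \<in> carrier Z \<times> A" "y \<in> carrier Z \<times> A"
    then obtain z s z' s' where p: "x = (z, s)" "y = (z', s')" "z \<in> carrier Z" "z' \<in> carrier Z" "s \<in> A" "s' \<in> A" by auto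
    have ls: "l s \<in> carrier G" "\<pi> (l s) = s" "l s' \<in> carrier G" "\<pi> (l s') = s'" "s \<in> carrier S" "s' \<in> carrier S"
      using l p assms by auto
    show "(case x of (z, s) \<Rightarrow> \<kappa> z \<otimes>\<^bsub>G\<^esub> l s) = (case y of (z, s) \<Rightarrow> \<kappa> z \<otimes>\<^bsub>G\<^esub> l s) \<longleftrightarrow> x = y"
    proof
      assume "(case x of (z, s) \<Rightarrow> \<kappa> z \<otimes>\<^bsub>G\<^esub> l s) = (case y of (z, s) \<Rightarrow> \<kappa> z \<otimes>\<^bsub>G\<^esub> l s)"
      then have e: "\<kappa> z \<otimes>\<^bsub>G\<^esub> l s = \<kappa> z' \<otimes>\<^bsub>G\<^esub> l s'" using p by simp
      from arg_cong[OF this, of \<pi>] have "s = s'" using p ls by simp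
      moreover from this have "\<kappa> z = \<kappa> z'" using e p ls by (simp add: G.right_cancel)
      ultimately show "x = y" using \<kappa>_inj p by (auto dest: inj_onD)
    qed simp
  next
    fix x assume "x \<in> carrier Z \<times> A"
    then show "(case x of (z, s) \<Rightarrow> \<kappa> z \<otimes>\<^bsub>G\<^esub> l s) \<in> {y \<in> carrier G. \<pi> y \<in> A}"
      using l assms by (auto simp: subset_iff)
  next
    fix y assume "y \<in> {y \<in> carrier G. \<pi> y \<in> A}"
    then have y: "y \<in> carrier G" "\<pi> y \<in> A" by auto
    let ?l = "l (\<pi> y)"
    have lc: "?l \<in> carrier G" "\<pi> ?l = \<pi> y" using l y by auto
    then have "y \<otimes>\<^bsub>G\<^esub> inv\<^bsub>G\<^esub> ?l \<in> carrier G" "\<pi> (y \<otimes>\<^bsub>G\<^esub> inv\<^bsub>G\<^esub> ?l) = \<one>\<^bsub>S\<^esub>" using y by auto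
    then obtain z where "z \<in> carrier Z" "y \<otimes>\<^bsub>G\<^esub> inv\<^bsub>G\<^esub> ?l = \<kappa> z" by (rule kernelE)
    moreover from this have "y = \<kappa> z \<otimes>\<^bsub>G\<^esub> ?l" using y lc by (metis G.inv_solve_right' \<kappa>.hom_closed)
    ultimately show "\<exists>x\<in>carrier Z \<times> A. y = (case x of (z, s) \<Rightarrow> \<kappa> z \<otimes>\<^bsub>G\<^esub> l s)"
      using y by (intro bexI[of _ "(z, \<pi> y)"]) auto
  qed
  from bij_betw_same_card[OF this] show ?thesis by (simp add: card_cartesian_product)
qed

text \<open>
  A product over coset representatives of the preimage of a Sylow subgroup of the stabiliser,
  as in the transfer homomorphism, restricts to \<open>\<phi>\<^sup>m\<close> on the kernel with \<open>m\<close> prime to \<open>p\<close>; a suitable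
  power of it restricts to \<open>\<phi>\<close>.
\<close>
lemma exists_cocycle_orbit:
  assumes p: "prime p" and \<Lambda>p: "\<And>\<phi> z. \<phi> \<in> \<Lambda> \<Longrightarrow> z \<in> carrier Z \<Longrightarrow> \<phi> z ^ p = 1"
    and \<phi>0: "\<phi>0 \<in> \<Lambda>"
    and ext: "\<And>P k. subgroup P S \<Longrightarrow> card P = p ^ k \<Longrightarrow> (\<And>s. s \<in> P \<Longrightarrow> tw \<phi>0 s = \<phi>0) \<Longrightarrow>
       \<exists>\<chi> :: 'g \<Rightarrow> complex. (\<forall>y\<in>{y \<in> carrier G. \<pi> y \<in> P}. \<forall>y'\<in>{y \<in> carrier G. \<pi> y \<in> P}. \<chi> (y \<otimes>\<^bsub>G\<^esub> y') = \<chi> y * \<chi> y') \<and>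
         (\<forall>z\<in>carrier Z. \<chi> (\<kappa> z) = \<phi>0 z)"
  shows "\<exists>\<mu>. \<forall>\<phi>\<in>tw \<phi>0 ` carrier S. (\<forall>y\<in>carrier G. \<forall>y'\<in>carrier G. \<mu> \<phi> (y \<otimes>\<^bsub>G\<^esub> y') = \<mu> \<phi> y * \<mu> (tw \<phi> (\<pi> y)) y')
     \<and> (\<forall>z\<in>carrier Z. \<mu> \<phi> (\<kappa> z) = (\<phi> z :: complex))"
proof -
  let ?\<Gamma> = "{s \<in> carrier S. tw \<phi>0 s = \<phi>0}"
  have \<Gamma>: "subgroup ?\<Gamma> S" by (rule stabilizer_subgroup[OF \<phi>0])
  have fin\<Gamma>: "finite ?\<Gamma>" using finite_S by simp
  have "card ?\<Gamma> \<noteq> 0" using fin\<Gamma> subgroup.one_closed[OF \<Gamma>] by auto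
  moreover have "\<exists>a m. c = p ^ a * m \<and> \<not> p dvd m" if "c \<noteq> 0" for c
    using multiplicity_decompose'[OF that, of p] not_prime_unit p by blast
  ultimately obtain a m where m: "card ?\<Gamma> = p ^ a * m" "\<not> p dvd m" by blast
  have "group (S\<lparr>carrier := ?\<Gamma>\<rparr>)" by (rule subgroup.subgroup_is_group[OF \<Gamma> S.group_axioms])
  from sylow_thm[OF p this, of a m] obtain P where P0: "subgroup P (S\<lparr>carrier := ?\<Gamma>\<rparr>)" and cP: "card P = p ^ a"
    using m fin\<Gamma> by (auto simp: order_def)
  have P: "subgroup P S" by (rule S.incl_subgroup[OF \<Gamma> P0])
  have Pst: "tw \<phi>0 s = \<phi>0" "s \<in> carrier S" if "s \<in> P" for s
    using subgroup.subset[OF P0] that by auto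
  define Q where "Q = {y \<in> carrier G. \<pi> y \<in> P}"
  obtain \<chi> :: "'g \<Rightarrow> complex" where \<chi>: "\<And>y y'. y \<in> Q \<Longrightarrow> y' \<in> Q \<Longrightarrow> \<chi> (y \<otimes>\<^bsub>G\<^esub> y') = \<chi> y * \<chi> y'"
    "\<And>z. z \<in> carrier Z \<Longrightarrow> \<chi> (\<kappa> z) = \<phi>0 z"
    using ext[OF P cP Pst(1)] unfolding Q_def by blast
  have Q: "subgroup Q G"
  proof (rule G.subgroupI)
    show "Q \<noteq> {}" using subgroup.one_closed[OF P] by (auto simp: Q_def intro!: exI[of _ "\<one>\<^bsub>G\<^esub>"])
  qed (use subgroup.m_closed[OF P] subgroup.m_inv_closed[OF P] in \<open>auto simp: Q_def\<close>)
  have KQ: "\<kappa> z \<in> Q" if "z \<in> carrier Z" for z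
    using that subgroup.one_closed[OF P] by (simp add: Q_def)
  \<comment> \<open>The representative is chosen from the coset as a set, so it depends on the coset
    alone; this gives \<open>tq\<close>.\<close>
  define t where "t y = (SOME x. x \<in> Q #>\<^bsub>G\<^esub> y)" for y
  have "t y \<in> Q #>\<^bsub>G\<^esub> y" if "y \<in> carrier G" for y
    unfolding t_def by (rule someI[of _ y]) (rule G.rcos_self[OF that Q])
  then have t: "\<exists>q\<in>Q. t y = q \<otimes>\<^bsub>G\<^esub> y" if "y \<in> carrier G" for y
    using that by (fastforce simp: r_coset_def)
  have Qc: "q \<in> carrier G" if "q \<in> Q" for q using that by (simp add: Q_def)
  have tc: "t y \<in> carrier G" if "y \<in> carrier G" for y using t[OF that] that Qc by auto
  have tq: "t (q \<otimes>\<^bsub>G\<^esub> y) = t y" if "q \<in> Q" "y \<in> carrier G" for q y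
  proof -
    have "Q #>\<^bsub>G\<^esub> (q \<otimes>\<^bsub>G\<^esub> y) = Q #>\<^bsub>G\<^esub> y"
      using G.coset_mult_assoc[of Q q y] G.coset_join2[OF _ Q, of q] that Qc subgroup.subset[OF Q] by simp
    then show ?thesis by (simp add: t_def)
  qed
  have tQ: "y \<otimes>\<^bsub>G\<^esub> inv\<^bsub>G\<^esub> (t y) \<in> Q" if "y \<in> carrier G" for y
  proof -
    obtain q where q: "q \<in> Q" "t y = q \<otimes>\<^bsub>G\<^esub> y" using t[OF \<open>y \<in> carrier G\<close>] by blast
    have "y \<otimes>\<^bsub>G\<^esub> inv\<^bsub>G\<^esub> (t y) = inv\<^bsub>G\<^esub> q"
      using q Qc that by (simp add: G.inv_mult_group flip: G.m_assoc)
    then show ?thesis using subgroup.m_inv_closed[OF Q q(1)] by simp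
  qed
  define R where "R = t ` carrier G"
  have Rc: "r \<in> carrier G" "t r = r" if "r \<in> R" for r
  proof -
    obtain y where y: "y \<in> carrier G" "r = t y" using \<open>r \<in> R\<close> by (auto simp: R_def)
    then show "r \<in> carrier G" using tc by simp
    obtain q where "q \<in> Q" "t y = q \<otimes>\<^bsub>G\<^esub> y" using t[OF y(1)] by blast
    then show "t r = r" using tq[of q y] y by simp
  qed
  have tR: "t y \<in> R" if "y \<in> carrier G" for y using that by (simp add: R_def)
  define R\<^sub>l where "R\<^sub>l \<phi> = {r \<in> R. tw \<phi>0 (\<pi> r) = \<phi>}" for \<phi>
  have finR: "finite (R\<^sub>l \<phi>)" for \<phi> using finite_G by (simp add: R\<^sub>l_def R_def)
  \<comment> \<open>\<open>F r y\<close> is the value of \<open>\<chi>\<close> at the element of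
    \<open>Q\<close> by which the product of \<open>r\<close> and \<open>y\<close> differs from its
    representative. Right multiplication by \<open>y\<close> maps \<open>R\<^sub>l \<phi>\<close> to
    the set for the twisted character, so the product over \<open>r\<close> satisfies the cocycle
    relation.\<close>
  define F where "F r y = \<chi> (r \<otimes>\<^bsub>G\<^esub> y \<otimes>\<^bsub>G\<^esub> inv\<^bsub>G\<^esub> (t (r \<otimes>\<^bsub>G\<^esub> y)))" for r y
  have tt: "t (t y \<otimes>\<^bsub>G\<^esub> y') = t (y \<otimes>\<^bsub>G\<^esub> y')" if y: "y \<in> carrier G" "y' \<in> carrier G" for y y'
  proof -
    obtain q where q: "q \<in> Q" "t y = q \<otimes>\<^bsub>G\<^esub> y" using t[OF y(1)] by blast
    then have "t y \<otimes>\<^bsub>G\<^esub> y' = q \<otimes>\<^bsub>G\<^esub> (y \<otimes>\<^bsub>G\<^esub> y')" using y Qc by (simp add: G.m_assoc)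
    then show ?thesis using tq q y by simp
  qed
  have F: "F r (y \<otimes>\<^bsub>G\<^esub> y') = F r y * F (t (r \<otimes>\<^bsub>G\<^esub> y)) y'"
    if r: "r \<in> carrier G" and y: "y \<in> carrier G" "y' \<in> carrier G" for r y y'
  proof -
    let ?u = "t (r \<otimes>\<^bsub>G\<^esub> y)" and ?w = "t (r \<otimes>\<^bsub>G\<^esub> y \<otimes>\<^bsub>G\<^esub> y')"
    have c: "?u \<in> carrier G" "?w \<in> carrier G" using r y tc by auto
    have w: "t (?u \<otimes>\<^bsub>G\<^esub> y') = ?w" using tt[of "r \<otimes>\<^bsub>G\<^esub> y" y'] r y by simp
    have "r \<otimes>\<^bsub>G\<^esub> (y \<otimes>\<^bsub>G\<^esub> y') \<otimes>\<^bsub>G\<^esub> inv\<^bsub>G\<^esub> ?w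
      = (r \<otimes>\<^bsub>G\<^esub> y \<otimes>\<^bsub>G\<^esub> inv\<^bsub>G\<^esub> ?u) \<otimes>\<^bsub>G\<^esub> (?u \<otimes>\<^bsub>G\<^esub> y' \<otimes>\<^bsub>G\<^esub> inv\<^bsub>G\<^esub> ?w)"
    proof -
      have "(r \<otimes>\<^bsub>G\<^esub> y \<otimes>\<^bsub>G\<^esub> inv\<^bsub>G\<^esub> ?u) \<otimes>\<^bsub>G\<^esub> (?u \<otimes>\<^bsub>G\<^esub> y' \<otimes>\<^bsub>G\<^esub> inv\<^bsub>G\<^esub> ?w)
        = r \<otimes>\<^bsub>G\<^esub> y \<otimes>\<^bsub>G\<^esub> (inv\<^bsub>G\<^esub> ?u \<otimes>\<^bsub>G\<^esub> ?u) \<otimes>\<^bsub>G\<^esub> (y' \<otimes>\<^bsub>G\<^esub> inv\<^bsub>G\<^esub> ?w)"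
        using c r y by (simp only: G.m_assoc G.m_closed G.inv_closed)
      then show ?thesis using c r y by (simp add: G.m_assoc)
    qed
    moreover have "r \<otimes>\<^bsub>G\<^esub> y \<otimes>\<^bsub>G\<^esub> inv\<^bsub>G\<^esub> ?u \<in> Q" "?u \<otimes>\<^bsub>G\<^esub> y' \<otimes>\<^bsub>G\<^esub> inv\<^bsub>G\<^esub> ?w \<in> Q"
      using tQ[of "r \<otimes>\<^bsub>G\<^esub> y"] tQ[of "?u \<otimes>\<^bsub>G\<^esub> y'"] w c r y by auto
    ultimately show ?thesis using \<chi>(1) w r y by (simp add: F_def G.m_assoc)
  qed
  have \<pi>t: "tw \<phi>0 (\<pi> (t y)) = tw \<phi>0 (\<pi> y)" if y: "y \<in> carrier G" for y
  proof -
    obtain q where q: "q \<in> Q" "t y = q \<otimes>\<^bsub>G\<^esub> y" using t[OF y] by blast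
    then have "\<pi> q \<in> P" by (simp add: Q_def)
    then show ?thesis using q y Qc Pst by (simp add: tw_mult)
  qed
  have shift: "bij_betw (\<lambda>r. t (r \<otimes>\<^bsub>G\<^esub> y)) (R\<^sub>l \<phi>) (R\<^sub>l (tw \<phi> (\<pi> y)))" if y: "y \<in> carrier G" and \<phi>: "\<phi> \<in> \<Lambda>" for y \<phi>
  proof (rule bij_betw_byWitness[where f' = "\<lambda>r. t (r \<otimes>\<^bsub>G\<^esub> inv\<^bsub>G\<^esub> y)"])
    have inverse: "t (t (r \<otimes>\<^bsub>G\<^esub> x) \<otimes>\<^bsub>G\<^esub> x') = r" if "r \<in> R" "x \<in> carrier G" "x' \<in> carrier G" "x \<otimes>\<^bsub>G\<^esub> x' = \<one>\<^bsub>G\<^esub>" for r x x'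
      using tt[of "r \<otimes>\<^bsub>G\<^esub> x" x'] Rc[OF that(1)] that by (simp add: G.m_assoc)
    show "\<forall>r\<in>R\<^sub>l \<phi>. t (t (r \<otimes>\<^bsub>G\<^esub> y) \<otimes>\<^bsub>G\<^esub> inv\<^bsub>G\<^esub> y) = r"
      "\<forall>r\<in>R\<^sub>l (tw \<phi> (\<pi> y)). t (t (r \<otimes>\<^bsub>G\<^esub> inv\<^bsub>G\<^esub> y) \<otimes>\<^bsub>G\<^esub> y) = r"
      using inverse y by (auto simp: R\<^sub>l_def)
    have fwd: "t (r \<otimes>\<^bsub>G\<^esub> x) \<in> R\<^sub>l (tw \<nu> (\<pi> x))" if "r \<in> R\<^sub>l \<nu>" "x \<in> carrier G" for r x \<nu>
      using that Rc by (auto simp: R\<^sub>l_def tR \<pi>t tw_mult)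
    show "(\<lambda>r. t (r \<otimes>\<^bsub>G\<^esub> y)) ` R\<^sub>l \<phi> \<subseteq> R\<^sub>l (tw \<phi> (\<pi> y))" using fwd y by auto
    have "tw (tw \<phi> (\<pi> y)) (\<pi> (inv\<^bsub>G\<^esub> y)) = \<phi>"
      using y tw_one[OF \<phi>] by (simp add: tw_mult[symmetric])
    then show "(\<lambda>r. t (r \<otimes>\<^bsub>G\<^esub> inv\<^bsub>G\<^esub> y)) ` R\<^sub>l (tw \<phi> (\<pi> y)) \<subseteq> R\<^sub>l \<phi>"
      using fwd[of _ "tw \<phi> (\<pi> y)" "inv\<^bsub>G\<^esub> y"] y by auto
  qed
  \<comment> \<open>\<open>R\<^sub>l \<phi>0\<close> represents the cosets of \<open>Q\<close> in
    the preimage of the stabiliser, and their number is the index \<open>m\<close> of the Sylow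
    subgroup.\<close>
  have card0: "card (R\<^sub>l \<phi>0) = m"
  proof -
    have "bij_betw (\<lambda>(q, r). q \<otimes>\<^bsub>G\<^esub> r) (Q \<times> R\<^sub>l \<phi>0) {y \<in> carrier G. \<pi> y \<in> ?\<Gamma>}"
    proof (rule bij_betw_byWitness[where f' = "\<lambda>y. (y \<otimes>\<^bsub>G\<^esub> inv\<^bsub>G\<^esub> (t y), t y)"])
      show "\<forall>a\<in>Q \<times> R\<^sub>l \<phi>0. ((case a of (q, r) \<Rightarrow> q \<otimes>\<^bsub>G\<^esub> r) \<otimes>\<^bsub>G\<^esub> inv\<^bsub>G\<^esub> (t (case a of (q, r) \<Rightarrow> q \<otimes>\<^bsub>G\<^esub> r)),
         t (case a of (q, r) \<Rightarrow> q \<otimes>\<^bsub>G\<^esub> r)) = a"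
        using Rc Qc by (auto simp: R\<^sub>l_def tq G.m_assoc)
      show "\<forall>y\<in>{y \<in> carrier G. \<pi> y \<in> ?\<Gamma>}. (case (y \<otimes>\<^bsub>G\<^esub> inv\<^bsub>G\<^esub> (t y), t y) of (q, r) \<Rightarrow> q \<otimes>\<^bsub>G\<^esub> r) = y"
        using tc by (auto simp: G.m_assoc)
      show "(\<lambda>(q, r). q \<otimes>\<^bsub>G\<^esub> r) ` (Q \<times> R\<^sub>l \<phi>0) \<subseteq> {y \<in> carrier G. \<pi> y \<in> ?\<Gamma>}"
      proof (rule image_subsetI)
        fix x assume "x \<in> Q \<times> R\<^sub>l \<phi>0"
        then obtain q r where qr: "x = (q, r)" "q \<in> Q" "r \<in> R\<^sub>l \<phi>0" by blast
        then have c: "q \<in> carrier G" "r \<in> carrier G" "\<pi> q \<in> P" "tw \<phi>0 (\<pi> r) = \<phi>0"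
          using Rc(1) by (auto simp: R\<^sub>l_def Q_def)
        then have "tw \<phi>0 (\<pi> (q \<otimes>\<^bsub>G\<^esub> r)) = \<phi>0"
          using tw_mult[of "\<pi> q" "\<pi> r" \<phi>0] Pst(1)[OF c(3)] by simp
        then show "(case x of (q, r) \<Rightarrow> q \<otimes>\<^bsub>G\<^esub> r) \<in> {y \<in> carrier G. \<pi> y \<in> ?\<Gamma>}"
          using c by (simp add: qr(1))
      qed
      show "(\<lambda>y. (y \<otimes>\<^bsub>G\<^esub> inv\<^bsub>G\<^esub> (t y), t y)) ` {y \<in> carrier G. \<pi> y \<in> ?\<Gamma>} \<subseteq> Q \<times> R\<^sub>l \<phi>0"
      proof (rule image_subsetI)
        fix y assume "y \<in> {y \<in> carrier G. \<pi> y \<in> ?\<Gamma>}"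
        then show "(y \<otimes>\<^bsub>G\<^esub> inv\<^bsub>G\<^esub> (t y), t y) \<in> Q \<times> R\<^sub>l \<phi>0"
          using tQ tR \<pi>t by (simp add: R\<^sub>l_def)
      qed
    qed
    from bij_betw_same_card[OF this] have "card Q * card (R\<^sub>l \<phi>0) = card (carrier Z) * card ?\<Gamma>"
      using card_preimage[of ?\<Gamma>] by (simp add: card_cartesian_product)
    moreover have "card Q = card (carrier Z) * p ^ a"
      unfolding Q_def using card_preimage[of P] subgroup.subset[OF P] cP by simp
    moreover have "card (carrier Z) \<noteq> 0" using finite_Z Z.one_closed by auto
    ultimately show ?thesis using m(1) prime_gt_0_nat[OF p] by simp
  qed
  \<comment> \<open>\<open>u\<close> inverts \<open>m\<close> modulo \<open>p\<close>; as characters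
    have order dividing \<open>p\<close>, the power \<open>u\<close> undoes the exponent
    \<open>m\<close>.\<close>
  obtain u l where ul: "m * u = p * l + 1"
  proof -
    have "m \<noteq> 0" using m(2) by (metis dvd_0_right)
    from bezout_nat[OF this, of p] obtain x y where "m * x = p * y + gcd m p" by blast
    moreover have "gcd m p = 1"
      using p m(2) by (metis coprime_commute coprime_imp_gcd_eq_1 prime_imp_coprime)
    ultimately show thesis using that by simp
  qed
  define \<mu> where "\<mu> \<phi> y = (\<Prod>r\<in>R\<^sub>l \<phi>. F r y) ^ u" for \<phi> y
  show ?thesis
  proof (intro exI[of _ \<mu>] ballI conjI)
    fix \<phi> assume "\<phi> \<in> tw \<phi>0 ` carrier S"
    then obtain s where s: "s \<in> carrier S" "\<phi> = tw \<phi>0 s" by blast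
    then have \<phi>: "\<phi> \<in> \<Lambda>" using tw_in \<phi>0 by simp
    {
      fix y y' assume y: "y \<in> carrier G" "y' \<in> carrier G"
      have "(\<Prod>r\<in>R\<^sub>l \<phi>. F r (y \<otimes>\<^bsub>G\<^esub> y')) = (\<Prod>r\<in>R\<^sub>l \<phi>. F r y * F (t (r \<otimes>\<^bsub>G\<^esub> y)) y')"
        using y Rc by (intro prod.cong F) (auto simp: R\<^sub>l_def)
      also have "\<dots> = (\<Prod>r\<in>R\<^sub>l \<phi>. F r y) * (\<Prod>r\<in>R\<^sub>l \<phi>. F (t (r \<otimes>\<^bsub>G\<^esub> y)) y')"
        by (rule prod.distrib)
      also have "(\<Prod>r\<in>R\<^sub>l \<phi>. F (t (r \<otimes>\<^bsub>G\<^esub> y)) y') = (\<Prod>r\<in>R\<^sub>l (tw \<phi> (\<pi> y)). F r y')"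
        by (rule prod.reindex_bij_betw[OF shift[OF y(1) \<phi>], of "\<lambda>r. F r y'"])
      finally show "\<mu> \<phi> (y \<otimes>\<^bsub>G\<^esub> y') = \<mu> \<phi> y * \<mu> (tw \<phi> (\<pi> y)) y'"
        by (simp add: \<mu>_def power_mult_distrib)
    }
    fix z assume z: "z \<in> carrier Z"
    have "F r (\<kappa> z) = \<phi> z" if "r \<in> R\<^sub>l \<phi>" for r
    proof -
      have r: "r \<in> carrier G" "t r = r" "tw \<phi>0 (\<pi> r) = \<phi>" using that Rc by (auto simp: R\<^sub>l_def)
      have c: "act (\<pi> r) z \<in> carrier Z" using act_closed r z by simp
      have "t (r \<otimes>\<^bsub>G\<^esub> \<kappa> z) = r" using conj[OF r(1) z] tq[OF KQ[OF c] r(1)] r by simp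
      then have "F r (\<kappa> z) = \<chi> (\<kappa> (act (\<pi> r) z))"
        using conj[OF r(1) z] r c by (simp add: F_def G.m_assoc)
      also have "\<dots> = \<phi> z" using \<chi>(2)[OF c] tw_apply[OF z, of \<phi>0 "\<pi> r"] r by simp
      finally show ?thesis .
    qed
    then have "\<mu> \<phi> (\<kappa> z) = (\<phi> z ^ card (R\<^sub>l \<phi>)) ^ u" by (simp add: \<mu>_def)
    also have "card (R\<^sub>l \<phi>) = m"
    proof -
      obtain y where y: "y \<in> carrier G" "\<pi> y = s" using liftE s by blast
      show ?thesis using bij_betw_same_card[OF shift[OF y(1) \<phi>0]] y s card0 by simp
    qed
    also have "(\<phi> z ^ m) ^ u = (\<phi> z ^ p) ^ l * \<phi> z" by (simp add: ul power_add flip: power_mult)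
    finally show "\<mu> \<phi> (\<kappa> z) = \<phi> z" using \<Lambda>p[OF \<phi> z] by simp
  qed
qed

text \<open>The cocycle relation links only characters of one orbit, so solutions on single orbits
  can be combined. They are indexed by \<open>rep \<phi>\<close>, which is chosen from the orbit as
  a set and hence does not change under \<open>tw\<close>.\<close>

theorem exists_cocycle:
  assumes p: "prime p" and \<Lambda>p: "\<And>\<phi> z. \<phi> \<in> \<Lambda> \<Longrightarrow> z \<in> carrier Z \<Longrightarrow> \<phi> z ^ p = 1"
    and ext: "\<And>\<phi> P k. \<phi> \<in> \<Lambda> \<Longrightarrow> subgroup P S \<Longrightarrow> card P = p ^ k \<Longrightarrow> (\<And>s. s \<in> P \<Longrightarrow> tw \<phi> s = \<phi>) \<Longrightarrow>
       \<exists>\<chi> :: 'g \<Rightarrow> complex. (\<forall>y\<in>{y \<in> carrier G. \<pi> y \<in> P}. \<forall>y'\<in>{y \<in> carrier G. \<pi> y \<in> P}. \<chi> (y \<otimes>\<^bsub>G\<^esub> y') = \<chi> y * \<chi> y') \<and>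
         (\<forall>z\<in>carrier Z. \<chi> (\<kappa> z) = \<phi> z)"
  shows "\<exists>\<mu>. \<forall>\<phi>\<in>\<Lambda>. (\<forall>y\<in>carrier G. \<forall>y'\<in>carrier G. \<mu> \<phi> (y \<otimes>\<^bsub>G\<^esub> y') = \<mu> \<phi> y * \<mu> (tw \<phi> (\<pi> y)) y')
     \<and> (\<forall>z\<in>carrier Z. \<mu> \<phi> (\<kappa> z) = (\<phi> z :: complex))"
proof -
  let ?Q = "\<lambda>\<phi>0 \<mu>. \<forall>\<phi>\<in>tw \<phi>0 ` carrier S. (\<forall>y\<in>carrier G. \<forall>y'\<in>carrier G. \<mu> \<phi> (y \<otimes>\<^bsub>G\<^esub> y') = \<mu> \<phi> y * \<mu> (tw \<phi> (\<pi> y)) y')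
     \<and> (\<forall>z\<in>carrier Z. \<mu> \<phi> (\<kappa> z) = (\<phi> z :: complex))"
  have "\<forall>\<phi>0. \<exists>\<mu>. \<phi>0 \<in> \<Lambda> \<longrightarrow> ?Q \<phi>0 \<mu>"
  proof
    fix \<phi>0 show "\<exists>\<mu>. \<phi>0 \<in> \<Lambda> \<longrightarrow> ?Q \<phi>0 \<mu>"
    proof (cases "\<phi>0 \<in> \<Lambda>")
      case True
      have "\<exists>\<mu>. ?Q \<phi>0 \<mu>"
        by (rule exists_cocycle_orbit[OF p _ True]) (fact \<Lambda>p, rule ext[OF True])
      then show ?thesis by blast
    qed simp
  qed
  from choice[OF this] obtain \<mu>' where \<mu>': "\<And>\<phi>0. \<phi>0 \<in> \<Lambda> \<Longrightarrow> ?Q \<phi>0 (\<mu>' \<phi>0)" by blast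
  define rep where "rep \<phi> = (SOME \<nu>. \<nu> \<in> tw \<phi> ` carrier S)" for \<phi>
  have orb: "tw (tw \<phi> s) ` carrier S = tw \<phi> ` carrier S" if s: "s \<in> carrier S" for \<phi> s
  proof -
    have "(\<lambda>x. s \<otimes>\<^bsub>S\<^esub> x) ` carrier S = carrier S" using S.surj_const_mult[OF s] .
    then have "tw \<phi> ` carrier S = (\<lambda>x. tw \<phi> (s \<otimes>\<^bsub>S\<^esub> x)) ` carrier S"
      by (metis image_image)
    also have "\<dots> = tw (tw \<phi> s) ` carrier S" using s by (intro image_cong) (simp_all add: tw_mult)
    finally show ?thesis ..
  qed
  have rep: "rep \<phi> \<in> \<Lambda>" "\<phi> \<in> tw (rep \<phi>) ` carrier S" if \<phi>: "\<phi> \<in> \<Lambda>" for \<phi>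
  proof -
    have "rep \<phi> \<in> tw \<phi> ` carrier S" unfolding rep_def by (rule someI[of _ "tw \<phi> \<one>\<^bsub>S\<^esub>"]) simp
    then obtain s where s: "s \<in> carrier S" "rep \<phi> = tw \<phi> s" by blast
    then show "rep \<phi> \<in> \<Lambda>" using tw_in \<phi> by simp
    have "\<phi> \<in> tw \<phi> ` carrier S" using tw_one[OF \<phi>] by (metis S.one_closed image_eqI)
    then show "\<phi> \<in> tw (rep \<phi>) ` carrier S" using orb[OF s(1)] s(2) by simp
  qed
  have rep_tw: "rep (tw \<phi> s) = rep \<phi>" if "s \<in> carrier S" for \<phi> s
    by (simp add: rep_def orb[OF that])
  show ?thesis
  proof (intro exI[of _ "\<lambda>\<phi>. \<mu>' (rep \<phi>) \<phi>"] ballI)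
    fix \<phi> assume "\<phi> \<in> \<Lambda>"
    from bspec[OF \<mu>'[OF rep(1)[OF this]] rep(2)[OF this]]
    show "(\<forall>y\<in>carrier G. \<forall>y'\<in>carrier G. \<mu>' (rep \<phi>) \<phi> (y \<otimes>\<^bsub>G\<^esub> y') =
        \<mu>' (rep \<phi>) \<phi> y * \<mu>' (rep (tw \<phi> (\<pi> y))) (tw \<phi> (\<pi> y)) y') \<and>
        (\<forall>z\<in>carrier Z. \<mu>' (rep \<phi>) \<phi> (\<kappa> z) = \<phi> z)"
      by (simp add: rep_tw)
  qed
qed

end

section \<open>Transferring representations\<close>

text \<open>The dimension is a parameter because an empty sum must be the zero matrix of that
  size.\<close>

definition msum :: "nat \<Rightarrow> 'i set \<Rightarrow> ('i \<Rightarrow> complex mat) \<Rightarrow> complex mat" where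
  "msum d A f = mat d d (\<lambda>ij. \<Sum>x\<in>A. f x $$ ij)"

lemma msum_carrier [simp]: "msum d A f \<in> carrier_mat d d"
  by (simp add: msum_def)

lemma msum_index: "i < d \<Longrightarrow> j < d \<Longrightarrow> msum d A f $$ (i, j) = (\<Sum>x\<in>A. f x $$ (i, j))"
  by (simp add: msum_def)

lemma msum_cong: "(\<And>x. x \<in> A \<Longrightarrow> f x = g x) \<Longrightarrow> msum d A f = msum d A g"
  by (auto simp: msum_def intro!: eq_matI sum.cong)

lemma msum_mult_left:
  assumes B: "B \<in> carrier_mat d d" and f: "\<And>x. x \<in> A \<Longrightarrow> f x \<in> carrier_mat d d"
  shows "B * msum d A f = msum d A (\<lambda>x. B * f x)"
proof (rule eq_matI)
  fix i j assume "i < dim_row (msum d A (\<lambda>x. B * f x))" "j < dim_col (msum d A (\<lambda>x. B * f x))"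
  then have ij: "i < d" "j < d" by (auto simp: msum_def)
  have "(B * msum d A f) $$ (i, j) = (\<Sum>l<d. B $$ (i, l) * (\<Sum>x\<in>A. f x $$ (l, j)))"
    unfolding index_mat_mult[OF B msum_carrier ij] using ij by (simp add: msum_index)
  also have "\<dots> = (\<Sum>x\<in>A. \<Sum>l<d. B $$ (i, l) * f x $$ (l, j))"
    by (simp add: sum_distrib_left) (rule sum.swap)
  also have "\<dots> = (\<Sum>x\<in>A. (B * f x) $$ (i, j))"
    by (intro sum.cong refl index_mat_mult[OF B f ij, symmetric])
  finally show "(B * msum d A f) $$ (i, j) = msum d A (\<lambda>x. B * f x) $$ (i, j)"
    using ij by (simp only: msum_index)
qed (use B in \<open>auto simp: msum_def\<close>)

lemma msum_mult_right:
  assumes B: "B \<in> carrier_mat d d" and f: "\<And>x. x \<in> A \<Longrightarrow> f x \<in> carrier_mat d d"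
  shows "msum d A f * B = msum d A (\<lambda>x. f x * B)"
proof (rule eq_matI)
  fix i j assume "i < dim_row (msum d A (\<lambda>x. f x * B))" "j < dim_col (msum d A (\<lambda>x. f x * B))"
  then have ij: "i < d" "j < d" by (auto simp: msum_def)
  have "(msum d A f * B) $$ (i, j) = (\<Sum>l<d. (\<Sum>x\<in>A. f x $$ (i, l)) * B $$ (l, j))"
    unfolding index_mat_mult[OF msum_carrier B ij] using ij by (simp add: msum_index)
  also have "\<dots> = (\<Sum>x\<in>A. \<Sum>l<d. f x $$ (i, l) * B $$ (l, j))"
    by (simp add: sum_distrib_right) (rule sum.swap)
  also have "\<dots> = (\<Sum>x\<in>A. (f x * B) $$ (i, j))"
    by (intro sum.cong refl index_mat_mult[OF f B ij, symmetric])
  finally show "(msum d A f * B) $$ (i, j) = msum d A (\<lambda>x. f x * B) $$ (i, j)"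
    using ij by (simp only: msum_index)
qed (use B in \<open>auto simp: msum_def\<close>)

lemma msum_smult:
  assumes "\<And>x. x \<in> A \<Longrightarrow> f x \<in> carrier_mat d d"
  shows "c \<cdot>\<^sub>m msum d A f = msum d A (\<lambda>x. c \<cdot>\<^sub>m f x)"
proof (rule eq_matI)
  fix i j assume "i < dim_row (msum d A (\<lambda>x. c \<cdot>\<^sub>m f x))" "j < dim_col (msum d A (\<lambda>x. c \<cdot>\<^sub>m f x))"
  then have ij: "i < d" "j < d" by (auto simp: msum_def)
  have "(c \<cdot>\<^sub>m f x) $$ (i, j) = c * f x $$ (i, j)" if "x \<in> A" for x
    using assms[OF that] ij by simp
  then show "(c \<cdot>\<^sub>m msum d A f) $$ (i, j) = msum d A (\<lambda>x. c \<cdot>\<^sub>m f x) $$ (i, j)"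
    using ij by (simp add: msum_def sum_distrib_left)
qed (auto simp: msum_def)

lemma msum_swap: "msum d A (\<lambda>x. msum d B (f x)) = msum d B (\<lambda>y. msum d A (\<lambda>x. f x y))"
  by (rule eq_matI) (auto simp: msum_def intro: sum.swap)

lemma msum_scalar:
  assumes "M \<in> carrier_mat d d"
  shows "msum d A (\<lambda>x. c x \<cdot>\<^sub>m M) = (\<Sum>x\<in>A. c x) \<cdot>\<^sub>m M"
  using assms by (intro eq_matI) (auto simp: msum_def sum_distrib_right)

lemma smult_smult_mat: "a \<cdot>\<^sub>m (b \<cdot>\<^sub>m M) = (a * b) \<cdot>\<^sub>m M" for M :: "'a::semigroup_mult mat"
  by (rule eq_matI) (auto simp: mult.assoc)

lemma zero_smult_mat: "M \<in> carrier_mat d d \<Longrightarrow> (0 :: complex) \<cdot>\<^sub>m M = 0\<^sub>m d d"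
  by (intro eq_matI) auto

lemma one_smult_mat: "(1 :: complex) \<cdot>\<^sub>m M = M"
  by (rule eq_matI) auto

lemma msum_delta:
  assumes "finite A" "a \<in> A" "M a \<in> carrier_mat d d"
  shows "msum d A (\<lambda>x. if x = a then M x else 0\<^sub>m d d) = M a"
proof (rule eq_matI)
  fix i j assume "i < dim_row (M a)" "j < dim_col (M a)"
  then have ij: "i < d" "j < d" using assms by auto
  have "(\<Sum>x\<in>A. (if x = a then M x else 0\<^sub>m d d) $$ (i, j)) = (\<Sum>x\<in>{a}. (if x = a then M x else 0\<^sub>m d d) $$ (i, j))"
    using assms ij by (intro sum.mono_neutral_right) auto
  then show "msum d A (\<lambda>x. if x = a then M x else 0\<^sub>m d d) $$ (i, j) = M a $$ (i, j)"
    using ij by (simp add: msum_def)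
qed (use assms in \<open>auto simp: msum_def\<close>)

lemma msum_reindex: "bij_betw h A B \<Longrightarrow> msum d A (\<lambda>x. f (h x)) = msum d B f"
  by (rule eq_matI) (auto simp: msum_def intro: sum.reindex_bij_betw)

lemma msum_mult_vec:
  assumes W: "VectorSpace.subspace class_ring W (module_vec TYPE(complex) d)"
    and A: "finite A" and w: "w \<in> W" and f: "\<And>x. x \<in> A \<Longrightarrow> f x \<in> carrier_mat d d" "\<And>x. x \<in> A \<Longrightarrow> f x *\<^sub>v w \<in> W"
  shows "msum d A f *\<^sub>v w \<in> W"
proof -
  interpret vec_space "TYPE(complex)" d .
  have sm: "submodule class_ring W (module_vec TYPE(complex) d)" using W by (simp add: subspace_def)
  have Wc: "W \<subseteq> carrier_vec d" using submodule.subset[OF sm] by (simp add: module_vec_simps)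
  then have wc: "w \<in> carrier_vec d" using w by blast
  show ?thesis using A f
  proof (induction A rule: finite_induct)
    case empty
    have "msum d {} f *\<^sub>v w = 0\<^sub>v d" using wc by (intro eq_vecI) (auto simp: msum_def scalar_prod_def)
    moreover have "0\<^sub>v d \<in> W" using submodule.zero_closed[OF sm] by (simp add: module_vec_simps)
    ultimately show ?case by simp
  next
    case (insert x A)
    have "msum d (insert x A) f = f x + msum d A f"
      using insert by (intro eq_matI) (auto simp: msum_def)
    then have "msum d (insert x A) f *\<^sub>v w = f x *\<^sub>v w + msum d A f *\<^sub>v w"
      using insert wc by (simp add: add_mult_distrib_mat_vec[of _ d d])
    then show ?case using submodule.m_closed[OF sm, of "f x *\<^sub>v w" "msum d A f *\<^sub>v w"] insert
      by (simp add: module_vec_simps)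
  qed
qed

lemma smult_mult_vec_in:
  assumes W: "VectorSpace.subspace class_ring W (module_vec TYPE(complex) d)"
    and w: "w \<in> W" and M: "M \<in> carrier_mat d d" "M *\<^sub>v w \<in> W"
  shows "(c \<cdot>\<^sub>m M) *\<^sub>v w \<in> W"
proof -
  have sm: "submodule class_ring W (module_vec TYPE(complex) d)" using W by (simp add: subspace_def)
  have Wc: "W \<subseteq> carrier_vec d" using submodule.subset[OF sm] by (simp add: module_vec_simps)
  have "(c \<cdot>\<^sub>m M) *\<^sub>v w = c \<cdot>\<^sub>v (M *\<^sub>v w)"
    using M w Wc by (intro eq_vecI) (auto simp: scalar_prod_def sum_distrib_left mult.assoc)
  then show ?thesis using submodule.smult_closed[OF sm, of c "M *\<^sub>v w"] M
    by (simp add: module_vec_simps class_ring_simps)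
qed

section \<open>Representations as families of matrices\<close>

definition is_rep :: "nat \<Rightarrow> 'g monoid \<Rightarrow> ('g \<Rightarrow> complex mat) \<Rightarrow> bool" where
  "is_rep d G \<rho> \<longleftrightarrow> (\<forall>y\<in>carrier G. \<rho> y \<in> carrier_mat d d) \<and> \<rho> \<one>\<^bsub>G\<^esub> = 1\<^sub>m d \<and>
     (\<forall>y\<in>carrier G. \<forall>y'\<in>carrier G. \<rho> (y \<otimes>\<^bsub>G\<^esub> y') = \<rho> y * \<rho> y')"

lemma GL_complex_iff:
  "A \<in> carrier (GL_complex d) \<longleftrightarrow>
     A \<in> carrier_mat d d \<and> (\<exists>B\<in>carrier_mat d d. B * A = 1\<^sub>m d \<and> A * B = 1\<^sub>m d)"
  by (auto simp: GL_complex_def units_of_def Units_def ring_mat_simps)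

lemma group_GL_complex: "group (GL_complex d)"
proof -
  interpret M: ring "ring_mat TYPE(complex) d ()" by (rule ring_mat)
  show ?thesis unfolding GL_complex_def by (rule M.units_group)
qed

lemma GL_complex_simps:
  "A \<otimes>\<^bsub>GL_complex d\<^esub> B = A * B" "\<one>\<^bsub>GL_complex d\<^esub> = 1\<^sub>m d"
  by (simp_all add: GL_complex_def units_of_mult units_of_one ring_mat_simps)

text \<open>Invertibility of \<open>\<rho> y\<close> is automatic, the inverse being the value at
  the inverse of \<open>y\<close>.\<close>

lemma reps_iff_is_rep:
  assumes "group G"
  shows "\<rho> \<in> reps d G \<longleftrightarrow> is_rep d G \<rho>"
proof
  interpret group G by fact
  assume \<rho>: "\<rho> \<in> reps d G"
  then have h: "\<rho> \<in> hom G (GL_complex d)" by (simp add: reps_def)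
  interpret h: group_hom G "GL_complex d" \<rho>
    by (intro group_hom.intro group_hom_axioms.intro assms group_GL_complex h)
  show "is_rep d G \<rho>"
    using h.hom_closed h.hom_mult h.hom_one by (auto simp: is_rep_def GL_complex_iff GL_complex_simps)
next
  interpret group G by fact
  assume \<rho>: "is_rep d G \<rho>"
  have "\<rho> y \<in> carrier (GL_complex d)" if "y \<in> carrier G" for y
  proof -
    let ?y' = "inv\<^bsub>G\<^esub> y"
    have y': "?y' \<in> carrier G" using that by simp
    have "\<rho> (?y' \<otimes>\<^bsub>G\<^esub> y) = \<rho> ?y' * \<rho> y" "\<rho> (y \<otimes>\<^bsub>G\<^esub> ?y') = \<rho> y * \<rho> ?y'"
      using \<rho> that y' unfolding is_rep_def by blast+
    then have "\<rho> ?y' * \<rho> y = 1\<^sub>m d" "\<rho> y * \<rho> ?y' = 1\<^sub>m d"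
      using \<rho> that by (simp_all add: is_rep_def)
    then show ?thesis using \<rho> that y' by (auto simp: GL_complex_iff is_rep_def)
  qed
  then show "\<rho> \<in> reps d G"
    using \<rho> by (auto simp: reps_def is_rep_def GL_complex_simps intro!: homI)
qed

text \<open>The further conditions on \<open>\<Lambda>\<close> make it the full character group of
  \<open>Z\<close>; \<open>\<mu>\<close> is a family of scalars as supplied by
  \<open>exists_cocycle\<close>.\<close>

locale rep_side = ext_data G S Z \<pi> \<kappa> act \<Lambda>
  for G :: "'g monoid" and S :: "'s monoid" and Z :: "'z monoid" and \<pi> \<kappa> act \<Lambda> +
  fixes \<mu> :: "('z \<Rightarrow> complex) \<Rightarrow> 'g \<Rightarrow> complex"
  assumes finite_\<Lambda>: "finite \<Lambda>"
    and \<Lambda>_times: "\<phi> \<in> \<Lambda> \<Longrightarrow> \<psi> \<in> \<Lambda> \<Longrightarrow> restrict (\<lambda>z. \<phi> z * \<psi> z) (carrier Z) \<in> \<Lambda>"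
    and \<Lambda>_inverse: "\<phi> \<in> \<Lambda> \<Longrightarrow> restrict (\<lambda>z. inverse (\<phi> z)) (carrier Z) \<in> \<Lambda>"
    and \<Lambda>_trivial: "restrict (\<lambda>z. 1) (carrier Z) \<in> \<Lambda>"
    and \<Lambda>_separates: "z \<in> carrier Z \<Longrightarrow> z \<noteq> \<one>\<^bsub>Z\<^esub> \<Longrightarrow> \<exists>\<phi>\<in>\<Lambda>. \<phi> z \<noteq> 1"
    and \<mu>_mult: "\<phi> \<in> \<Lambda> \<Longrightarrow> y \<in> carrier G \<Longrightarrow> y' \<in> carrier G \<Longrightarrow> \<mu> \<phi> (y \<otimes>\<^bsub>G\<^esub> y') = \<mu> \<phi> y * \<mu> (tw \<phi> (\<pi> y)) y'"
    and \<mu>_\<kappa>: "\<phi> \<in> \<Lambda> \<Longrightarrow> z \<in> carrier Z \<Longrightarrow> \<mu> \<phi> (\<kappa> z) = \<phi> z"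
begin

lemma \<Lambda>_nonzero: "\<phi> \<in> \<Lambda> \<Longrightarrow> z \<in> carrier Z \<Longrightarrow> \<phi> z \<noteq> 0"
  using \<Lambda>_mult[of \<phi> z "inv\<^bsub>Z\<^esub> z"] \<Lambda>_one[of \<phi>] by auto

lemma \<mu>_one: "\<phi> \<in> \<Lambda> \<Longrightarrow> \<mu> \<phi> \<one>\<^bsub>G\<^esub> = 1"
  using \<mu>_\<kappa>[of \<phi> "\<one>\<^bsub>Z\<^esub>"] \<Lambda>_one[of \<phi>] by simp

lemma \<mu>_nonzero: "\<phi> \<in> \<Lambda> \<Longrightarrow> y \<in> carrier G \<Longrightarrow> \<mu> \<phi> y \<noteq> 0"
  using \<mu>_mult[of \<phi> y "inv\<^bsub>G\<^esub> y"] \<mu>_one[of \<phi>] by auto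

section \<open>Orthogonality of characters and isotypic projections\<close>

lemma card_Z: "card (carrier Z) \<noteq> 0" using finite_Z Z.one_closed by auto

text \<open>Translation by \<open>w\<close> multiplies the sum by \<open>\<phi> w\<close>; if this
  is not 1, the sum vanishes.\<close>

lemma sum_character:
  assumes \<phi>: "\<phi> \<in> \<Lambda>"
  shows "(\<Sum>z\<in>carrier Z. \<phi> z) = (if \<phi> = restrict (\<lambda>z. 1) (carrier Z) then of_nat (card (carrier Z)) else 0)"
proof (cases "\<forall>z\<in>carrier Z. \<phi> z = 1")
  case True
  then have "\<phi> = restrict (\<lambda>z. 1) (carrier Z)" using \<Lambda>_ext[OF \<phi>] by (intro extensionalityI[of _ "carrier Z"]) auto
  then show ?thesis using True by simp
next
  case False
  then obtain w where w: "w \<in> carrier Z" "\<phi> w \<noteq> 1" by blast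
  have "(\<Sum>z\<in>carrier Z. \<phi> z) = (\<Sum>z\<in>carrier Z. \<phi> (w \<otimes>\<^bsub>Z\<^esub> z))"
    using Z.surj_const_mult[OF w(1)] Z.inj_on_cmult[OF w(1)]
    by (intro sum.reindex_bij_betw[symmetric]) (simp add: bij_betw_def)
  also have "\<dots> = \<phi> w * (\<Sum>z\<in>carrier Z. \<phi> z)"
    using w by (simp add: sum_distrib_left \<Lambda>_mult[OF \<phi>])
  finally have "(\<Sum>z\<in>carrier Z. \<phi> z) = 0" using w(2) by simp
  moreover have "\<phi> \<noteq> restrict (\<lambda>z. 1) (carrier Z)" using w by auto
  ultimately show ?thesis by simp
qed

text \<open>Multiplication by a character that is nontrivial at \<open>z\<close> permutes
  \<open>\<Lambda>\<close> and multiplies the sum by its value there.\<close>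

lemma sum_\<Lambda>:
  assumes z: "z \<in> carrier Z" "z \<noteq> \<one>\<^bsub>Z\<^esub>"
  shows "(\<Sum>\<phi>\<in>\<Lambda>. \<phi> z) = 0"
proof -
  obtain \<psi> where \<psi>: "\<psi> \<in> \<Lambda>" "\<psi> z \<noteq> 1" using \<Lambda>_separates z by blast
  let ?m = "\<lambda>\<phi>. restrict (\<lambda>z. \<psi> z * \<phi> z) (carrier Z)"
  have inj: "inj_on ?m \<Lambda>"
  proof (rule inj_onI)
    fix \<phi> \<phi>' assume f: "\<phi> \<in> \<Lambda>" "\<phi>' \<in> \<Lambda>" "?m \<phi> = ?m \<phi>'"
    have "\<phi> x = \<phi>' x" if "x \<in> carrier Z" for x
      using fun_cong[OF f(3), of x] that \<Lambda>_nonzero[OF \<psi>(1) that] by simp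
    then show "\<phi> = \<phi>'" using \<Lambda>_ext f by (intro extensionalityI[of _ "carrier Z"]) auto
  qed
  moreover have "?m ` \<Lambda> \<subseteq> \<Lambda>" using \<Lambda>_times[OF \<psi>(1)] by auto
  ultimately have "?m ` \<Lambda> = \<Lambda>" using finite_\<Lambda> by (intro endo_inj_surj)
  then have "(\<Sum>\<phi>\<in>\<Lambda>. \<phi> z) = (\<Sum>\<phi>\<in>\<Lambda>. ?m \<phi> z)"
    using sum.reindex[OF inj, of "\<lambda>\<phi>. \<phi> z"] by simp
  also have "\<dots> = \<psi> z * (\<Sum>\<phi>\<in>\<Lambda>. \<phi> z)" using z by (simp add: sum_distrib_left)
  finally show ?thesis using \<psi>(2) by (metis mult_cancel_right1)
qed

text \<open>The double sum of \<open>\<phi> z\<close> over \<open>\<Lambda>\<close> and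
  \<open>Z\<close> is evaluated by each of the two orthogonality relations.\<close>

lemma card_\<Lambda>: "card \<Lambda> = card (carrier Z)"
proof -
  have "(\<Sum>\<phi>\<in>\<Lambda>. \<Sum>z\<in>carrier Z. \<phi> z) = (\<Sum>\<phi>\<in>{restrict (\<lambda>z. 1) (carrier Z)}. of_nat (card (carrier Z)))"
    using finite_\<Lambda> \<Lambda>_trivial by (simp add: sum_character cong: sum.cong)
  moreover have "(\<Sum>\<phi>\<in>\<Lambda>. \<Sum>z\<in>carrier Z. \<phi> z) = (\<Sum>z\<in>carrier Z. \<Sum>\<phi>\<in>\<Lambda>. \<phi> z)" by (rule sum.swap)
  moreover have "\<dots> = (\<Sum>z\<in>{\<one>\<^bsub>Z\<^esub>}. \<Sum>\<phi>\<in>\<Lambda>. \<phi> z)"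
    using finite_Z sum_\<Lambda> by (intro sum.mono_neutral_right) auto
  moreover have "\<dots> = of_nat (card \<Lambda>)" by (simp add: \<Lambda>_one cong: sum.cong)
  ultimately have "(of_nat (card \<Lambda>) :: complex) = of_nat (card (carrier Z))" by simp
  then show ?thesis by (simp only: of_nat_eq_iff)
qed

text \<open>The projection onto the \<open>\<phi>\<close>-isotypic part of the restriction of
  \<open>\<rho>\<close> to \<open>Z\<close>.\<close>

definition proj :: "nat \<Rightarrow> ('g \<Rightarrow> complex mat) \<Rightarrow> ('z \<Rightarrow> complex) \<Rightarrow> complex mat" where
  "proj d \<rho> \<phi> = msum d (carrier Z) (\<lambda>z. (inverse (\<phi> z) / of_nat (card (carrier Z))) \<cdot>\<^sub>m \<rho> (\<kappa> z))"

lemma proj_carrier [simp]: "proj d \<rho> \<phi> \<in> carrier_mat d d" by (simp add: proj_def)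

context
  fixes d \<rho> assumes \<rho>: "is_rep d G \<rho>"
begin

lemma \<rho>_carrier: "y \<in> carrier G \<Longrightarrow> \<rho> y \<in> carrier_mat d d" using \<rho> by (simp add: is_rep_def)
lemma \<rho>_mult: "y \<in> carrier G \<Longrightarrow> y' \<in> carrier G \<Longrightarrow> \<rho> (y \<otimes>\<^bsub>G\<^esub> y') = \<rho> y * \<rho> y'" using \<rho> by (simp add: is_rep_def)
lemma \<rho>_one: "\<rho> \<one>\<^bsub>G\<^esub> = 1\<^sub>m d" using \<rho> by (simp add: is_rep_def)
lemma \<rho>\<kappa>_carrier: "z \<in> carrier Z \<Longrightarrow> \<rho> (\<kappa> z) \<in> carrier_mat d d" using \<rho>_carrier by simp

lemma proj_\<kappa>:
  assumes \<phi>: "\<phi> \<in> \<Lambda>" and w: "w \<in> carrier Z"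
  shows "proj d \<rho> \<phi> * \<rho> (\<kappa> w) = \<phi> w \<cdot>\<^sub>m proj d \<rho> \<phi>"
proof -
  let ?n = "of_nat (card (carrier Z)) :: complex"
  have "proj d \<rho> \<phi> * \<rho> (\<kappa> w) = msum d (carrier Z) (\<lambda>z. (inverse (\<phi> z) / ?n) \<cdot>\<^sub>m \<rho> (\<kappa> z) * \<rho> (\<kappa> w))"
    unfolding proj_def using w by (intro msum_mult_right) (auto simp: \<rho>\<kappa>_carrier)
  also have "\<dots> = msum d (carrier Z) (\<lambda>z. \<phi> w \<cdot>\<^sub>m ((inverse (\<phi> (z \<otimes>\<^bsub>Z\<^esub> w)) / ?n) \<cdot>\<^sub>m \<rho> (\<kappa> (z \<otimes>\<^bsub>Z\<^esub> w))))"
  proof (rule msum_cong)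
    fix z assume z: "z \<in> carrier Z"
    have 1: "(inverse (\<phi> z) / ?n) \<cdot>\<^sub>m \<rho> (\<kappa> z) * \<rho> (\<kappa> w) = (inverse (\<phi> z) / ?n) \<cdot>\<^sub>m \<rho> (\<kappa> (z \<otimes>\<^bsub>Z\<^esub> w))"
      using z w by (simp add: mult_smult_assoc_mat[of _ d d _ d] \<rho>\<kappa>_carrier \<rho>_mult)
    have 2: "inverse (\<phi> z) / ?n = \<phi> w * (inverse (\<phi> (z \<otimes>\<^bsub>Z\<^esub> w)) / ?n)"
      using z w \<Lambda>_nonzero[OF \<phi>] by (simp add: \<Lambda>_mult[OF \<phi>])
    show "(inverse (\<phi> z) / ?n) \<cdot>\<^sub>m \<rho> (\<kappa> z) * \<rho> (\<kappa> w) = \<phi> w \<cdot>\<^sub>m ((inverse (\<phi> (z \<otimes>\<^bsub>Z\<^esub> w)) / ?n) \<cdot>\<^sub>m \<rho> (\<kappa> (z \<otimes>\<^bsub>Z\<^esub> w)))"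
      unfolding 1 unfolding 2 smult_smult_mat ..
  qed
  also have "\<dots> = msum d (carrier Z) (\<lambda>z. \<phi> w \<cdot>\<^sub>m ((inverse (\<phi> z) / ?n) \<cdot>\<^sub>m \<rho> (\<kappa> z)))"
  proof (rule msum_reindex[where h = "\<lambda>z. z \<otimes>\<^bsub>Z\<^esub> w"])
    show "bij_betw (\<lambda>z. z \<otimes>\<^bsub>Z\<^esub> w) (carrier Z) (carrier Z)"
      using Z.surj_const_mult[OF w] Z.inj_on_cmult[OF w] w
      by (simp add: bij_betw_def Z.m_comm[of _ w] cong: image_cong inj_on_cong)
  qed
  also have "\<dots> = \<phi> w \<cdot>\<^sub>m proj d \<rho> \<phi>"
    unfolding proj_def by (rule msum_smult[symmetric]) (simp add: \<rho>\<kappa>_carrier)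
  finally show ?thesis .
qed

text \<open>By \<open>proj_\<kappa>\<close>, expanding the second projection leaves the first one
  with the average of \<open>\<phi> / \<psi>\<close> over \<open>Z\<close> as factor.\<close>

lemma proj_proj:
  assumes \<phi>: "\<phi> \<in> \<Lambda>" and \<psi>: "\<psi> \<in> \<Lambda>"
  shows "proj d \<rho> \<phi> * proj d \<rho> \<psi> = (if \<phi> = \<psi> then proj d \<rho> \<phi> else 0\<^sub>m d d)"
proof -
  let ?n = "of_nat (card (carrier Z)) :: complex"
  have "proj d \<rho> \<phi> * proj d \<rho> \<psi> = msum d (carrier Z) (\<lambda>z. proj d \<rho> \<phi> * ((inverse (\<psi> z) / ?n) \<cdot>\<^sub>m \<rho> (\<kappa> z)))"
    unfolding proj_def[of d \<rho> \<psi>] by (rule msum_mult_left) (auto simp: \<rho>\<kappa>_carrier)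
  also have "\<dots> = msum d (carrier Z) (\<lambda>z. (\<phi> z * inverse (\<psi> z) / ?n) \<cdot>\<^sub>m proj d \<rho> \<phi>)"
  proof (rule msum_cong)
    fix z assume z: "z \<in> carrier Z"
    show "proj d \<rho> \<phi> * ((inverse (\<psi> z) / ?n) \<cdot>\<^sub>m \<rho> (\<kappa> z)) = (\<phi> z * inverse (\<psi> z) / ?n) \<cdot>\<^sub>m proj d \<rho> \<phi>"
      using z by (simp add: mult_smult_distrib[of _ d d _ d] \<rho>\<kappa>_carrier proj_\<kappa>[OF \<phi>] smult_smult_mat mult.commute)
  qed
  also have "\<dots> = (\<Sum>z\<in>carrier Z. \<phi> z * inverse (\<psi> z) / ?n) \<cdot>\<^sub>m proj d \<rho> \<phi>"
    by (rule msum_scalar) simp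
  also have "(\<Sum>z\<in>carrier Z. \<phi> z * inverse (\<psi> z) / ?n) = (if \<phi> = \<psi> then 1 else 0)"
  proof -
    let ?\<chi> = "restrict (\<lambda>z. \<phi> z * restrict (\<lambda>z. inverse (\<psi> z)) (carrier Z) z) (carrier Z)"
    have \<chi>: "?\<chi> \<in> \<Lambda>" by (intro \<Lambda>_times \<Lambda>_inverse \<phi> \<psi>)
    have "(\<Sum>z\<in>carrier Z. \<phi> z * inverse (\<psi> z) / ?n) = (\<Sum>z\<in>carrier Z. ?\<chi> z) / ?n"
      by (simp add: sum_divide_distrib)
    moreover have "?\<chi> = restrict (\<lambda>z. 1) (carrier Z) \<longleftrightarrow> \<phi> = \<psi>"
    proof
      assume e: "?\<chi> = restrict (\<lambda>z. 1) (carrier Z)"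
      have "\<phi> x = \<psi> x" if "x \<in> carrier Z" for x
        using fun_cong[OF e, of x] that \<Lambda>_nonzero[OF \<psi> that] by (simp add: field_simps)
      then show "\<phi> = \<psi>" using \<Lambda>_ext \<phi> \<psi> by (intro extensionalityI[of _ "carrier Z"]) auto
    next
      assume "\<phi> = \<psi>"
      then show "?\<chi> = restrict (\<lambda>z. 1) (carrier Z)" using \<Lambda>_nonzero[OF \<psi>] by auto
    qed
    ultimately show ?thesis using sum_character[OF \<chi>] card_Z by (simp only:) simp
  qed
  finally show ?thesis by (simp add: zero_smult_mat[OF proj_carrier] one_smult_mat)
qed

text \<open>After exchanging the sums, the coefficient of \<open>\<rho> (\<kappa> z)\<close> is the
  average of \<open>inverse (\<phi> z)\<close> over \<open>\<Lambda>\<close>, which vanishes except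
  at the identity.\<close>

lemma sum_proj: "msum d \<Lambda> (proj d \<rho>) = 1\<^sub>m d"
proof -
  let ?n = "of_nat (card (carrier Z)) :: complex"
  have "msum d \<Lambda> (proj d \<rho>) = msum d (carrier Z) (\<lambda>z. msum d \<Lambda> (\<lambda>\<phi>. (inverse (\<phi> z) / ?n) \<cdot>\<^sub>m \<rho> (\<kappa> z)))"
    unfolding proj_def by (rule msum_swap)
  also have "\<dots> = msum d (carrier Z) (\<lambda>z. if z = \<one>\<^bsub>Z\<^esub> then 1\<^sub>m d else 0\<^sub>m d d)"
  proof (rule msum_cong)
    fix z assume z: "z \<in> carrier Z"
    have "inverse (\<phi> z) = \<phi> (inv\<^bsub>Z\<^esub> z)" if "\<phi> \<in> \<Lambda>" for \<phi>
      using \<Lambda>_mult[OF that z, of "inv\<^bsub>Z\<^esub> z"] \<Lambda>_one[OF that] z by (auto intro: inverse_unique)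
    then have "(\<Sum>\<phi>\<in>\<Lambda>. inverse (\<phi> z) / ?n) = (\<Sum>\<phi>\<in>\<Lambda>. \<phi> (inv\<^bsub>Z\<^esub> z)) / ?n"
      by (simp add: sum_divide_distrib cong: sum.cong)
    also have "\<dots> = (if z = \<one>\<^bsub>Z\<^esub> then 1 else 0)"
    proof (cases "z = \<one>\<^bsub>Z\<^esub>")
      case True
      then show ?thesis using card_\<Lambda> card_Z by (simp add: \<Lambda>_one cong: sum.cong)
    next
      case False
      then have "inv\<^bsub>Z\<^esub> z \<noteq> \<one>\<^bsub>Z\<^esub>" using z by (metis Z.inv_inv Z.inv_one)
      then show ?thesis using sum_\<Lambda>[of "inv\<^bsub>Z\<^esub> z"] z False by simp
    qed
    finally have "msum d \<Lambda> (\<lambda>\<phi>. (inverse (\<phi> z) / ?n) \<cdot>\<^sub>m \<rho> (\<kappa> z)) = (if z = \<one>\<^bsub>Z\<^esub> then 1 else 0) \<cdot>\<^sub>m \<rho> (\<kappa> z)"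
      using msum_scalar[OF \<rho>\<kappa>_carrier[OF z], of \<Lambda> "\<lambda>\<phi>. inverse (\<phi> z) / ?n"] by (simp only:)
    also have "\<dots> = (if z = \<one>\<^bsub>Z\<^esub> then 1\<^sub>m d else 0\<^sub>m d d)"
      using \<rho>\<kappa>_carrier[OF z] \<rho>_one by (auto intro!: eq_matI)
    finally show "msum d \<Lambda> (\<lambda>\<phi>. (inverse (\<phi> z) / ?n) \<cdot>\<^sub>m \<rho> (\<kappa> z)) = (if z = \<one>\<^bsub>Z\<^esub> then 1\<^sub>m d else 0\<^sub>m d d)" .
  qed
  also have "\<dots> = 1\<^sub>m d" by (rule msum_delta[OF finite_Z Z.one_closed]) simp
  finally show ?thesis .
qed

text \<open>Conjugation by \<open>y\<close> permutes the kernel through \<open>act\<close>, hence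
  the isotypic parts through \<open>tw\<close>.\<close>

lemma proj_\<rho>:
  assumes \<phi>: "\<phi> \<in> \<Lambda>" and y: "y \<in> carrier G"
  shows "proj d \<rho> \<phi> * \<rho> y = \<rho> y * proj d \<rho> (tw \<phi> (\<pi> y))"
proof -
  let ?n = "of_nat (card (carrier Z)) :: complex"
  let ?s = "\<pi> y"
  have s: "?s \<in> carrier S" using y by simp
  have "\<rho> y * proj d \<rho> (tw \<phi> ?s) = msum d (carrier Z) (\<lambda>z. \<rho> y * ((inverse (tw \<phi> ?s z) / ?n) \<cdot>\<^sub>m \<rho> (\<kappa> z)))"
    unfolding proj_def by (rule msum_mult_left) (auto simp: \<rho>\<kappa>_carrier \<rho>_carrier y)
  also have "\<dots> = msum d (carrier Z) (\<lambda>z. ((inverse (\<phi> (act ?s z)) / ?n) \<cdot>\<^sub>m \<rho> (\<kappa> (act ?s z))) * \<rho> y)"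
  proof (rule msum_cong)
    fix z assume z: "z \<in> carrier Z"
    have a: "act ?s z \<in> carrier Z" using act_closed s z by simp
    have "\<rho> y * \<rho> (\<kappa> z) = \<rho> (\<kappa> (act ?s z)) * \<rho> y"
      using conj[OF y z] y z a by (metis \<rho>_mult \<kappa>.hom_closed)
    then show "\<rho> y * ((inverse (tw \<phi> ?s z) / ?n) \<cdot>\<^sub>m \<rho> (\<kappa> z)) = ((inverse (\<phi> (act ?s z)) / ?n) \<cdot>\<^sub>m \<rho> (\<kappa> (act ?s z))) * \<rho> y"
      using \<rho>\<kappa>_carrier[OF z] \<rho>\<kappa>_carrier[OF a] \<rho>_carrier[OF y] z
      by (simp add: tw_apply mult_smult_distrib[of _ d d _ d] mult_smult_assoc_mat[of _ d d _ d])
  qed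
  also have "\<dots> = msum d (carrier Z) (\<lambda>z. ((inverse (\<phi> z) / ?n) \<cdot>\<^sub>m \<rho> (\<kappa> z)) * \<rho> y)"
  proof (rule msum_reindex[where h = "act ?s"])
    have i: "inv\<^bsub>S\<^esub> ?s \<in> carrier S" using s by simp
    show "bij_betw (act ?s) (carrier Z) (carrier Z)"
      by (rule bij_betw_byWitness[where f' = "act (inv\<^bsub>S\<^esub> ?s)"])
        (use s i in \<open>auto simp: act_closed act_one simp flip: act_mult\<close>)
  qed
  also have "\<dots> = proj d \<rho> \<phi> * \<rho> y"
    unfolding proj_def by (rule msum_mult_right[symmetric]) (auto simp: \<rho>\<kappa>_carrier \<rho>_carrier y)
  finally show ?thesis by simp
qed

lemma sum_proj_scaled:
  assumes z: "z \<in> carrier Z"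
  shows "msum d \<Lambda> (\<lambda>\<phi>. \<phi> z \<cdot>\<^sub>m proj d \<rho> \<phi>) = \<rho> (\<kappa> z)"
proof -
  have "msum d \<Lambda> (\<lambda>\<phi>. \<phi> z \<cdot>\<^sub>m proj d \<rho> \<phi>) = msum d \<Lambda> (\<lambda>\<phi>. proj d \<rho> \<phi> * \<rho> (\<kappa> z))"
    using z by (intro msum_cong) (simp add: proj_\<kappa>)
  also have "\<dots> = msum d \<Lambda> (proj d \<rho>) * \<rho> (\<kappa> z)"
    using z by (intro msum_mult_right[symmetric]) (auto simp: \<rho>\<kappa>_carrier)
  finally show ?thesis using z \<rho>\<kappa>_carrier[OF z] by (simp add: sum_proj)
qed

text \<open>Elements with the same image differ by some \<open>\<kappa> z\<close>, and both
  \<open>\<mu> \<phi>\<close> and the operator acquire the factor \<open>\<phi> z\<close>. Hence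
  \<open>transfer\<close> does not depend on the choice made in \<open>lift\<close>.\<close>

lemma normalized_eq:
  assumes \<phi>: "\<phi> \<in> \<Lambda>" and y: "y \<in> carrier G" "y' \<in> carrier G" "\<pi> y = \<pi> y'"
  shows "inverse (\<mu> \<phi> y) \<cdot>\<^sub>m (proj d \<rho> \<phi> * \<rho> y) = inverse (\<mu> \<phi> y') \<cdot>\<^sub>m (proj d \<rho> \<phi> * \<rho> y')"
proof -
  have "y' \<otimes>\<^bsub>G\<^esub> inv\<^bsub>G\<^esub> y \<in> carrier G" "\<pi> (y' \<otimes>\<^bsub>G\<^esub> inv\<^bsub>G\<^esub> y) = \<one>\<^bsub>S\<^esub>" using y by auto
  then obtain z where z: "z \<in> carrier Z" "y' \<otimes>\<^bsub>G\<^esub> inv\<^bsub>G\<^esub> y = \<kappa> z" by (rule kernelE)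
  then have y': "y' = \<kappa> z \<otimes>\<^bsub>G\<^esub> y" using y by (metis G.inv_solve_right' \<kappa>.hom_closed)
  have m: "\<mu> \<phi> y' = \<phi> z * \<mu> \<phi> y"
    unfolding y' using \<mu>_mult[OF \<phi> \<kappa>.hom_closed[OF z(1)] y(1)] z \<mu>_\<kappa>[OF \<phi>] tw_one[OF \<phi>] by simp
  have r: "proj d \<rho> \<phi> * \<rho> y' = \<phi> z \<cdot>\<^sub>m (proj d \<rho> \<phi> * \<rho> y)"
  proof -
    have "proj d \<rho> \<phi> * \<rho> y' = proj d \<rho> \<phi> * \<rho> (\<kappa> z) * \<rho> y"
      unfolding y' using z y by (simp add: \<rho>_mult \<rho>\<kappa>_carrier \<rho>_carrier assoc_mult_mat[of _ d d _ d _ d])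
    then show ?thesis using z y by (simp add: proj_\<kappa>[OF \<phi>] mult_smult_assoc_mat[of _ d d _ d] \<rho>_carrier)
  qed
  have "inverse (\<mu> \<phi> y) = inverse (\<mu> \<phi> y') * \<phi> z"
    using \<Lambda>_nonzero[OF \<phi> z(1)] by (simp add: m)
  then show ?thesis by (simp only: r smult_smult_mat)
qed

end

end

section \<open>Transfer between two extensions with the same quotient, kernel and action\<close>

locale rep_pair = A: rep_side G1 S Z \<pi>1 \<kappa>1 act \<Lambda> \<mu>1 + B: rep_side G2 S Z \<pi>2 \<kappa>2 act \<Lambda> \<mu>2
  for G1 :: "'g monoid" and G2 :: "'h monoid" and S :: "'s monoid" and Z :: "'z monoid"
    and \<pi>1 \<kappa>1 \<mu>1 \<pi>2 \<kappa>2 \<mu>2 act \<Lambda>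
begin

definition lift :: "'h \<Rightarrow> 'g" where
  "lift y = (SOME x. x \<in> carrier G1 \<and> \<pi>1 x = \<pi>2 y)"

lemma lift: "y \<in> carrier G2 \<Longrightarrow> lift y \<in> carrier G1 \<and> \<pi>1 (lift y) = \<pi>2 y"
  unfolding lift_def by (rule someI_ex) (metis A.liftE B.\<pi>.hom_closed)

definition transfer :: "nat \<Rightarrow> ('g \<Rightarrow> complex mat) \<Rightarrow> 'h \<Rightarrow> complex mat" where
  "transfer d \<rho> y = msum d \<Lambda> (\<lambda>\<phi>. \<mu>2 \<phi> y \<cdot>\<^sub>m (inverse (\<mu>1 \<phi> (lift y)) \<cdot>\<^sub>m (A.proj d \<rho> \<phi> * \<rho> (lift y))))"

context
  fixes d \<rho> assumes \<rho>: "is_rep d G1 \<rho>"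
begin

lemmas \<rho>c = A.\<rho>_carrier[OF \<rho>]

lemma transfer_eq:
  assumes y: "y \<in> carrier G2" and x: "x \<in> carrier G1" "\<pi>1 x = \<pi>2 y"
  shows "transfer d \<rho> y = msum d \<Lambda> (\<lambda>\<phi>. \<mu>2 \<phi> y \<cdot>\<^sub>m (inverse (\<mu>1 \<phi> x) \<cdot>\<^sub>m (A.proj d \<rho> \<phi> * \<rho> x)))"
  unfolding transfer_def
  by (rule msum_cong) (use A.normalized_eq[OF \<rho>, of _ "lift y" x] lift[OF y] x in simp)

text \<open>The projections are orthogonal, so applying one of them isolates its summand.\<close>

lemma proj_transfer:
  assumes \<phi>: "\<phi> \<in> \<Lambda>" and y: "y \<in> carrier G2" and x: "x \<in> carrier G1" "\<pi>1 x = \<pi>2 y"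
  shows "A.proj d \<rho> \<phi> * transfer d \<rho> y = \<mu>2 \<phi> y \<cdot>\<^sub>m (inverse (\<mu>1 \<phi> x) \<cdot>\<^sub>m (A.proj d \<rho> \<phi> * \<rho> x))"
proof -
  let ?t = "\<lambda>\<phi>. \<mu>2 \<phi> y \<cdot>\<^sub>m (inverse (\<mu>1 \<phi> x) \<cdot>\<^sub>m (A.proj d \<rho> \<phi> * \<rho> x))"
  have c: "A.proj d \<rho> \<psi> * \<rho> x \<in> carrier_mat d d" for \<psi>
    by (rule mult_carrier_mat[OF A.proj_carrier \<rho>c[OF x(1)]])
  have "A.proj d \<rho> \<phi> * transfer d \<rho> y = msum d \<Lambda> (\<lambda>\<psi>. A.proj d \<rho> \<phi> * ?t \<psi>)"
    unfolding transfer_eq[OF y x] using c by (intro msum_mult_left) auto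
  also have "\<dots> = msum d \<Lambda> (\<lambda>\<psi>. if \<psi> = \<phi> then ?t \<psi> else 0\<^sub>m d d)"
  proof (rule msum_cong)
    fix \<psi> assume \<psi>: "\<psi> \<in> \<Lambda>"
    have "A.proj d \<rho> \<phi> * ?t \<psi> = (\<mu>2 \<psi> y * inverse (\<mu>1 \<psi> x)) \<cdot>\<^sub>m (A.proj d \<rho> \<phi> * (A.proj d \<rho> \<psi> * \<rho> x))"
      using c[of \<psi>] by (simp add: smult_smult_mat mult_smult_distrib[of _ d d _ d])
    also have "A.proj d \<rho> \<phi> * (A.proj d \<rho> \<psi> * \<rho> x) = (A.proj d \<rho> \<phi> * A.proj d \<rho> \<psi>) * \<rho> x"
      by (rule assoc_mult_mat[symmetric, OF A.proj_carrier A.proj_carrier \<rho>c[OF x(1)]])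
    also have "\<dots> = (if \<psi> = \<phi> then A.proj d \<rho> \<psi> * \<rho> x else 0\<^sub>m d d)"
      using A.proj_proj[OF \<rho> \<phi> \<psi>] left_mult_zero_mat[OF \<rho>c[OF x(1)], of d] by auto
    finally show "A.proj d \<rho> \<phi> * ?t \<psi> = (if \<psi> = \<phi> then ?t \<psi> else 0\<^sub>m d d)"
      by (simp add: smult_smult_mat)
  qed
  also have "\<dots> = ?t \<phi>" using c[of \<phi>] by (intro msum_delta A.finite_\<Lambda> \<phi>) simp
  finally show ?thesis .
qed

lemma transfer_carrier [simp]: "transfer d \<rho> y \<in> carrier_mat d d"
  by (simp add: transfer_def)

lemma transfer_decomp:
  "transfer d \<rho> y = msum d \<Lambda> (\<lambda>\<phi>. A.proj d \<rho> \<phi> * transfer d \<rho> y)"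
proof -
  have "msum d \<Lambda> (\<lambda>\<phi>. A.proj d \<rho> \<phi> * transfer d \<rho> y) = msum d \<Lambda> (A.proj d \<rho>) * transfer d \<rho> y"
    by (intro msum_mult_right[symmetric]) auto
  then show ?thesis by (simp add: A.sum_proj[OF \<rho>] left_mult_one_mat[OF transfer_carrier])
qed

text \<open>The identity is a lift for \<open>\<kappa>2 z\<close>; there \<open>\<mu>1\<close> is 1,
  and the sum becomes the isotypic decomposition of \<open>\<rho> (\<kappa>1 z)\<close>.\<close>

lemma transfer_\<kappa>:
  assumes z: "z \<in> carrier Z" shows "transfer d \<rho> (\<kappa>2 z) = \<rho> (\<kappa>1 z)"
proof -
  have "transfer d \<rho> (\<kappa>2 z) = msum d \<Lambda> (\<lambda>\<phi>. \<mu>2 \<phi> (\<kappa>2 z) \<cdot>\<^sub>m (inverse (\<mu>1 \<phi> \<one>\<^bsub>G1\<^esub>) \<cdot>\<^sub>m (A.proj d \<rho> \<phi> * \<rho> \<one>\<^bsub>G1\<^esub>)))"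
    using z by (intro transfer_eq) auto
  also have "\<dots> = msum d \<Lambda> (\<lambda>\<phi>. \<phi> z \<cdot>\<^sub>m A.proj d \<rho> \<phi>)"
    using z by (intro msum_cong)
      (simp add: B.\<mu>_\<kappa> A.\<mu>_one A.\<rho>_one[OF \<rho>] right_mult_one_mat[OF A.proj_carrier] one_smult_mat)
  also have "\<dots> = \<rho> (\<kappa>1 z)" by (rule A.sum_proj_scaled[OF \<rho> z])
  finally show ?thesis .
qed

text \<open>The projections sum to the identity, so both sides can be compared after applying each
  of them. Moving the projection for \<open>\<phi>\<close> past \<open>\<rho> ?x\<close> turns
  \<open>\<phi>\<close> into its twist, which is the very twist in the cocycle relations of
  \<open>\<mu>1\<close> and \<open>\<mu>2\<close>.\<close>

lemma transfer_is_rep: "is_rep d G2 (transfer d \<rho>)"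
  unfolding is_rep_def
proof (intro conjI ballI)
  show "transfer d \<rho> \<one>\<^bsub>G2\<^esub> = 1\<^sub>m d"
    using transfer_\<kappa>[of "\<one>\<^bsub>Z\<^esub>"] A.\<rho>_one[OF \<rho>] by simp
  fix y y' assume y: "y \<in> carrier G2" "y' \<in> carrier G2"
  let ?x = "lift y" and ?x' = "lift y'"
  have x: "?x \<in> carrier G1" "\<pi>1 ?x = \<pi>2 y" "?x' \<in> carrier G1" "\<pi>1 ?x' = \<pi>2 y'" using lift y by auto
  have xx: "?x \<otimes>\<^bsub>G1\<^esub> ?x' \<in> carrier G1" "\<pi>1 (?x \<otimes>\<^bsub>G1\<^esub> ?x') = \<pi>2 (y \<otimes>\<^bsub>G2\<^esub> y')" using x y by auto
  have yy: "y \<otimes>\<^bsub>G2\<^esub> y' \<in> carrier G2" using y by simp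
  have "A.proj d \<rho> \<phi> * (transfer d \<rho> y * transfer d \<rho> y') = A.proj d \<rho> \<phi> * transfer d \<rho> (y \<otimes>\<^bsub>G2\<^esub> y')"
    if \<phi>: "\<phi> \<in> \<Lambda>" for \<phi>
  proof -
    let ?\<psi> = "A.tw \<phi> (\<pi>2 y)"
    have \<psi>: "?\<psi> \<in> \<Lambda>" using A.tw_in[OF \<phi>] B.\<pi>.hom_closed[OF y(1)] by simp
    have c: "A.proj d \<rho> \<nu> * \<rho> w \<in> carrier_mat d d" if "w \<in> carrier G1" for \<nu> w
      by (rule mult_carrier_mat[OF A.proj_carrier \<rho>c[OF that]])
    let ?a = "\<mu>2 \<phi> y * inverse (\<mu>1 \<phi> ?x)" and ?b = "\<mu>2 ?\<psi> y' * inverse (\<mu>1 ?\<psi> ?x')"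
    have "A.proj d \<rho> \<phi> * (transfer d \<rho> y * transfer d \<rho> y') = (A.proj d \<rho> \<phi> * transfer d \<rho> y) * transfer d \<rho> y'"
      by (rule assoc_mult_mat[symmetric, OF A.proj_carrier transfer_carrier transfer_carrier])
    also have "\<dots> = (?a \<cdot>\<^sub>m (\<rho> ?x * A.proj d \<rho> ?\<psi>)) * transfer d \<rho> y'"
      unfolding proj_transfer[OF \<phi> y(1) x(1,2)] A.proj_\<rho>[OF \<rho> \<phi> x(1)] x(2) smult_smult_mat ..
    also have "\<dots> = ?a \<cdot>\<^sub>m (\<rho> ?x * (A.proj d \<rho> ?\<psi> * transfer d \<rho> y'))"
      using \<rho>c[OF x(1)] by (simp add: mult_smult_assoc_mat[of _ d d _ d] assoc_mult_mat[of _ d d _ d _ d] mult_carrier_mat[of _ d d _ d])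
    also have "\<dots> = ?a \<cdot>\<^sub>m (\<rho> ?x * (?b \<cdot>\<^sub>m (A.proj d \<rho> ?\<psi> * \<rho> ?x')))"
      unfolding proj_transfer[OF \<psi> y(2) x(3,4)] smult_smult_mat ..
    also have "\<dots> = (?a * ?b) \<cdot>\<^sub>m (\<rho> ?x * (A.proj d \<rho> ?\<psi> * \<rho> ?x'))"
      by (simp add: mult_smult_distrib[OF \<rho>c[OF x(1)] c[OF x(3)]] smult_smult_mat)
    also have "\<rho> ?x * (A.proj d \<rho> ?\<psi> * \<rho> ?x') = \<rho> ?x * A.proj d \<rho> ?\<psi> * \<rho> ?x'"
      by (rule assoc_mult_mat[symmetric, OF \<rho>c[OF x(1)] A.proj_carrier \<rho>c[OF x(3)]])
    also have "\<rho> ?x * A.proj d \<rho> ?\<psi> = A.proj d \<rho> \<phi> * \<rho> ?x"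
      using A.proj_\<rho>[OF \<rho> \<phi> x(1)] x(2) by simp
    also have "A.proj d \<rho> \<phi> * \<rho> ?x * \<rho> ?x' = A.proj d \<rho> \<phi> * \<rho> (?x \<otimes>\<^bsub>G1\<^esub> ?x')"
      using assoc_mult_mat[OF A.proj_carrier \<rho>c[OF x(1)] \<rho>c[OF x(3)]] A.\<rho>_mult[OF \<rho> x(1) x(3)] by simp
    also have "?a * ?b = \<mu>2 \<phi> (y \<otimes>\<^bsub>G2\<^esub> y') * inverse (\<mu>1 \<phi> (?x \<otimes>\<^bsub>G1\<^esub> ?x'))"
      using A.\<mu>_mult[OF \<phi> x(1,3)] B.\<mu>_mult[OF \<phi> y] x(2) by simp
    finally show ?thesis unfolding proj_transfer[OF \<phi> yy xx] smult_smult_mat .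
  qed
  then have "msum d \<Lambda> (\<lambda>\<phi>. A.proj d \<rho> \<phi> * (transfer d \<rho> y * transfer d \<rho> y')) = transfer d \<rho> (y \<otimes>\<^bsub>G2\<^esub> y')"
    by (subst transfer_decomp) (rule msum_cong)
  moreover have "msum d \<Lambda> (\<lambda>\<phi>. A.proj d \<rho> \<phi> * (transfer d \<rho> y * transfer d \<rho> y')) = transfer d \<rho> y * transfer d \<rho> y'"
  proof -
    have tc: "transfer d \<rho> y * transfer d \<rho> y' \<in> carrier_mat d d"
      by (rule mult_carrier_mat[OF transfer_carrier transfer_carrier])
    have "msum d \<Lambda> (\<lambda>\<phi>. A.proj d \<rho> \<phi> * (transfer d \<rho> y * transfer d \<rho> y')) = msum d \<Lambda> (A.proj d \<rho>) * (transfer d \<rho> y * transfer d \<rho> y')"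
      using tc by (intro msum_mult_right[symmetric]) auto
    then show ?thesis by (simp add: A.sum_proj[OF \<rho>] left_mult_one_mat[OF tc])
  qed
  ultimately show "transfer d \<rho> (y \<otimes>\<^bsub>G2\<^esub> y') = transfer d \<rho> y * transfer d \<rho> y'" by simp
qed simp

text \<open>A projection involves only values on the kernel, and \<open>transfer_\<kappa>\<close>
  says that these are kept.\<close>

lemma proj_transfer_eq: "B.proj d (transfer d \<rho>) \<phi> = A.proj d \<rho> \<phi>"
  unfolding A.proj_def B.proj_def by (rule msum_cong) (simp add: transfer_\<kappa>)

text \<open>Each value of the transfer is a linear combination of products of values of
  \<open>\<rho>\<close>.\<close>

lemma transfer_subspace:
  assumes W: "VectorSpace.subspace class_ring W (module_vec TYPE(complex) d)"
    and inv: "\<And>g w. g \<in> carrier G1 \<Longrightarrow> w \<in> W \<Longrightarrow> \<rho> g *\<^sub>v w \<in> W"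
    and y: "y \<in> carrier G2" and w: "w \<in> W"
  shows "transfer d \<rho> y *\<^sub>v w \<in> W"
proof -
  have sm: "submodule class_ring W (module_vec TYPE(complex) d)" using W by (simp add: VectorSpace.subspace_def)
  have Wc: "W \<subseteq> carrier_vec d" using submodule.subset[OF sm] by (simp add: module_vec_simps)
  let ?x = "lift y"
  have x: "?x \<in> carrier G1" using lift[OF y] by simp
  have "A.proj d \<rho> \<phi> *\<^sub>v u \<in> W" if "u \<in> W" for \<phi> u
    unfolding A.proj_def
    using that by (intro msum_mult_vec[OF W A.finite_Z that] smult_mult_vec_in[OF W that] smult_carrier_mat inv)
      (auto simp: A.\<rho>\<kappa>_carrier[OF \<rho>])
  then have p: "(A.proj d \<rho> \<phi> * \<rho> ?x) *\<^sub>v w \<in> W" for \<phi>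
    using assoc_mult_mat_vec[OF A.proj_carrier \<rho>c[OF x], of w] inv[OF x w] w Wc by auto
  have c: "A.proj d \<rho> \<phi> * \<rho> ?x \<in> carrier_mat d d" for \<phi>
    by (rule mult_carrier_mat[OF A.proj_carrier \<rho>c[OF x]])
  show ?thesis
    unfolding transfer_def
    by (intro msum_mult_vec[OF W A.finite_\<Lambda> w] smult_mult_vec_in[OF W w] smult_carrier_mat c p)
qed

end

text \<open>Projections are combinations of values of the representation, so \<open>U\<close>
  carries those of \<open>\<rho>\<close> to those of \<open>\<sigma>\<close>; the scalars are the
  same on both sides.\<close>

lemma transfer_intertwine:
  assumes \<rho>: "is_rep d G1 \<rho>" and \<sigma>: "is_rep d G1 \<sigma>" and U: "U \<in> carrier_mat d d"
    and eq: "\<And>g. g \<in> carrier G1 \<Longrightarrow> U * \<rho> g = \<sigma> g * U" and y: "y \<in> carrier G2"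
  shows "U * transfer d \<rho> y = transfer d \<sigma> y * U"
proof -
  let ?x = "lift y"
  have x: "?x \<in> carrier G1" using lift[OF y] by simp
  note c\<rho> = A.\<rho>_carrier[OF \<rho>] and c\<sigma> = A.\<rho>_carrier[OF \<sigma>]
  have p: "U * A.proj d \<rho> \<phi> = A.proj d \<sigma> \<phi> * U" for \<phi>
  proof -
    have "U * A.proj d \<rho> \<phi> = msum d (carrier Z) (\<lambda>z. U * ((inverse (\<phi> z) / of_nat (card (carrier Z))) \<cdot>\<^sub>m \<rho> (\<kappa>1 z)))"
      unfolding A.proj_def by (rule msum_mult_left[OF U]) (auto simp: c\<rho>)
    also have "\<dots> = msum d (carrier Z) (\<lambda>z. ((inverse (\<phi> z) / of_nat (card (carrier Z))) \<cdot>\<^sub>m \<sigma> (\<kappa>1 z)) * U)"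
      by (rule msum_cong) (simp add: mult_smult_distrib[OF U c\<rho>] mult_smult_assoc_mat[OF c\<sigma> U] eq)
    also have "\<dots> = A.proj d \<sigma> \<phi> * U"
      unfolding A.proj_def by (rule msum_mult_right[OF U, symmetric]) (auto simp: c\<sigma>)
    finally show ?thesis .
  qed
  have m: "U * (A.proj d \<rho> \<phi> * \<rho> ?x) = A.proj d \<sigma> \<phi> * \<sigma> ?x * U" for \<phi>
  proof -
    have "U * (A.proj d \<rho> \<phi> * \<rho> ?x) = A.proj d \<sigma> \<phi> * U * \<rho> ?x"
      unfolding p[symmetric] by (rule assoc_mult_mat[symmetric, OF U A.proj_carrier c\<rho>[OF x]])
    also have "\<dots> = A.proj d \<sigma> \<phi> * (\<sigma> ?x * U)"
      using assoc_mult_mat[OF A.proj_carrier U c\<rho>[OF x]] eq[OF x] by simp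
    also have "\<dots> = A.proj d \<sigma> \<phi> * \<sigma> ?x * U"
      by (rule assoc_mult_mat[OF A.proj_carrier c\<sigma>[OF x] U, symmetric])
    finally show ?thesis .
  qed
  have c: "A.proj d \<rho> \<phi> * \<rho> ?x \<in> carrier_mat d d" "A.proj d \<sigma> \<phi> * \<sigma> ?x \<in> carrier_mat d d" for \<phi>
    using mult_carrier_mat[OF A.proj_carrier c\<rho>[OF x]] mult_carrier_mat[OF A.proj_carrier c\<sigma>[OF x]] by auto
  show ?thesis
    unfolding transfer_def smult_smult_mat
    by (subst msum_mult_left[OF U], simp add: c, subst msum_mult_right[OF U], simp add: c, rule msum_cong)
      (simp add: mult_smult_distrib[OF U c(1)] mult_smult_assoc_mat[OF c(2) U] m)
qed

end

text \<open>The maps are inverse to each other only up to the relations; \<open>e\<close> picks a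
  member of \<open>A\<close> in each class, so that \<open>f\<close> induces a bijection of
  classes.\<close>

lemma card_quotient_eq:
  assumes r: "equiv R r" and s: "equiv Q s" and AR: "A \<subseteq> R" and BQ: "B \<subseteq> Q"
    and f: "\<And>x. x \<in> A \<Longrightarrow> f x \<in> B" "\<And>x x'. x \<in> A \<Longrightarrow> x' \<in> A \<Longrightarrow> (x, x') \<in> r \<Longrightarrow> (f x, f x') \<in> s"
    and g: "\<And>y. y \<in> B \<Longrightarrow> g y \<in> A" "\<And>y y'. y \<in> B \<Longrightarrow> y' \<in> B \<Longrightarrow> (y, y') \<in> s \<Longrightarrow> (g y, g y') \<in> r"
    and gf: "\<And>x. x \<in> A \<Longrightarrow> (g (f x), x) \<in> r" and fg: "\<And>y. y \<in> B \<Longrightarrow> (f (g y), y) \<in> s"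
  shows "card (A // r) = card (B // s)"
proof -
  define e where "e C = (SOME x. x \<in> A \<and> C = r `` {x})" for C
  have e: "e C \<in> A \<and> C = r `` {e C}" if "C \<in> A // r" for C
    unfolding e_def by (rule someI_ex) (use that in \<open>auto simp: quotient_def\<close>)
  have cls_r: "r `` {x} = r `` {y} \<longleftrightarrow> (x, y) \<in> r" if "x \<in> A" "y \<in> A" for x y
    using eq_equiv_class_iff[OF r] that AR by blast
  have cls_s: "s `` {x} = s `` {y} \<longleftrightarrow> (x, y) \<in> s" if "x \<in> B" "y \<in> B" for x y
    using eq_equiv_class_iff[OF s] that BQ by blast
  have sym_r: "(x, y) \<in> r \<Longrightarrow> (y, x) \<in> r" for x y using r by (auto simp: equiv_def dest: symD)
  have trans_r: "(x, y) \<in> r \<Longrightarrow> (y, z) \<in> r \<Longrightarrow> (x, z) \<in> r" for x y z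
    using r by (auto simp: equiv_def dest: transD)
  have trans_s: "(x, y) \<in> s \<Longrightarrow> (y, z) \<in> s \<Longrightarrow> (x, z) \<in> s" for x y z
    using s by (auto simp: equiv_def dest: transD)
  have "bij_betw (\<lambda>C. s `` {f (e C)}) (A // r) (B // s)"
  proof (rule bij_betwI')
    fix C D assume CD: "C \<in> A // r" "D \<in> A // r"
    show "s `` {f (e C)} = s `` {f (e D)} \<longleftrightarrow> C = D"
    proof
      assume "s `` {f (e C)} = s `` {f (e D)}"
      then have "(f (e C), f (e D)) \<in> s" using cls_s f(1) e CD by simp
      then have "(g (f (e C)), g (f (e D))) \<in> r" using g(2) f(1) e CD by simp
      moreover have ec: "e C \<in> A" "e D \<in> A" "C = r `` {e C}" "D = r `` {e D}"
        using e[OF CD(1)] e[OF CD(2)] by blast+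
      ultimately have "(e C, e D) \<in> r" by (intro trans_r[OF sym_r[OF gf[OF ec(1)]] trans_r[OF _ gf[OF ec(2)]]])
      then have "r `` {e C} = r `` {e D}" using cls_r[OF ec(1,2)] by blast
      then show "C = D" by (rule trans[OF ec(3) trans[OF _ ec(4)[symmetric]]])
    qed simp
  next
    fix C assume "C \<in> A // r"
    then show "s `` {f (e C)} \<in> B // s" using e f(1) by (auto intro: quotientI)
  next
    fix D assume "D \<in> B // s"
    then obtain y where y: "y \<in> B" "D = s `` {y}" by (auto simp: quotient_def)
    let ?C = "r `` {g y}"
    have C: "?C \<in> A // r" using g(1)[OF y(1)] by (rule quotientI)
    have eA: "e ?C \<in> A" and eC: "?C = r `` {e ?C}" using e[OF C] by blast+
    have "(e ?C, g y) \<in> r" using cls_r[OF eA g(1)[OF y(1)]] eC by simp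
    then have "(f (e ?C), f (g y)) \<in> s" using f(2) eA g(1) y(1) by blast
    then have "(f (e ?C), y) \<in> s" using fg[OF y(1)] trans_s by blast
    then have "s `` {f (e ?C)} = s `` {y}" using cls_s[OF f(1)[OF eA] y(1)] by simp
    then have "D = s `` {f (e ?C)}" using y(2) by simp
    then show "\<exists>C\<in>A // r. D = s `` {f (e C)}" using C by blast
  qed
  then show ?thesis by (rule bij_betw_same_card)
qed

context rep_pair
begin

lemma rep_pair_swap: "rep_pair G2 G1 S Z \<pi>2 \<kappa>2 \<mu>2 \<pi>1 \<kappa>1 \<mu>1 act \<Lambda>"
  by (intro rep_pair.intro A.rep_side_axioms B.rep_side_axioms)

text \<open>The way back uses the same projections, and its scalars are inverse to those of the way
  there.\<close>

lemma transfer_transfer: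
  assumes \<rho>: "is_rep d G1 \<rho>" and x: "x \<in> carrier G1"
  shows "rep_pair.transfer G2 Z \<pi>2 \<kappa>2 \<mu>2 \<pi>1 \<mu>1 \<Lambda> d (transfer d \<rho>) x = \<rho> x"
proof -
  interpret sw: rep_pair G2 G1 S Z \<pi>2 \<kappa>2 \<mu>2 \<pi>1 \<kappa>1 \<mu>1 act \<Lambda> by (rule rep_pair_swap)
  let ?y = "sw.lift x"
  have y: "?y \<in> carrier G2" "\<pi>1 x = \<pi>2 ?y" using sw.lift[OF x] by auto
  have c: "A.proj d \<rho> \<phi> * \<rho> x \<in> carrier_mat d d" for \<phi>
    by (rule mult_carrier_mat[OF A.proj_carrier A.\<rho>_carrier[OF \<rho> x]])
  have "sw.transfer d (transfer d \<rho>) x = msum d \<Lambda> (\<lambda>\<phi>. A.proj d \<rho> \<phi> * \<rho> x)"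
    unfolding sw.transfer_def proj_transfer_eq[OF \<rho>]
  proof (rule msum_cong)
    fix \<phi> assume \<phi>: "\<phi> \<in> \<Lambda>"
    have "\<mu>1 \<phi> x * (inverse (\<mu>2 \<phi> ?y) * (\<mu>2 \<phi> ?y * inverse (\<mu>1 \<phi> x))) = 1"
      using A.\<mu>_nonzero[OF \<phi> x] B.\<mu>_nonzero[OF \<phi> y(1)] by (simp add: field_simps)
    then show "\<mu>1 \<phi> x \<cdot>\<^sub>m (inverse (\<mu>2 \<phi> ?y) \<cdot>\<^sub>m (A.proj d \<rho> \<phi> * transfer d \<rho> ?y)) = A.proj d \<rho> \<phi> * \<rho> x"
      unfolding proj_transfer[OF \<rho> \<phi> y(1) x y(2)] smult_smult_mat by (simp add: mult.assoc one_smult_mat)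
  qed
  also have "\<dots> = msum d \<Lambda> (A.proj d \<rho>) * \<rho> x"
    by (intro msum_mult_right[symmetric] A.\<rho>_carrier[OF \<rho> x]) auto
  also have "\<dots> = \<rho> x" by (simp add: A.sum_proj[OF \<rho>] left_mult_one_mat[OF A.\<rho>_carrier[OF \<rho> x]])
  finally show ?thesis .
qed

text \<open>A subspace invariant under the transfer is invariant under the transfer back, that is,
  under \<open>\<rho>\<close>.\<close>

lemma transfer_irreducible:
  assumes irr: "irreducible_rep d G1 \<rho>"
  shows "irreducible_rep d G2 (transfer d \<rho>)"
proof -
  interpret sw: rep_pair G2 G1 S Z \<pi>2 \<kappa>2 \<mu>2 \<pi>1 \<kappa>1 \<mu>1 act \<Lambda> by (rule rep_pair_swap)
  have \<rho>: "is_rep d G1 \<rho>"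
    using irr reps_iff_is_rep[OF A.G.group_axioms] by (auto simp: irreducible_rep_def)
  have T: "is_rep d G2 (transfer d \<rho>)" by (rule transfer_is_rep[OF \<rho>])
  have "W = {0\<^sub>v d} \<or> W = carrier_vec d"
    if W: "VectorSpace.subspace class_ring W (module_vec TYPE(complex) d)"
      and inv: "\<forall>g\<in>carrier G2. \<forall>w\<in>W. transfer d \<rho> g *\<^sub>v w \<in> W" for W
  proof -
    have "\<rho> g *\<^sub>v w \<in> W" if "g \<in> carrier G1" "w \<in> W" for g w
      using sw.transfer_subspace[OF T W _ that] inv transfer_transfer[OF \<rho> that(1)] by simp
    then show ?thesis using irr W by (simp add: irreducible_rep_def)
  qed
  then show ?thesis
    using T irr reps_iff_is_rep[OF B.G.group_axioms] by (simp add: irreducible_rep_def)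
qed

lemma transfer_iso:
  assumes "(\<rho>, \<sigma>) \<in> rep_iso d G1"
  shows "(transfer d \<rho>, transfer d \<sigma>) \<in> rep_iso d G2"
proof -
  have \<rho>: "is_rep d G1 \<rho>" and \<sigma>: "is_rep d G1 \<sigma>"
    using assms reps_iff_is_rep[OF A.G.group_axioms] by (auto simp: rep_iso_def)
  obtain U where U: "U \<in> carrier (GL_complex d)" "\<And>g. g \<in> carrier G1 \<Longrightarrow> U * \<rho> g = \<sigma> g * U"
    using assms by (auto simp: rep_iso_def)
  have Uc: "U \<in> carrier_mat d d" using U(1) by (simp add: GL_complex_iff)
  show ?thesis
    using U(1) transfer_intertwine[OF \<rho> \<sigma> Uc U(2)] transfer_is_rep[OF \<rho>] transfer_is_rep[OF \<sigma>]
      reps_iff_is_rep[OF B.G.group_axioms] by (auto simp: rep_iso_def)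
qed

text \<open>The double transfer agrees with \<open>\<rho>\<close> on the carrier, so the identity
  matrix is an isomorphism, whereas the functions themselves may differ outside.\<close>

lemma transfer_transfer_iso:
  assumes "is_rep d G1 \<rho>"
  shows "(rep_pair.transfer G2 Z \<pi>2 \<kappa>2 \<mu>2 \<pi>1 \<mu>1 \<Lambda> d (transfer d \<rho>), \<rho>) \<in> rep_iso d G1"
proof -
  interpret sw: rep_pair G2 G1 S Z \<pi>2 \<kappa>2 \<mu>2 \<pi>1 \<kappa>1 \<mu>1 act \<Lambda> by (rule rep_pair_swap)
  have "is_rep d G1 (sw.transfer d (transfer d \<rho>))"
    by (intro sw.transfer_is_rep transfer_is_rep assms)
  moreover have "1\<^sub>m d \<in> carrier (GL_complex d)" by (auto simp: GL_complex_iff intro!: bexI[of _ "1\<^sub>m d"])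
  moreover have "1\<^sub>m d * \<rho> g = \<rho> g * 1\<^sub>m d" if "g \<in> carrier G1" for g
    using left_mult_one_mat[OF A.\<rho>_carrier[OF assms that]] right_mult_one_mat[OF A.\<rho>_carrier[OF assms that]] by simp
  ultimately show ?thesis
    using assms reps_iff_is_rep[OF A.G.group_axioms]
    by (auto simp: rep_iso_def transfer_transfer[OF assms] intro!: bexI[of _ "1\<^sub>m d"])
qed

theorem card_Irr_eq: "card (Irr d G1) = card (Irr d G2)"
proof -
  interpret sw: rep_pair G2 G1 S Z \<pi>2 \<kappa>2 \<mu>2 \<pi>1 \<kappa>1 \<mu>1 act \<Lambda> by (rule rep_pair_swap)
  have rep: "is_rep d G1 \<rho>" if "irreducible_rep d G1 \<rho>" for \<rho>
    using that reps_iff_is_rep[OF A.G.group_axioms] by (auto simp: irreducible_rep_def)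
  have rep': "is_rep d G2 \<rho>" if "irreducible_rep d G2 \<rho>" for \<rho>
    using that reps_iff_is_rep[OF B.G.group_axioms] by (auto simp: irreducible_rep_def)
  show ?thesis
    unfolding Irr_def
  proof (rule card_quotient_eq[OF equiv_rep_iso equiv_rep_iso, where f = "transfer d" and g = "sw.transfer d"])
    show "{\<rho>. irreducible_rep d G1 \<rho>} \<subseteq> reps d G1" "{\<rho>. irreducible_rep d G2 \<rho>} \<subseteq> reps d G2"
      by (auto simp: irreducible_rep_def)
    fix \<rho> assume "\<rho> \<in> {\<rho>. irreducible_rep d G1 \<rho>}"
    then have irr: "irreducible_rep d G1 \<rho>" by simp
    then show "transfer d \<rho> \<in> {\<rho>. irreducible_rep d G2 \<rho>}" using transfer_irreducible by blast
    show "(sw.transfer d (transfer d \<rho>), \<rho>) \<in> rep_iso d G1" by (rule transfer_transfer_iso[OF rep[OF irr]])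
  next
    fix \<rho> assume "\<rho> \<in> {\<rho>. irreducible_rep d G2 \<rho>}"
    then have irr: "irreducible_rep d G2 \<rho>" by simp
    then show "sw.transfer d \<rho> \<in> {\<rho>. irreducible_rep d G1 \<rho>}" using sw.transfer_irreducible by blast
    show "(transfer d (sw.transfer d \<rho>), \<rho>) \<in> rep_iso d G2" by (rule sw.transfer_transfer_iso[OF rep'[OF irr]])
  next
    fix \<rho> \<sigma> assume "(\<rho>, \<sigma>) \<in> rep_iso d G1"
    then show "(transfer d \<rho>, transfer d \<sigma>) \<in> rep_iso d G2" by (rule transfer_iso)
  next
    fix \<rho> \<sigma> assume "(\<rho>, \<sigma>) \<in> rep_iso d G2"
    then show "(sw.transfer d \<rho>, sw.transfer d \<sigma>) \<in> rep_iso d G1" by (rule sw.transfer_iso)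
  qed
qed

end

section \<open>Characters of trace-zero matrices\<close>

lemma freshmans_dream_CHAR_power: "(x + y) ^ (CHAR('q) ^ i) = x ^ (CHAR('q) ^ i) + y ^ (CHAR('q) ^ i)" for x y :: "'q::finite_field"
  by (rule freshmans_dream') auto

lemma of_nat_power_CHAR: "(of_nat j :: 'q::finite_field) ^ CHAR('q) = of_nat j"
proof (induction j)
  case (Suc j)
  have "(1 + of_nat j :: 'q) ^ CHAR('q) = 1 + of_nat j"
    using freshmans_dream_CHAR_power[of "1::'q" "of_nat j" 1] Suc by simp
  then show ?case by simp
qed (use CHAR_pos[where 'a = 'q] in simp)

text \<open>
  The composition of the trace to the prime field with \<open>j \<mapsto> exp(2\<pi>i j/p)\<close>.
\<close>
lemma exists_additive_character:
  "\<exists>\<theta> :: 'q::finite_field \<Rightarrow> complex. (\<forall>a b. \<theta> (a + b) = \<theta> a * \<theta> b) \<and> \<theta> 0 = 1 \<and> (\<exists>a. \<theta> a \<noteq> 1)"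
proof -
  let ?p = "CHAR('q)" and ?q = "card (UNIV :: 'q set)"
  have p: "prime ?p" by simp
  have p1: "?p > 1" using prime_gt_1_nat[OF p] .
  obtain r where r: "?q = ?p ^ r" using card_finite_field_prime_power by blast
  have "?q \<ge> 2" using card_mono[of "UNIV :: 'q set" "{0, 1}"] by simp
  then have r0: "r \<noteq> 0" using r by (intro notI) simp
  \<comment> \<open>The absolute trace; Frobenius permutes its terms, as the \<open>?q\<close>-th
    power of \<open>x\<close> is \<open>x\<close>.\<close>
  define Tr where "Tr x = (\<Sum>i<r. x ^ (?p ^ i))" for x :: 'q
  have Tr_add: "Tr (x + y) = Tr x + Tr y" for x y
    by (simp add: Tr_def freshmans_dream_CHAR_power sum.distrib)
  have Tr_p: "Tr x ^ ?p = Tr x" for x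
  proof -
    have "Tr x ^ ?p = (\<Sum>i<r. x ^ (?p ^ Suc i))"
      unfolding Tr_def by (subst freshmans_dream_sum) (auto simp: power_mult[symmetric] mult.commute)
    also have "\<dots> + x = (\<Sum>i<Suc r. x ^ (?p ^ i))"
      by (simp add: sum.lessThan_Suc_shift del: sum.lessThan_Suc)
    also have "\<dots> = Tr x + x"
      using finite_field_power_card_eq_same[of x] r by (simp add: Tr_def)
    finally show ?thesis by simp
  qed
  \<comment> \<open>The $p$ multiples of 1 are all the roots of \<open>t^p - t\<close>.\<close>
  have prime_field: "\<exists>j. x = of_nat j" if x: "x ^ ?p = x" for x :: 'q
  proof -
    let ?f = "monom 1 ?p - [:0, 1:] :: 'q poly"
    have cf: "coeff ?f ?p = 1"
    proof -
      obtain p' where "?p = Suc (Suc p')" using p1 by (metis One_nat_def less_imp_Suc_add add_Suc_right plus_1_eq_Suc add_0)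
      then show ?thesis by simp
    qed
    then have f0: "?f \<noteq> 0" by (metis coeff_0 zero_neq_one)
    have degf: "degree ?f \<le> ?p"
      using p1 by (intro degree_diff_le) (auto simp: degree_monom_le)
    have root: "poly ?f x = 0 \<longleftrightarrow> x ^ ?p = x" for x by (simp add: poly_monom)
    let ?F = "of_nat ` {..<?p} :: 'q set"
    have inj: "inj_on (of_nat :: nat \<Rightarrow> 'q) {..<?p}"
    proof (rule inj_onI)
      fix a b assume ab: "a \<in> {..<?p}" "b \<in> {..<?p}" "of_nat a = (of_nat b :: 'q)"
      show "a = b"
      proof (cases a b rule: linorder_cases)
        case less
        then have "of_nat (b - a) = (0 :: 'q)" using ab by (simp add: of_nat_diff)
        then have "?p dvd b - a" by (simp add: of_nat_eq_0_iff_char_dvd)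
        then show ?thesis using less ab by (auto dest: dvd_imp_le)
      next
        case greater
        then have "of_nat (a - b) = (0 :: 'q)" using ab by (simp add: of_nat_diff)
        then have "?p dvd a - b" by (simp add: of_nat_eq_0_iff_char_dvd)
        then show ?thesis using greater ab by (auto dest: dvd_imp_le)
      qed
    qed
    have "?F = {x. poly ?f x = 0}"
    proof (rule card_seteq)
      show "?F \<subseteq> {x. poly ?f x = 0}" unfolding root using of_nat_power_CHAR by blast
      have "card {x. poly ?f x = 0} \<le> degree ?f" using f0 by (rule card_poly_roots_bound)
      then show "card {x. poly ?f x = 0} \<le> card ?F" using degf card_image[OF inj] by simp
    qed simp
    moreover have "x \<in> {x. poly ?f x = 0}" using x root by simp
    ultimately show ?thesis by auto
  qed
  define \<omega> where "\<omega> = cis (2 * pi / ?p)"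
  have \<omega>p: "\<omega> ^ ?p = 1" using p1 by (simp add: \<omega>_def DeMoivre)
  have \<omega>mod: "\<omega> ^ j = \<omega> ^ (j mod ?p)" for j
  proof -
    have "\<omega> ^ j = \<omega> ^ (?p * (j div ?p) + j mod ?p)" by simp
    also have "\<dots> = \<omega> ^ (j mod ?p)" by (simp only: power_add power_mult \<omega>p power_one mult_1)
    finally show ?thesis .
  qed
  have \<omega>1: "?p dvd j" if "\<omega> ^ j = 1" for j
  proof -
    have "cis (real j * (2 * pi / ?p)) = 1" using that by (simp add: \<omega>_def DeMoivre)
    then have "cos (real j * (2 * pi / ?p)) = 1" by (metis cis.simps(1) one_complex.simps(1))
    then obtain k :: int where "real j * (2 * pi / ?p) = of_int k * 2 * pi" by (auto simp: cos_one_2pi_int)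
    then have "real j = of_int k * real ?p" using p1 by (simp add: field_simps)
    then have "int j = k * int ?p" by (metis of_int_eq_iff of_int_mult of_int_of_nat_eq)
    then have "int ?p dvd int j" by simp
    then show ?thesis by simp
  qed
  \<comment> \<open>All \<open>j\<close> that represent the trace are congruent modulo $p$ and give
    the same power of \<open>\<omega>\<close>.\<close>
  define \<theta> where "\<theta> x = \<omega> ^ (SOME j. Tr x = of_nat j)" for x
  have \<theta>: "\<theta> x = \<omega> ^ j" if j: "Tr x = of_nat j" for x j
  proof -
    let ?k = "SOME j. Tr x = of_nat j"
    have "Tr x = of_nat ?k" using j by (rule someI)
    then have "of_nat ?k = (of_nat j :: 'q)" using j by simp
    then have "?k mod ?p = j mod ?p"
    proof -
      assume e: "of_nat ?k = (of_nat j :: 'q)"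
      have "?p dvd j - ?k" if "?k \<le> j" using that e by (simp add: of_nat_diff flip: of_nat_eq_0_iff_char_dvd)
      moreover have "?p dvd ?k - j" if "j \<le> ?k" using that e by (simp add: of_nat_diff flip: of_nat_eq_0_iff_char_dvd)
      ultimately show ?thesis by (metis mod_eq_dvd_iff_nat nle_le)
    qed
    then show ?thesis unfolding \<theta>_def using \<omega>mod by metis
  qed
  have Tr_nat: "\<exists>j. Tr x = of_nat j" for x using prime_field[OF Tr_p] .
  have add: "\<theta> (a + b) = \<theta> a * \<theta> b" for a b
  proof -
    obtain j k where jk: "Tr a = of_nat j" "Tr b = of_nat k" using Tr_nat by metis
    then have "Tr (a + b) = of_nat (j + k)" by (simp add: Tr_add)
    from \<theta>[OF this] show ?thesis using \<theta>[OF jk(1)] \<theta>[OF jk(2)] by (simp add: power_add)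
  qed
  have "Tr 0 = of_nat 0" using CHAR_pos[where 'a = 'q] by (simp add: Tr_def power_0_left)
  then have zero: "\<theta> 0 = 1" using \<theta>[of 0 0] by simp
  \<comment> \<open>As a polynomial the trace has degree at most \<open>?p ^ (r - 1)\<close>, less
    than the number of elements of the field, so it does not vanish everywhere.\<close>
  have "\<exists>a. Tr a \<noteq> 0"
  proof (rule ccontr)
    assume "\<nexists>a. Tr a \<noteq> 0"
    then have all: "Tr a = 0" for a by simp
    let ?f = "\<Sum>i<r. monom 1 (?p ^ i) :: 'q poly"
    have "poly ?f x = 0" for x using all[of x] by (simp add: poly_sum poly_monom Tr_def)
    moreover have f0: "?f \<noteq> 0"
    proof -
      have "coeff ?f 1 = (\<Sum>i<r. if ?p ^ i = 1 then 1 else 0)" by (simp add: coeff_sum)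
      also have "\<dots> = (\<Sum>i\<in>{0}. if ?p ^ i = 1 then 1 else 0)"
        using r0 p1 by (intro sum.mono_neutral_right) auto
      finally show ?thesis by auto
    qed
    moreover have "degree ?f \<le> ?p ^ (r - 1)"
    proof (rule degree_sum_le)
      fix i assume "i \<in> {..<r}"
      then have "?p ^ i \<le> ?p ^ (r - 1)" using p1 by (intro power_increasing) auto
      then show "degree (monom (1::'q) (?p ^ i)) \<le> ?p ^ (r - 1)" using degree_monom_le order_trans by blast
    qed simp
    ultimately have "?q \<le> ?p ^ (r - 1)" using card_poly_roots_bound[OF f0] by simp
    moreover have "?p ^ (r - 1) < ?p ^ r" using p1 r0 by (intro power_strict_increasing) auto
    ultimately show False using r by simp
  qed
  then obtain a where a: "Tr a \<noteq> 0" by blast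
  obtain j where j: "Tr a = of_nat j" using Tr_nat by blast
  have "\<theta> a \<noteq> 1"
  proof
    assume "\<theta> a = 1"
    then have "?p dvd j" using \<theta>[OF j] \<omega>1 by simp
    then show False using a j by (simp add: of_nat_eq_0_iff_char_dvd)
  qed
  then show ?thesis using add zero by blast
qed

section \<open>The additive group of trace-zero matrices and its dual\<close>

definition sl_group :: "nat \<Rightarrow> 'a::comm_ring_1 mat monoid" where
  "sl_group n = \<lparr>carrier = {z \<in> carrier_mat n n. mtr n z = 0}, mult = (+), one = 0\<^sub>m n n\<rparr>"

text \<open>\<open>adj_mat s\<close> serves as the inverse, which it is for determinant 1.\<close>

definition adjoint :: "'a::comm_ring_1 mat \<Rightarrow> 'a mat \<Rightarrow> 'a mat" where
  "adjoint s z = s * z * adj_mat s"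

text \<open>Because of the restriction, matrices \<open>X\<close> that differ by a scalar matrix
  give equal functions.\<close>

definition sl_char :: "('a::comm_ring_1 \<Rightarrow> complex) \<Rightarrow> nat \<Rightarrow> 'a mat \<Rightarrow> 'a mat \<Rightarrow> complex" where
  "sl_char \<theta> n X = restrict (\<lambda>z. \<theta> (mtr n (X * z))) (carrier (sl_group n))"

lemma sl_group_simps:
  "z \<in> carrier (sl_group n) \<longleftrightarrow> z \<in> carrier_mat n n \<and> mtr n z = 0"
  "z \<otimes>\<^bsub>sl_group n\<^esub> w = z + w" "\<one>\<^bsub>sl_group n\<^esub> = 0\<^sub>m n n"
  by (auto simp: sl_group_def)

lemma sl_char_apply: "z \<in> carrier (sl_group n) \<Longrightarrow> sl_char \<theta> n X z = \<theta> (mtr n (X * z))"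
  by (simp add: sl_char_def)

lemma comm_group_sl: "comm_group (sl_group n :: 'a::comm_ring_1 mat monoid)"
proof (rule comm_groupI)
  fix z :: "'a mat" assume z: "z \<in> carrier (sl_group n)"
  then have "- z \<in> carrier (sl_group n)" "- z + z = 0\<^sub>m n n"
    by (auto simp: sl_group_simps mtr_def sum_negf intro!: eq_matI)
  then show "\<exists>y\<in>carrier (sl_group n). y \<otimes>\<^bsub>sl_group n\<^esub> z = \<one>\<^bsub>sl_group n\<^esub>"
    by (intro bexI[of _ "- z"]) (simp_all add: sl_group_simps(2,3))
qed (auto simp: sl_group_simps mtr_add mtr_def assoc_add_mat[of _ n n] comm_add_mat[of _ n n])

lemma adj_mat_SL:
  assumes "s \<in> carrier (SL TYPE('a::comm_ring_1) n)"
  shows "s \<in> carrier_mat n n" "adj_mat s \<in> carrier_mat n n" "s * adj_mat s = 1\<^sub>m n" "adj_mat s * s = 1\<^sub>m n"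
  using assms adj_mat[of s n] by (auto simp: SL_simps)

lemma mtr_adjoint:
  assumes "s \<in> carrier (SL TYPE('a::comm_ring_1) n)" "z \<in> carrier_mat n n"
  shows "mtr n (adjoint s z) = mtr n z"
proof -
  note s = adj_mat_SL[OF assms(1)]
  have "mtr n (adjoint s z) = mtr n (adj_mat s * (s * z))"
    unfolding adjoint_def using s assms(2) by (intro mtr_comm) auto
  also have "adj_mat s * (s * z) = z"
    using assoc_mult_mat[OF s(2,1) assms(2)] s assms(2) by simp
  finally show ?thesis .
qed

lemma mtr_mult_adjoint:
  assumes "s \<in> carrier (SL TYPE('a::comm_ring_1) n)" "X \<in> carrier_mat n n" "z \<in> carrier_mat n n"
  shows "mtr n (X * adjoint s z) = mtr n (adj_mat s * X * s * z)"
proof -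
  note s = adj_mat_SL[OF assms(1)]
  have "X * adjoint s z = (X * (s * z)) * adj_mat s"
    unfolding adjoint_def using s assms(2,3) by (simp add: assoc_mult_mat[of _ n n _ n _ n])
  then have "mtr n (X * adjoint s z) = mtr n (adj_mat s * (X * (s * z)))"
    using mtr_comm[of "X * (s * z)" n "adj_mat s"] s assms(2,3) by simp
  then show ?thesis using s assms(2,3) by (simp add: assoc_mult_mat[of _ n n _ n _ n])
qed

lemma mtr_diff:
  fixes A B :: "'a::comm_ring_1 mat"
  assumes "A \<in> carrier_mat n n" "B \<in> carrier_mat n n"
  shows "mtr n (A - B) = mtr n A - mtr n B"
  using assms by (simp add: mtr_def sum_subtractf)

definition unit_mat :: "nat \<Rightarrow> nat \<Rightarrow> nat \<Rightarrow> 'a::comm_ring_1 \<Rightarrow> 'a mat" where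
  "unit_mat n i j t = mat n n (\<lambda>(k, l). if k = i \<and> l = j then t else 0)"

lemma unit_mat_carrier [simp]: "unit_mat n i j t \<in> carrier_mat n n"
  by (simp add: unit_mat_def)

lemma mtr_mult_unit_mat:
  assumes W: "W \<in> carrier_mat n n" and ij: "i < n" "j < n"
  shows "mtr n (W * unit_mat n i j t) = W $$ (j, i) * t"
proof -
  have "mtr n (W * unit_mat n i j t) = (\<Sum>k<n. \<Sum>l<n. if k = j \<and> l = i then W $$ (j, i) * t else 0)"
    unfolding mtr_mult[OF W unit_mat_carrier] by (intro sum.cong) (auto simp: unit_mat_def)
  also have "\<dots> = (\<Sum>k\<in>{j}. \<Sum>l<n. if k = j \<and> l = i then W $$ (j, i) * t else 0)"
    using ij by (intro sum.mono_neutral_right) auto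
  also have "\<dots> = (\<Sum>l<n. if l = i then W $$ (j, i) * t else 0)" by simp
  also have "\<dots> = (\<Sum>l\<in>{i}. if l = i then W $$ (j, i) * t else 0)"
    using ij by (intro sum.mono_neutral_right) auto
  finally show ?thesis by simp
qed

lemma mtr_unit_mat:
  assumes "i < n" "j < n"
  shows "mtr n (unit_mat n i j t) = (if i = j then t else 0)"
  using mtr_mult_unit_mat[OF one_carrier_mat assms, of t] assms
  by (simp add: left_mult_one_mat[OF unit_mat_carrier])

text \<open>Testing against multiples of off-diagonal matrix units and against differences of
  diagonal ones gives \<open>\<theta> (x * t) = 1\<close> for all \<open>t\<close>, where
  \<open>x\<close> is an off-diagonal entry or a difference of diagonal entries of \<open>W\<close>.
  As \<open>\<theta>\<close> is nontrivial, \<open>x = 0\<close>.\<close>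

lemma scalar_if_orthogonal:
  fixes W :: "'q::field mat" and \<theta> :: "'q \<Rightarrow> complex"
  assumes W: "W \<in> carrier_mat n n" and n: "n \<ge> 1"
    and \<theta>: "\<exists>a. \<theta> a \<noteq> 1"
    and orth: "\<And>z :: 'q mat. z \<in> carrier (sl_group n) \<Longrightarrow> \<theta> (mtr n (W * z)) = 1"
  shows "W = W $$ (0, 0) \<cdot>\<^sub>m 1\<^sub>m n"
proof -
  obtain a where a: "\<theta> a \<noteq> 1" using \<theta> by blast
  have zero: "x = 0" if "\<And>t. \<theta> (x * t) = 1" for x
  proof (rule ccontr)
    assume "x \<noteq> 0"
    then have "\<theta> (x * (a / x)) = \<theta> a" by simp
    then show False using that[of "a / x"] a by simp
  qed
  have off: "W $$ (j, i) = 0" if ij: "i < n" "j < n" "i \<noteq> j" for i j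
  proof (rule zero)
    fix t :: 'q
    have "unit_mat n i j t \<in> carrier (sl_group n)" using ij by (simp add: sl_group_simps mtr_unit_mat)
    from orth[OF this] show "\<theta> (W $$ (j, i) * t) = 1" using mtr_mult_unit_mat[OF W ij(1,2)] by simp
  qed
  have diag: "W $$ (i, i) - W $$ (0, 0) = 0" if i: "i < n" for i
  proof (rule zero)
    fix t :: 'q
    let ?z = "unit_mat n i i t + unit_mat n 0 0 (- t)"
    have "mtr n ?z = 0"
      using i n by (simp add: mtr_add[OF unit_mat_carrier unit_mat_carrier] mtr_unit_mat)
    then have "?z \<in> carrier (sl_group n)" by (simp add: sl_group_simps)
    moreover have "mtr n (W * ?z) = (W $$ (i, i) - W $$ (0, 0)) * t"
    proof -
      have "W * ?z = W * unit_mat n i i t + W * unit_mat n 0 0 (- t)"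
        by (rule mult_add_distrib_mat[OF W unit_mat_carrier unit_mat_carrier])
      then have "mtr n (W * ?z) = mtr n (W * unit_mat n i i t) + mtr n (W * unit_mat n 0 0 (- t))"
        using mtr_add[OF mult_carrier_mat[OF W unit_mat_carrier] mult_carrier_mat[OF W unit_mat_carrier]] by simp
      then show ?thesis using mtr_mult_unit_mat[OF W i i] mtr_mult_unit_mat[OF W, of 0 0] n by (simp add: algebra_simps)
    qed
    ultimately show "\<theta> ((W $$ (i, i) - W $$ (0, 0)) * t) = 1" using orth by metis
  qed
  show ?thesis
  proof (rule eq_matI)
    fix i j assume "i < dim_row (W $$ (0, 0) \<cdot>\<^sub>m 1\<^sub>m n)" "j < dim_col (W $$ (0, 0) \<cdot>\<^sub>m 1\<^sub>m n)"
    then have ij: "i < n" "j < n" by auto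
    then show "W $$ (i, j) = (W $$ (0, 0) \<cdot>\<^sub>m 1\<^sub>m n) $$ (i, j)"
      using off[of j i] diag[of i] by auto
  qed (use W in auto)
qed

lemma finite_carrier_mat:
  assumes "finite (UNIV :: 'a set)"
  shows "finite (carrier_mat n m :: 'a mat set)"
proof -
  have "carrier_mat n m \<subseteq> mat n m ` (({..<n} \<times> {..<m}) \<rightarrow>\<^sub>E (UNIV :: 'a set))"
  proof
    fix A :: "'a mat" assume A: "A \<in> carrier_mat n m"
    then have "A = mat n m (restrict (\<lambda>ij. A $$ ij) ({..<n} \<times> {..<m}))" by (intro eq_matI) auto
    moreover have "restrict (\<lambda>ij. A $$ ij) ({..<n} \<times> {..<m}) \<in> ({..<n} \<times> {..<m}) \<rightarrow>\<^sub>E UNIV" by auto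
    ultimately show "A \<in> mat n m ` (({..<n} \<times> {..<m}) \<rightarrow>\<^sub>E (UNIV :: 'a set))" by (rule image_eqI)
  qed
  then show ?thesis by (rule finite_subset) (intro finite_imageI finite_PiE; simp add: assms)
qed

section \<open>The special linear groups as extensions\<close>

context length_two
begin

text \<open>A lift has determinant \<open>1 + v e\<close>; a kernel matrix with entry
  \<open>- e\<close> in the corner corrects this without changing the reduction.\<close>

lemma redm_surj:
  assumes n: "n \<ge> 1"
  shows "redm ` carrier (SL TYPE('r) n) = carrier (SL TYPE('q) n)"
proof (intro equalityI subsetI)
  fix s assume s: "s \<in> carrier (SL TYPE('q) n)"
  then have sc: "s \<in> carrier_mat n n" "det s = 1" by (auto simp: SL_simps)
  obtain A where A: "A \<in> carrier_mat n n" "redm A = s" using lift_mat[OF sc(1)] .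
  have "red (det A - 1) = 0" using A sc red.hom_det[of A] by (simp add: red.hom_minus)
  then obtain e where "det A - 1 = v e" by (auto simp: red_eq_0)
  then have e: "det A = 1 + v e" by (simp add: algebra_simps)
  let ?z = "unit_mat n 0 0 (- e)"
  have "det (A * kmat n ?z) = (1 + v e) * (1 + v (- e))"
    using det_mult[OF A(1) kmat_carrier[OF unit_mat_carrier]] n by (simp add: e det_kmat mtr_unit_mat)
  also have "\<dots> = 1" by (simp add: algebra_simps v_minus)
  finally have "det (A * kmat n ?z) = 1" .
  moreover have "A * kmat n ?z \<in> carrier_mat n n" by (rule mult_carrier_mat[OF A(1) kmat_carrier[OF unit_mat_carrier]])
  moreover have "redm (A * kmat n ?z) = s"
    using redm_mult[OF A(1) kmat_carrier[OF unit_mat_carrier]] A sc by (simp add: redm_kmat)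
  ultimately show "s \<in> redm ` carrier (SL TYPE('r) n)" by (intro image_eqI[of _ _ "A * kmat n ?z"]) (auto simp: SL_simps)
qed (use redm_hom[of n] in \<open>auto simp: hom_def\<close>)

theorem SL_ext_data:
  fixes \<theta> :: "'q \<Rightarrow> complex"
  assumes n: "n \<ge> 1" and \<theta>: "\<And>a b. \<theta> (a + b) = \<theta> a * \<theta> b" "\<theta> 0 = 1"
  shows "ext_data (SL TYPE('r) n) (SL TYPE('q) n) (sl_group n) redm (kmat n) adjoint
    (sl_char \<theta> n ` carrier_mat n n)"
proof (intro ext_data.intro ext_data_axioms.intro group_SL comm_group_sl redm_hom redm_surj[OF n])
  show "finite (carrier (SL TYPE('r) n))"
    by (rule finite_subset[OF _ finite_carrier_mat[OF finite_UNIV_r, of n n]]) (auto simp: SL_simps)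
  show "kmat n \<in> hom (sl_group n) (SL TYPE('r) n)"
    by (auto intro!: homI simp: sl_group_simps kmat_in_SL kmat_mult) (simp add: SL_simps kmat_mult)
  show "inj_on (kmat n) (carrier (sl_group n))"
    by (rule inj_onI) (auto simp: sl_group_simps intro: kmat_inj)
  show "kmat n ` carrier (sl_group n) = {y \<in> carrier (SL TYPE('r) n). redm y = \<one>\<^bsub>SL TYPE('q) n\<^esub>}"
    unfolding SL_simps(3) kernel_SL by (simp add: sl_group_def)
  show "adjoint s z \<in> carrier (sl_group n)" if "s \<in> carrier (SL TYPE('q) n)" "z \<in> carrier (sl_group n)" for s z
    using that adj_mat_SL[OF that(1)] mtr_adjoint[OF that(1), of z]
    by (auto simp: sl_group_simps) (auto simp: adjoint_def intro!: mult_carrier_mat[of _ n n])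
  show "y \<otimes>\<^bsub>SL TYPE('r) n\<^esub> kmat n z = kmat n (adjoint (redm y) z) \<otimes>\<^bsub>SL TYPE('r) n\<^esub> y"
    if y: "y \<in> carrier (SL TYPE('r) n)" and z: "z \<in> carrier (sl_group n)" for y z
  proof -
    have s: "redm y \<in> carrier (SL TYPE('q) n)" using redm_hom[of n] y by (auto simp: hom_def)
    show ?thesis
      using kmat_conj[of y n z "adj_mat (redm y)"] adj_mat_SL[OF s] y z
      by (simp add: SL_simps sl_group_simps adjoint_def del: assoc_mult_mat)
  qed
next
  fix \<phi> assume "\<phi> \<in> sl_char \<theta> n ` carrier_mat n n"
  then obtain X where X: "X \<in> carrier_mat n n" "\<phi> = sl_char \<theta> n X" by blast
  then show "\<phi> \<in> extensional (carrier (sl_group n))" by (simp add: sl_char_def)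
  show "\<phi> \<one>\<^bsub>sl_group n\<^esub> = 1"
    using X right_mult_zero_mat[OF X(1), of n] \<theta>(2)
    by (simp add: sl_char_def sl_group_simps mtr_def)
  show "\<phi> (z \<otimes>\<^bsub>sl_group n\<^esub> z') = \<phi> z * \<phi> z'"
    if z: "z \<in> carrier (sl_group n)" "z' \<in> carrier (sl_group n)" for z z'
  proof -
    have "z + z' \<in> carrier (sl_group n)" using z by (auto simp: sl_group_simps mtr_add)
    moreover have "mtr n (X * (z + z')) = mtr n (X * z) + mtr n (X * z')"
      using mult_add_distrib_mat[OF X(1), of z n z'] mtr_add[of "X * z" n "X * z'"] X z by (simp add: sl_group_simps)
    ultimately show ?thesis using z X \<theta>(1) by (simp add: sl_char_apply sl_group_simps(2))
  qed
  fix s assume s: "s \<in> carrier (SL TYPE('q) n)"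
  note sc = adj_mat_SL[OF s]
  have "restrict (\<lambda>z. \<phi> (adjoint s z)) (carrier (sl_group n)) = sl_char \<theta> n (adj_mat s * X * s)"
  proof (rule extensionalityI[of _ "carrier (sl_group n)"])
    fix z :: "'q mat" assume z: "z \<in> carrier (sl_group n)"
    have "adjoint s z \<in> carrier (sl_group n)"
      using z sc mtr_adjoint[OF s, of z]
      by (auto simp: sl_group_simps) (auto simp: adjoint_def intro!: mult_carrier_mat[of _ n n])
    then show "restrict (\<lambda>z. \<phi> (adjoint s z)) (carrier (sl_group n)) z = sl_char \<theta> n (adj_mat s * X * s) z"
      using z X mtr_mult_adjoint[OF s X(1), of z] by (simp add: sl_char_apply) (simp add: sl_group_simps)
  qed (auto simp: sl_char_def)
  then show "restrict (\<lambda>z. \<phi> (adjoint s z)) (carrier (sl_group n)) \<in> sl_char \<theta> n ` carrier_mat n n"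
    using sc X by auto
qed

text \<open>If \<open>s\<close> stabilises \<open>sl_char \<theta> n X\<close>, then
  \<open>X\<close> minus its conjugate by \<open>s\<close> is orthogonal to all trace-zero matrices,
  hence scalar. This scalar is the additive function \<open>c\<close> that
  \<open>exists_extension\<close> asks for.\<close>

theorem SL_rep_side:
  fixes \<theta> :: "'q \<Rightarrow> complex"
  assumes n: "n \<ge> 1" and \<theta>: "\<And>a b. \<theta> (a + b) = \<theta> a * \<theta> b" "\<theta> 0 = 1" "\<exists>a. \<theta> a \<noteq> 1"
  shows "\<exists>\<mu>. rep_side (SL TYPE('r) n) (SL TYPE('q) n) (sl_group n) redm (kmat n) adjoint
    (sl_char \<theta> n ` carrier_mat n n) \<mu>"
proof -
  let ?R = "SL TYPE('r) n" and ?S = "SL TYPE('q) n" and ?Z = "sl_group n :: 'q mat monoid"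
  let ?\<Lambda> = "sl_char \<theta> n ` carrier_mat n n"
  interpret E: ext_data ?R ?S ?Z redm "kmat n" adjoint ?\<Lambda> by (rule SL_ext_data[OF n \<theta>(1,2)])
  have \<theta>_of_nat: "\<theta> a ^ k = \<theta> (of_nat k * a)" for a k
    by (induction k) (auto simp: \<theta> distrib_right)
  have \<theta>_minus: "\<theta> (- a) = inverse (\<theta> a)" for a
    using \<theta>(1)[of a "- a"] \<theta>(2) by (intro inverse_unique[symmetric]) simp
  have \<theta>_nonzero: "\<theta> a \<noteq> 0" for a using \<theta>(1)[of a "- a"] \<theta>(2) by auto
  have "\<exists>\<mu>. \<forall>\<phi>\<in>?\<Lambda>. (\<forall>y\<in>carrier ?R. \<forall>y'\<in>carrier ?R. \<mu> \<phi> (y \<otimes>\<^bsub>?R\<^esub> y') = \<mu> \<phi> y * \<mu> (E.tw \<phi> (redm y)) y')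
     \<and> (\<forall>z\<in>carrier ?Z. \<mu> \<phi> (kmat n z) = (\<phi> z :: complex))"
  proof (rule E.exists_cocycle[of "CHAR('q)"])
    show "prime CHAR('q)" by simp
    fix \<phi> z assume "\<phi> \<in> ?\<Lambda>" "z \<in> carrier ?Z"
    then show "\<phi> z ^ CHAR('q) = 1" by (auto simp: sl_char_apply \<theta>_of_nat \<theta>(2))
  next
    fix \<phi> P k assume \<phi>: "\<phi> \<in> ?\<Lambda>" and P: "subgroup P ?S" "card P = CHAR('q) ^ k"
      and stab: "\<And>s. s \<in> P \<Longrightarrow> E.tw \<phi> s = \<phi>"
    obtain X where X: "X \<in> carrier_mat n n" "\<phi> = sl_char \<theta> n X" using \<phi> by blast
    have PS: "s \<in> carrier ?S" if "s \<in> P" for s using subgroup.subset[OF P(1)] that by blast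
    \<comment> \<open>The scalar is read off at the corner entry, which exists as
      \<open>n \<ge> 1\<close>.\<close>
    define c where "c s = (X - adj_mat s * X * s) $$ (0, 0)" for s
    have twist: "s * X = X * s + c s \<cdot>\<^sub>m s" if s: "s \<in> P" for s
    proof -
      note sc = adj_mat_SL[OF PS[OF s]]
      let ?Y = "adj_mat s * X * s"
      have Y: "?Y \<in> carrier_mat n n" using sc X by auto
      have W: "X - ?Y \<in> carrier_mat n n" by (rule minus_carrier_mat[OF Y])
      have "X - ?Y = (X - ?Y) $$ (0, 0) \<cdot>\<^sub>m 1\<^sub>m n"
      proof (rule scalar_if_orthogonal[OF W n \<theta>(3)])
        fix z assume z: "z \<in> carrier ?Z"
        then have zc: "z \<in> carrier_mat n n" by (simp add: sl_group_simps)
        have "adjoint s z \<in> carrier ?Z" by (rule E.act_closed[OF PS[OF s] z])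
        then have "\<theta> (mtr n (X * z)) = \<theta> (mtr n (?Y * z))"
          using fun_cong[OF stab[OF s], of z] z X(2) mtr_mult_adjoint[OF PS[OF s] X(1) zc]
          by (simp add: E.tw_apply sl_char_apply)
        moreover have "mtr n ((X - ?Y) * z) = mtr n (X * z) + - mtr n (?Y * z)"
        proof -
          have "(X - ?Y) * z = X * z - ?Y * z" by (rule minus_mult_distrib_mat[OF X(1) Y zc])
          then show ?thesis
            using mtr_diff[OF mult_carrier_mat[OF X(1) zc] mult_carrier_mat[OF Y zc]] by simp
        qed
        ultimately show "\<theta> (mtr n ((X - ?Y) * z)) = 1"
          by (simp only: \<theta>(1) \<theta>_minus) (simp add: \<theta>_nonzero)
      qed
      then have e: "X - ?Y = c s \<cdot>\<^sub>m 1\<^sub>m n" by (simp only: c_def)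
      have "s * (X - ?Y) = s * X - s * ?Y" by (rule mult_minus_distrib_mat[OF sc(1) X(1) Y])
      also have "s * ?Y = X * s"
      proof -
        have "s * ?Y = s * (adj_mat s * (X * s))" using sc X by (simp add: assoc_mult_mat[of _ n n _ n _ n])
        also have "\<dots> = X * s" using assoc_mult_mat[OF sc(1,2), of "X * s" n] sc X by simp
        finally show ?thesis .
      qed
      finally have "s * X - X * s = c s \<cdot>\<^sub>m s"
        using e mult_smult_distrib[OF sc(1) one_carrier_mat] sc by simp
      then have d: "(s * X) $$ (i, j) - (X * s) $$ (i, j) = (c s \<cdot>\<^sub>m s) $$ (i, j)" if "i < n" "j < n" for i j
        using arg_cong[of _ _ "\<lambda>A. A $$ (i, j)"] sc X that by (metis carrier_matD index_minus_mat(1) mult_carrier_mat)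
      show ?thesis
      proof (rule eq_matI)
        fix i j assume "i < dim_row (X * s + c s \<cdot>\<^sub>m s)" "j < dim_col (X * s + c s \<cdot>\<^sub>m s)"
        then have ij: "i < n" "j < n" using sc by auto
        have "(X * s + c s \<cdot>\<^sub>m s) $$ (i, j) = (X * s) $$ (i, j) + (c s \<cdot>\<^sub>m s) $$ (i, j)"
          using sc ij by (intro index_add_mat) auto
        then show "(s * X) $$ (i, j) = (X * s + c s \<cdot>\<^sub>m s) $$ (i, j)" using d[OF ij] by (simp only: algebra_simps)
      qed (use sc X in auto)
    qed
    \<comment> \<open>The twist relation determines its scalar, so additivity of \<open>c\<close>
      follows from the relation for \<open>g * h\<close>.\<close>
    have c_eq: "c s = k" if s: "s \<in> P" and e: "s * X = X * s + k \<cdot>\<^sub>m s" for s k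
    proof -
      note sc = adj_mat_SL[OF PS[OF s]]
      have "X = adj_mat s * (s * X)" using assoc_mult_mat[OF sc(2,1) X(1)] sc X by simp
      also have "\<dots> = adj_mat s * (X * s) + k \<cdot>\<^sub>m 1\<^sub>m n"
        unfolding e using mult_add_distrib_mat[OF sc(2) mult_carrier_mat[OF X(1) sc(1)], of "k \<cdot>\<^sub>m s"]
          mult_smult_distrib[OF sc(2,1)] sc by simp
      finally have "X $$ (0, 0) = (adj_mat s * (X * s) + k \<cdot>\<^sub>m 1\<^sub>m n) $$ (0, 0)" by (rule arg_cong)
      also have "\<dots> = (adj_mat s * (X * s)) $$ (0, 0) + k"
        using n by simp
      also have "adj_mat s * (X * s) = adj_mat s * X * s"
        using sc X by (simp add: assoc_mult_mat[of _ n n _ n _ n])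
      finally have "X $$ (0, 0) = (adj_mat s * X * s) $$ (0, 0) + k" .
      moreover have "c s = X $$ (0, 0) - (adj_mat s * X * s) $$ (0, 0)"
        unfolding c_def using sc X n by (intro index_minus_mat) auto
      ultimately show ?thesis by simp
    qed
    have c_mult: "c (g * h) = c g + c h" if gh: "g \<in> P" "h \<in> P" for g h
    proof (rule c_eq)
      show "g * h \<in> P" using subgroup.m_closed[OF P(1) gh] by (simp add: SL_simps)
      note gc = adj_mat_SL(1)[OF PS[OF gh(1)]] and hc = adj_mat_SL(1)[OF PS[OF gh(2)]]
      have "g * h * X = g * (X * h + c h \<cdot>\<^sub>m h)" using assoc_mult_mat[OF gc hc X(1)] twist[OF gh(2)] by simp
      also have "\<dots> = g * (X * h) + c h \<cdot>\<^sub>m (g * h)"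
        using mult_add_distrib_mat[OF gc mult_carrier_mat[OF X(1) hc], of "c h \<cdot>\<^sub>m h"] mult_smult_distrib[OF gc hc] hc by simp
      also have "g * (X * h) = (X * g + c g \<cdot>\<^sub>m g) * h" using assoc_mult_mat[OF gc X(1) hc] twist[OF gh(1)] by simp
      also have "\<dots> = X * (g * h) + c g \<cdot>\<^sub>m (g * h)"
        using add_mult_distrib_mat[OF mult_carrier_mat[OF X(1) gc] smult_carrier_mat[OF gc] hc]
          assoc_mult_mat[OF X(1) gc hc] mult_smult_assoc_mat[OF gc hc] by simp
      also have "\<dots> + c h \<cdot>\<^sub>m (g * h) = X * (g * h) + (c g + c h) \<cdot>\<^sub>m (g * h)"
      proof -
        have ghc: "g * h \<in> carrier_mat n n" "X * (g * h) \<in> carrier_mat n n" using gc hc X by auto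
        then show ?thesis by (intro eq_matI) (auto simp: algebra_simps simp del: index_mult_mat)
      qed
      finally show "g * h * X = X * (g * h) + (c g + c h) \<cdot>\<^sub>m (g * h)" .
    qed
    obtain \<chi> :: "'r mat \<Rightarrow> complex" where \<chi>: "\<forall>y\<in>{y \<in> carrier ?R. redm y \<in> P}. \<forall>y'\<in>{y \<in> carrier ?R. redm y \<in> P}. \<chi> (y * y') = \<chi> y * \<chi> y'"
      "\<forall>z\<in>carrier_mat n n. mtr n z = 0 \<longrightarrow> \<chi> (kmat n z) = \<theta> (mtr n (X * z))"
      using exists_extension[OF \<theta>(1,2) X(1) P c_mult twist] by blast
    have "\<chi> (kmat n z) = \<phi> z" if "z \<in> carrier ?Z" for z
      using that \<chi>(2) X(2) by (simp add: sl_char_apply) (simp add: sl_group_simps)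
    then show "\<exists>\<chi> :: 'r mat \<Rightarrow> complex. (\<forall>y\<in>{y \<in> carrier ?R. redm y \<in> P}. \<forall>y'\<in>{y \<in> carrier ?R. redm y \<in> P}. \<chi> (y \<otimes>\<^bsub>?R\<^esub> y') = \<chi> y * \<chi> y') \<and>
         (\<forall>z\<in>carrier ?Z. \<chi> (kmat n z) = \<phi> z)"
      using \<chi>(1) by (intro exI[of _ \<chi>]) (simp add: SL_simps(2))
  qed
  then obtain \<mu> where \<mu>: "\<And>\<phi> y y'. \<phi> \<in> ?\<Lambda> \<Longrightarrow> y \<in> carrier ?R \<Longrightarrow> y' \<in> carrier ?R \<Longrightarrow> \<mu> \<phi> (y \<otimes>\<^bsub>?R\<^esub> y') = \<mu> \<phi> y * \<mu> (E.tw \<phi> (redm y)) y'"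
    "\<And>\<phi> z. \<phi> \<in> ?\<Lambda> \<Longrightarrow> z \<in> carrier ?Z \<Longrightarrow> \<mu> \<phi> (kmat n z) = (\<phi> z :: complex)" by blast
  have "rep_side ?R ?S ?Z redm (kmat n) adjoint ?\<Lambda> \<mu>"
  proof (intro rep_side.intro rep_side_axioms.intro E.ext_data_axioms \<mu>)
    show "finite ?\<Lambda>" by (intro finite_imageI finite_carrier_mat finite)
    show "restrict (\<lambda>z. 1) (carrier ?Z) \<in> ?\<Lambda>"
    proof
      show "restrict (\<lambda>z. 1) (carrier ?Z) = sl_char \<theta> n (0\<^sub>m n n)"
      proof (rule extensionalityI[of _ "carrier ?Z"])
        fix z assume z: "z \<in> carrier ?Z"
        then have "0\<^sub>m n n * z = 0\<^sub>m n n" by (intro left_mult_zero_mat) (simp add: sl_group_simps)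
        then show "restrict (\<lambda>z. 1) (carrier ?Z) z = sl_char \<theta> n (0\<^sub>m n n) z"
          using z \<theta>(2) by (simp add: sl_char_apply mtr_def)
      qed (auto simp: sl_char_def)
    qed simp
    fix \<phi> assume "\<phi> \<in> ?\<Lambda>"
    then obtain X where X: "X \<in> carrier_mat n n" "\<phi> = sl_char \<theta> n X" by blast
    show "restrict (\<lambda>z. inverse (\<phi> z)) (carrier ?Z) \<in> ?\<Lambda>"
    proof
      show "restrict (\<lambda>z. inverse (\<phi> z)) (carrier ?Z) = sl_char \<theta> n (- X)"
      proof (rule extensionalityI[of _ "carrier ?Z"])
        fix z assume z: "z \<in> carrier ?Z"
        then have zc: "z \<in> carrier_mat n n" by (simp add: sl_group_simps)
        have "mtr n (- X * z) = - mtr n (X * z)"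
          unfolding mtr_mult[OF uminus_carrier_mat[OF X(1)] zc] mtr_mult[OF X(1) zc]
          using X zc by (simp add: sum_negf)
        then show "restrict (\<lambda>z. inverse (\<phi> z)) (carrier ?Z) z = sl_char \<theta> n (- X) z"
          using z X by (simp add: sl_char_apply \<theta>_minus)
      qed (auto simp: sl_char_def)
    qed (use X in simp)
    fix \<psi> assume "\<psi> \<in> ?\<Lambda>"
    then obtain Y where Y: "Y \<in> carrier_mat n n" "\<psi> = sl_char \<theta> n Y" by blast
    show "restrict (\<lambda>z. \<phi> z * \<psi> z) (carrier ?Z) \<in> ?\<Lambda>"
    proof
      show "restrict (\<lambda>z. \<phi> z * \<psi> z) (carrier ?Z) = sl_char \<theta> n (X + Y)"
      proof (rule extensionalityI[of _ "carrier ?Z"])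
        fix z assume z: "z \<in> carrier ?Z"
        then have zc: "z \<in> carrier_mat n n" by (simp add: sl_group_simps)
        have "mtr n ((X + Y) * z) = mtr n (X * z) + mtr n (Y * z)"
          using X Y zc by (simp add: mtr_mult sum.distrib distrib_right)
        then show "restrict (\<lambda>z. \<phi> z * \<psi> z) (carrier ?Z) z = sl_char \<theta> n (X + Y) z"
          using z X Y by (simp add: sl_char_apply \<theta>(1))
      qed (auto simp: sl_char_def)
    qed (use X Y in simp)
  next
    fix z assume z: "z \<in> carrier ?Z" "z \<noteq> \<one>\<^bsub>?Z\<^esub>"
    then have zc: "z \<in> carrier_mat n n" by (simp add: sl_group_simps)
    obtain i j where ij: "i < n" "j < n" "z $$ (i, j) \<noteq> 0"
      using z zc by (auto simp: sl_group_simps) (metis carrier_matD eq_matI index_zero_mat)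
    obtain a where a: "\<theta> a \<noteq> 1" using \<theta>(3) by blast
    \<comment> \<open>A multiple of a matrix unit whose trace pairing with \<open>z\<close> is
      \<open>a\<close>.\<close>
    let ?X = "unit_mat n j i (a / z $$ (i, j))"
    have "mtr n (?X * z) = a"
      using mtr_comm[OF unit_mat_carrier zc] mtr_mult_unit_mat[OF zc ij(2,1)] ij(3) by simp
    then have "sl_char \<theta> n ?X z \<noteq> 1" using z a by (simp add: sl_char_apply)
    then show "\<exists>\<phi>\<in>?\<Lambda>. \<phi> z \<noteq> 1" by (intro bexI[of _ "sl_char \<theta> n ?X"]) auto
  qed
  then show ?thesis by blast
qed

end

section \<open>The two rings\<close>

lift_definition poly_mod_t2_const :: "'a::comm_ring_1 poly_mod_t2 \<Rightarrow> 'a" is "\<lambda>f. coeff f 0"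
proof -
  fix f g :: "'a poly" assume "[:0, 1:] ^ 2 dvd f - g"
  then obtain h where "f - g = [:0, 1:] ^ 2 * h" by (elim dvdE)
  from arg_cong[OF this, of "\<lambda>f. coeff f 0"] show "coeff f 0 = coeff g 0" by (simp add: power2_eq_square)
qed

lift_definition poly_mod_t2_eps :: "'a::comm_ring_1 \<Rightarrow> 'a poly_mod_t2" is "\<lambda>b. [:0, b:]" .

lemma t2_dvd_if_coeffs_0: "coeff f 0 = 0 \<Longrightarrow> coeff f 1 = 0 \<Longrightarrow> [:0, 1:] ^ 2 dvd f"
  for f :: "'a::comm_ring_1 poly"
proof (cases f rule: pCons_cases)
  fix a g assume f: "coeff f 0 = 0" "coeff f 1 = 0" "f = pCons a g"
  show ?thesis
  proof (cases g rule: pCons_cases)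
    fix b h assume "g = pCons b h"
    then have "f = [:0, 1:] ^ 2 * h" using f by (simp add: power2_eq_square)
    then show ?thesis by simp
  qed
qed

lemma coeff_1_0_if_t2_dvd: "[:0, 1:] ^ 2 dvd f \<Longrightarrow> coeff f 1 = 0"
  for f :: "'a::comm_ring_1 poly"
  by (auto simp: power2_eq_square elim!: dvdE)

lemma length_two_poly_mod_t2:
  "length_two (poly_mod_t2_const :: 'q::finite_field poly_mod_t2 \<Rightarrow> 'q) poly_mod_t2_eps"
proof
  show "poly_mod_t2_const (x + y) = poly_mod_t2_const x + poly_mod_t2_const y"
    "poly_mod_t2_const (x * y) = poly_mod_t2_const x * poly_mod_t2_const y"
    for x y :: "'q poly_mod_t2" by (transfer, simp add: coeff_mult_0)+
  show "poly_mod_t2_const 0 = (0::'q)" "poly_mod_t2_const 1 = (1::'q)" by (transfer, simp)+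
  show "\<exists>x. poly_mod_t2_const x = a" for a :: 'q
    by (rule exI[of _ "abs_poly_mod_t2 [:a:]"]) (simp add: poly_mod_t2_const.abs_eq)
  show "poly_mod_t2_eps (a + b) = poly_mod_t2_eps a + poly_mod_t2_eps b" for a b :: 'q
    by transfer simp
  show "a = 0" if "poly_mod_t2_eps a = 0" for a :: 'q
  proof -
    have "[:0, 1:] ^ 2 dvd [:0, a:] - 0"
      using that by (simp only: poly_mod_t2_eps.abs_eq zero_poly_mod_t2_def poly_mod_t2.abs_eq_iff)
    from coeff_1_0_if_t2_dvd[OF this] show ?thesis by simp
  qed
  show "x * poly_mod_t2_eps b = poly_mod_t2_eps (poly_mod_t2_const x * b)" for x and b :: 'q
  proof transfer
    fix f :: "'q poly" and b :: 'q
    show "[:0, 1:] ^ 2 dvd f * [:0, b:] - [:0, coeff f 0 * b:]"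
      by (rule t2_dvd_if_coeffs_0) (auto simp: mult.commute)
  qed
  have "\<exists>b. x = poly_mod_t2_eps b" if "poly_mod_t2_const x = 0" for x :: "'q poly_mod_t2"
    using that
  proof transfer
    fix f :: "'q poly" assume "coeff f 0 = 0"
    then show "\<exists>b. [:0, 1:] ^ 2 dvd f - [:0, b:]"
      by (intro exI[of _ "coeff f 1"] t2_dvd_if_coeffs_0) auto
  qed
  moreover have "poly_mod_t2_const (poly_mod_t2_eps b) = 0" for b :: 'q by transfer simp
  ultimately show "poly_mod_t2_const x = 0 \<longleftrightarrow> x \<in> range poly_mod_t2_eps" for x :: "'q poly_mod_t2" by auto
qed

text \<open>Frobenius is additive with trivial kernel, and an injective self-map of a finite set is
  onto. Surjectivity is what makes the elements \<open>Witt2 0 (b ^ CHAR('q))\<close> exhaust the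
  kernel of \<open>witt_fst\<close>.\<close>

lemma bij_frobenius: "bij (\<lambda>x :: 'q::finite_field. x ^ CHAR('q))"
proof -
  have "x = y" if "x ^ CHAR('q) = y ^ CHAR('q)" for x y :: 'q
  proof -
    have "x ^ CHAR('q) = (x - y) ^ CHAR('q) + y ^ CHAR('q)"
      using freshmans_dream[of "CHAR('q)" "x - y" y] by simp
    then show ?thesis using that by simp
  qed
  then have "inj (\<lambda>x :: 'q. x ^ CHAR('q))" by (rule injI)
  then show ?thesis using finite_UNIV_inj_surj[OF finite] by (simp add: bij_def)
qed

text \<open>
  In \<open>W\<^sub>2\<close>, \<open>(x\<^sub>0, x\<^sub>1) (0, c) = (0, x\<^sub>0\<^sup>p c)\<close>; the substitution \<open>c = b\<^sup>p\<close> makes the action of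
  \<open>x\<^sub>0\<close> linear.
\<close>
lemma length_two_witt2:
  "length_two (witt_fst :: 'q::finite_field witt2 \<Rightarrow> 'q) (\<lambda>b. Witt2 0 (b ^ CHAR('q)))"
proof
  show "witt_fst (x + y) = witt_fst x + witt_fst y" "witt_fst (x * y) = witt_fst x * witt_fst y"
    for x y :: "'q witt2" by (simp_all add: plus_witt2_def times_witt2_def)
  show "witt_fst 0 = (0::'q)" "witt_fst 1 = (1::'q)" by (simp_all add: zero_witt2_def one_witt2_def)
  show "\<exists>x. witt_fst x = a" for a :: 'q by (rule exI[of _ "Witt2 a 0"]) simp
  show "Witt2 0 ((a + b) ^ CHAR('q)) = Witt2 0 (a ^ CHAR('q)) + Witt2 0 (b ^ CHAR('q))" for a b :: 'q
    by (simp add: plus_witt2_def freshmans_dream)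
  show "a = 0" if "Witt2 0 (a ^ CHAR('q)) = 0" for a :: 'q using that by (simp add: zero_witt2_def)
  show "x * Witt2 0 (b ^ CHAR('q)) = Witt2 0 ((witt_fst x * b) ^ CHAR('q))" for x and b :: 'q
    using CHAR_pos[where 'a = 'q] by (simp add: times_witt2_def power_mult_distrib power_0_left)
  show "witt_fst x = 0 \<longleftrightarrow> x \<in> range (\<lambda>b. Witt2 0 (b ^ CHAR('q)))" for x :: "'q witt2"
  proof
    assume x: "witt_fst x = 0"
    obtain b where "witt_snd x = b ^ CHAR('q)" using bij_frobenius[where 'q = 'q] by (metis bij_pointE)
    then have "x = Witt2 0 (b ^ CHAR('q))" using x by (cases x) simp
    then show "x \<in> range (\<lambda>b. Witt2 0 (b ^ CHAR('q)))" by blast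
  qed auto
qed

theorem theorem5p3:
  fixes n d :: nat
  assumes "n \<ge> 1" and "d \<ge> 1"
  shows "card (Irr d (SL TYPE('q::finite_field poly_mod_t2) n))
       = card (Irr d (SL TYPE('q witt2) n))"
proof -
  \<comment> \<open>The same \<open>\<theta>\<close> serves both rings, so that the two sides share
    quotient group, kernel, action and characters, as \<open>rep_pair\<close> requires.\<close>
  obtain \<theta> :: "'q \<Rightarrow> complex" where \<theta>: "\<And>a b. \<theta> (a + b) = \<theta> a * \<theta> b" "\<theta> 0 = 1" "\<exists>a. \<theta> a \<noteq> 1"
    using exists_additive_character by blast
  from length_two.SL_rep_side[OF length_two_poly_mod_t2 assms(1) \<theta>] obtain \<mu>1
    where 1: "rep_side (SL TYPE('q poly_mod_t2) n) (SL TYPE('q) n) (sl_group n) (map_mat poly_mod_t2_const)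
      (length_two.kmat poly_mod_t2_eps n) adjoint (sl_char \<theta> n ` carrier_mat n n) \<mu>1" by blast
  from length_two.SL_rep_side[OF length_two_witt2 assms(1) \<theta>] obtain \<mu>2
    where 2: "rep_side (SL TYPE('q witt2) n) (SL TYPE('q) n) (sl_group n) (map_mat witt_fst)
      (length_two.kmat (\<lambda>b. Witt2 0 (b ^ CHAR('q))) n) adjoint (sl_char \<theta> n ` carrier_mat n n) \<mu>2" by blast
  from rep_pair.card_Irr_eq[OF rep_pair.intro[OF 1 2]] show ?thesis .
qed

end
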